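(* Let $a\ge1$ be an integer, and let \[ \alpha=[0;a,a,a,\ldots]=\frac{\sqrt{a^2+4}-a}{2}. \] Let $f:\mathbb{R}\to\mathbb{R}$ be a $1$-periodic function which is of bounded variation on $[0,1]$ and satisfies $\int_0^1f(x)\,\mathrm{d}x=0$, and let $V(f)$ denote its total variation on $[0,1]$. Let $S_N(\alpha,f)=\sum_{n=1}^Nf(n\alpha)$, and let $B_M\ge 0$ and $A_M$ be defined by \[ A_M=\frac1M\sum_{N=1}^MS_N(\alpha,f),\qquad B_M^2=\frac1M\sum_{N=1}^M(S_N(\alpha,f)-A_M)^2. \] For any integer $M\ge3$ with $B_M>0$ and any $t\in\mathbb{R}$, \[ \frac1M\left|\left\{1\le N\le M : \frac{S_N(\alpha,f)-A_M}{B_M}\le t\right\}\right|=\int_{-\infty}^t\frac{e^{-x^2/2}}{\sqrt{2\pi}}\,\mathrm{d}x+O\left(\frac{V(f)(\log M)^{1/3}(\log\log M)^2}{B_M}\right) \] with an implied constant depending only on $\alpha$ (in particular independent of $f$, $t$ and $M$).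
   Context: $[a_0;a_1,a_2,\ldots]$ denotes a continued fraction. *)

theory Defs
  imports "HOL-Analysis.Analysis"
begin

text \<open>The \<open>n\<close>-th convergent of \<open>[c 0; c 1, c 2, ...]\<close>, i.e. the value of \<open>[c 0; c 1, ..., c n]\<close>.\<close>

primrec cfrac_convergent :: "nat \<Rightarrow> (nat \<Rightarrow> int) \<Rightarrow> real" where
  "cfrac_convergent 0 c = of_int (c 0)"
| "cfrac_convergent (Suc n) c = of_int (c 0) + 1 / cfrac_convergent n (\<lambda>k. c (Suc k))"

definition cfrac_value :: "(nat \<Rightarrow> int) \<Rightarrow> real" where
  "cfrac_value c = lim (\<lambda>n. cfrac_convergent n c)"

definition variation_sums :: "(real \<Rightarrow> real) \<Rightarrow> real \<Rightarrow> real \<Rightarrow> real set" where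
  "variation_sums f a b =
     {(\<Sum>i<n. \<bar>f (x (Suc i)) - f (x i)\<bar>) | n x.
        x 0 = a \<and> x n = b \<and> (\<forall>i<n. x i < x (Suc i))}"

definition bounded_variation_on :: "(real \<Rightarrow> real) \<Rightarrow> real \<Rightarrow> real \<Rightarrow> bool" where
  "bounded_variation_on f a b \<longleftrightarrow> bdd_above (variation_sums f a b)"

text \<open>Meaningful only when \<open>bounded_variation_on f a b\<close> and \<open>a \<le> b\<close>.\<close>

definition total_variation :: "(real \<Rightarrow> real) \<Rightarrow> real \<Rightarrow> real \<Rightarrow> real" where
  "total_variation f a b = Sup (variation_sums f a b)"

definition birkhoff_sum :: "real \<Rightarrow> (real \<Rightarrow> real) \<Rightarrow> nat \<Rightarrow> real" where
  "birkhoff_sum \<alpha> f N = (\<Sum>n=1..N. f (real n * \<alpha>))"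

definition birkhoff_mean :: "real \<Rightarrow> (real \<Rightarrow> real) \<Rightarrow> nat \<Rightarrow> real" where
  "birkhoff_mean \<alpha> f M = (1 / real M) * (\<Sum>N=1..M. birkhoff_sum \<alpha> f N)"

definition birkhoff_sd :: "real \<Rightarrow> (real \<Rightarrow> real) \<Rightarrow> nat \<Rightarrow> real" where
  "birkhoff_sd \<alpha> f M =
     sqrt ((1 / real M) * (\<Sum>N=1..M. (birkhoff_sum \<alpha> f N - birkhoff_mean \<alpha> f M)\<^sup>2))"

end

theory Submission
  imports Defs "HOL-Probability.Distributions" "HOL-Number_Theory.Cong" "HOL-Real_Asymp.Real_Asymp"
begin

text \<open>
  Let \<open>N\<close> be uniformly distributed on \<open>{1..M}\<close> and let \<open>S N\<close> be the Birkhoff sum. The theorem holds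
  because, read in the right system of numeration, \<open>S N\<close> is very nearly a sum of bounded random
  variables in which only neighbours depend on each other.

  Let \<open>q 1, q 2, \<dots>\<close> be the denominators of the convergents of \<open>\<alpha>\<close>; they grow like
  \<open>\<alpha> ^ (- k)\<close>, and \<open>q (k + 1) * \<alpha>\<close> is an integer up to \<open>\<alpha> ^ (k + 1)\<close>. Fix a block length \<open>l\<close> of
  order \<open>ln (ln M)\<close>, put \<open>R i = q (i * l + 1)\<close>, and draw independent digits \<open>U i\<close>, uniform on
  \<open>{..<R (i + 1) div R i}\<close>. Then \<open>\<Sum>i<J. R i * U i\<close> is uniform on \<open>{..<M}\<close> up to an error of order
  \<open>J * \<alpha> ^ l\<close> in total variation (\<open>partial_value_almost_uniform\<close>), since rounding down the quotient
  \<open>R (i + 1) div R i\<close> loses fewer than \<open>R i\<close> of \<open>R (i + 1)\<close> values. With \<open>l\<close> a large multiple of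
  \<open>ln (ln M)\<close> this error is a high negative power of \<open>ln M\<close>.

  Along such an \<open>N\<close> the orbit splits into \<open>J\<close> blocks; block \<open>j\<close> has \<open>R j * U j\<close> steps and starts at
  \<open>(\<Sum>i>j. R i * U i) * \<alpha>\<close>. Modulo 1 the digits from \<open>j + 4\<close> on move this starting point by much
  less than the spacing of the orbit at scale \<open>R (j + 1)\<close>. Dropping them changes the block sum by
  \<open>O(V * \<alpha> ^ l)\<close> on average, because the total oscillation of \<open>f\<close> over small neighbourhoods of orbit
  points is bounded by \<open>V\<close> (\<open>block_approx\<close>). What remains depends on four consecutive digits and is
  bounded by a multiple of \<open>V * l\<^sup>2\<close>, by the Denjoy--Koksma inequality and algebraic identities
  between the \<open>q k\<close> (\<open>block_bound\<close>).

  Stein's method for locally dependent summands (\<open>stein_local_dependence\<close>) now compares a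
  distribution function smoothed at scale \<open>\<delta>\<close> with the Gaussian one. If the summands are bounded by
  \<open>\<beta>\<close>, of order \<open>V * l\<^sup>2 / B\<close>, the error is of order \<open>J * \<beta> ^ 3 / \<delta> + sqrt J * \<beta>\<^sup>2\<close>, and removing
  the smoothing costs \<open>\<delta>\<close>. For \<open>\<delta> = V * (ln M) powr (1/3) * (ln (ln M))\<^sup>2 / B\<close>, which is the error
  allowed in the theorem, \<open>J * \<beta> ^ 3\<close> is \<open>O(\<delta> ^ 3)\<close>, so everything is \<open>O(\<delta>)\<close> when \<open>\<delta> \<le> 1\<close>. When
  \<open>\<delta> > 1\<close>, or when \<open>M\<close> is bounded, the assertion is trivial.

  Bounded variation enters only through a nondecreasing \<open>v\<close> whose increments dominate those of
  \<open>f\<close> (\<open>bounded_variation_majorant\<close>), so that sums of oscillations telescope.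
\<close>

section \<open>Solving Stein's equation for the Gaussian law\<close>

lemma DERIV_std_normal_density:
  "(std_normal_density has_real_derivative - (x * std_normal_density x)) (at x)"
  unfolding std_normal_density_def[abs_def]
  by (auto intro!: derivative_eq_intros simp: field_simps power2_eq_square)

text \<open>
  On \<open>{w..}\<close> the constant \<open>w\<close> is at most \<open>x\<close>, and \<open>x * std_normal_density x\<close> has the antiderivative
  \<open>- std_normal_density x\<close>. This is the Mills ratio bound.
\<close>

lemma std_normal_upper_tail:
  assumes w: "w \<ge> 0"
  shows "w * (LBINT x:{w..}. std_normal_density x) \<le> std_normal_density w"
proof -
  have int1: "set_integrable lborel {w..} (\<lambda>x. w * std_normal_density x)"
    unfolding set_integrable_def by (intro integrable_mult_indicator) auto
  have int2: "set_integrable lborel {w..} (\<lambda>x. x * std_normal_density x)"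
    unfolding set_integrable_def using integrable_std_normal_moment[of 1]
    by (intro integrable_mult_indicator) (auto simp: mult.commute)
  have lim: "((\<lambda>x. - std_normal_density x) \<longlongrightarrow> 0) at_top"
    unfolding std_normal_density_def by real_asymp
  have "(\<integral>\<^sup>+x. ennreal (x * std_normal_density x) * indicator {w ..} x \<partial>lborel)
      = ennreal (0 - (- std_normal_density w))"
    using w by (intro nn_integral_FTC_atLeast lim) 
      (auto intro!: derivative_eq_intros DERIV_std_normal_density)
  moreover have "(\<integral>\<^sup>+x. ennreal (x * std_normal_density x) * indicator {w ..} x \<partial>lborel)
      = ennreal (LBINT x:{w..}. x * std_normal_density x)"
    using w integrable_std_normal_moment[of 1]
    by (intro nn_set_integral_eq_set_integral) (auto simp: mult.commute)
  moreover have "0 \<le> (LBINT x:{w..}. x * std_normal_density x)"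
    unfolding set_lebesgue_integral_def using w
    by (intro Bochner_Integration.integral_nonneg) (auto simp: indicator_def)
  ultimately have "(LBINT x:{w..}. x * std_normal_density x) = std_normal_density w"
    by simp
  moreover have "(LBINT x:{w..}. w * std_normal_density x) \<le> (LBINT x:{w..}. x * std_normal_density x)"
    by (intro set_integral_mono int1 int2) (auto intro!: mult_right_mono)
  ultimately show ?thesis by simp
qed

lemma std_normal_lower_tail:
  assumes w: "w \<le> 0"
  shows "- w * (LBINT x:{..w}. std_normal_density x) \<le> std_normal_density w"
proof -
  have "(LBINT x:{..w}. std_normal_density x) = (LBINT x:{-w..}. std_normal_density x)"
    unfolding set_lebesgue_integral_def
    by (subst lborel_integral_real_affine[of "-1" _ 0])
       (auto simp: std_normal_density_def indicator_def intro!: Bochner_Integration.integral_cong)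
  then show ?thesis
    using std_normal_upper_tail[of "-w"] w by (simp add: std_normal_density_def)
qed

lemma set_integrable_std_normal_density [simp]:
  "A \<in> sets borel \<Longrightarrow> set_integrable lborel A std_normal_density"
  unfolding set_integrable_def by (intro integrable_mult_indicator) auto

lemma std_normal_cdf_bounds:
  "0 \<le> (LBINT x:{..t}. std_normal_density x)"
  "(LBINT x:{..t}. std_normal_density x) + (LBINT x:{t<..}. std_normal_density x) = 1"
proof -
  show "0 \<le> (LBINT x:{..t}. std_normal_density x)"
    unfolding set_lebesgue_integral_def
    by (intro Bochner_Integration.integral_nonneg) (auto simp: indicator_def)
  have "(LBINT x:{..t} \<union> {t<..}. std_normal_density x)
      = (LBINT x:{..t}. std_normal_density x) + (LBINT x:{t<..}. std_normal_density x)"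
    by (intro set_integral_Un) auto
  moreover have "{..t} \<union> {t<..} = (UNIV :: real set)" by auto
  ultimately show "(LBINT x:{..t}. std_normal_density x) + (LBINT x:{t<..}. std_normal_density x) = 1"
    by (simp add: set_lebesgue_integral_def)
qed

lemma std_normal_cdf_lipschitz:
  assumes "0 \<le> e"
  shows "(LBINT x:{..t+e}. std_normal_density x) \<le> (LBINT x:{..t}. std_normal_density x) + e"
proof -
  have "(LBINT x:{..t+e}. std_normal_density x)
      = (LBINT x:{..t} \<union> {t<..t+e}. std_normal_density x)"
    using assms by (intro arg_cong2[where f="\<lambda>A f. set_lebesgue_integral lborel A f"]) auto
  also have "\<dots> = (LBINT x:{..t}. std_normal_density x) + (LBINT x:{t<..t+e}. std_normal_density x)"
    by (intro set_integral_Un) auto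
  also have "(LBINT x:{t<..t+e}. std_normal_density x) \<le> (LBINT x:{t<..t+e}. 1)"
  proof (intro set_integral_mono)
    fix x :: real
    have "1 \<le> sqrt (2 * pi)" using pi_gt3 by simp
    then show "std_normal_density x \<le> 1"
      unfolding std_normal_density_def 
      by (intro mult_le_one) (auto simp: divide_le_eq)
  next
    show "set_integrable lborel {t<..t+e} (\<lambda>_. 1::real)"
      using assms by (simp add: set_integrable_def integrable_indicator_iff)
  qed auto
  also have "(LBINT x:{t<..t+e}. 1) = e" using assms by (simp add: set_lebesgue_integral_def)
  finally show ?thesis by simp
qed

lemma indefinite_integral_derivative:
  fixes g :: "real \<Rightarrow> real"
  assumes g: "integrable lborel g" and cont: "continuous_on UNIV g"
  shows "((\<lambda>w. LBINT x:{..w}. g x) has_real_derivative g w) (at w)"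
proof -
  have gI: "set_integrable lborel A g" if "A \<in> sets borel" for A
    unfolding set_integrable_def using that by (intro integrable_mult_indicator g) auto
  have split: "(LBINT x:{..u}. g x) = (LBINT x:{..w-1}. g x) + integral {w-1..u} g" if "u \<ge> w-1" for u
  proof -
    have "(LBINT x:{..w-1} \<union> {w-1<..u}. g x) = (LBINT x:{..w-1}. g x) + (LBINT x:{w-1<..u}. g x)"
      by (intro set_integral_Un gI) auto
    moreover have "{..w-1} \<union> {w-1<..u} = {..u}" using that by auto
    moreover have "(LBINT x:{w-1<..u}. g x) = (LBINT x:{w-1..u}. g x)"
      unfolding set_lebesgue_integral_def
      by (intro integral_cong_AE borel_measurable_scaleR borel_measurable_indicator
            borel_measurable_integrable[OF g] AE_I[where N="{w-1}"])
         (auto simp: indicator_def)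
    moreover have "(LBINT x:{w-1..u}. g x) = integral {w-1..u} g"
      by (intro set_borel_integral_eq_integral gI) auto
    ultimately show ?thesis by simp
  qed
  have "((\<lambda>u. integral {w-1..u} g) has_real_derivative g w) (at w within {w-1..w+1})"
    by (intro integral_has_real_derivative continuous_on_subset[OF cont]) auto
  then have "((\<lambda>u. integral {w-1..u} g) has_real_derivative g w) (at w)"
    by (simp add: at_within_Icc_at)
  then have "((\<lambda>u. (LBINT x:{..w-1}. g x) + integral {w-1..u} g) has_real_derivative g w) (at w)"
    by (auto intro!: derivative_eq_intros)
  then show ?thesis
  proof (rule DERIV_cong_ev[THEN iffD1, rotated -1])
    show "\<forall>\<^sub>F u in nhds w. (LBINT x:{..w-1}. g x) + integral {w-1..u} g = (LBINT x:{..u}. g x)"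
    proof -
      have "\<forall>\<^sub>F u in nhds w. u \<in> {w-1<..}"
        by (rule eventually_nhds_in_open) auto
      then show ?thesis by eventually_elim (rule split[symmetric], simp)
    qed
  qed auto
qed

text \<open>
  Stein's equation \<open>f' w = w * f w + h w - Nh\<close> is solved by \<open>f w = G w / std_normal_density w\<close>, where \<open>G w\<close>
  integrates \<open>std_normal_density x * (h x - Nh)\<close> over \<open>{..w}\<close>. As the full integral vanishes,
  \<open>\<bar>G w\<bar>\<close> is bounded by either Gaussian tail at \<open>w\<close>, and the Mills ratio gives \<open>\<bar>w * f w\<bar> \<le> 1\<close>. Both
  bounds on \<open>f\<close> and \<open>f'\<close> follow from this.
\<close>

lemma stein_solution:
  fixes h :: "real \<Rightarrow> real"
  assumes cont: "continuous_on UNIV h" and h: "\<And>x. 0 \<le> h x" "\<And>x. h x \<le> 1"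
  defines "Nh \<equiv> (LINT x|lborel. std_normal_density x * h x)"
  obtains f f' where 
    "\<And>w. (f has_real_derivative f' w) (at w)"
    "\<And>w. f' w = w * f w + h w - Nh" "\<And>w. \<bar>f w\<bar> \<le> 5" "\<And>w. \<bar>f' w\<bar> \<le> 2"
proof -
  have hm [measurable]: "h \<in> borel_measurable borel"
    using cont by (rule borel_measurable_continuous_onI)
  let ?d = std_normal_density
  have int: "integrable lborel (\<lambda>x. ?d x * h x)"
    by (rule Bochner_Integration.integrable_bound[of _ ?d]) 
       (auto simp: abs_mult h mult_left_le)
  have Nh: "0 \<le> Nh" "Nh \<le> 1"
  proof -
    show "0 \<le> Nh" unfolding Nh_def by (intro Bochner_Integration.integral_nonneg) (auto simp: h)
    have "Nh \<le> (LINT x|lborel. ?d x)" unfolding Nh_def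
      by (intro integral_mono int) (auto simp: h mult_left_le)
    then show "Nh \<le> 1" by simp
  qed
  define g where "g = (\<lambda>x. ?d x * (h x - Nh))"
  have g_int: "integrable lborel g"
    using int by (simp add: g_def right_diff_distrib)
  have g_cont: "continuous_on UNIV g"
    unfolding g_def std_normal_density_def by (intro continuous_intros cont) auto
  have g_bd: "\<bar>g x\<bar> \<le> ?d x" for x
  proof -
    have "\<bar>h x - Nh\<bar> \<le> 1" using h[of x] Nh by auto
    then show ?thesis by (simp add: g_def abs_mult mult_left_le)
  qed
  define G where "G = (\<lambda>w. LBINT x:{..w}. g x)"
  have gI: "set_integrable lborel A g" if "A \<in> sets borel" for A
    unfolding set_integrable_def using that by (intro integrable_mult_indicator g_int) auto
  have set_bd: "\<bar>LBINT x:A. g x\<bar> \<le> (LBINT x:A. ?d x)" if "A \<in> sets borel" for A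
  proof -
    have "\<bar>LBINT x:A. g x\<bar> \<le> (LBINT x:A. \<bar>g x\<bar>)"
      using set_integral_norm_bound[OF gI[OF that]] by simp
    also have "\<dots> \<le> (LBINT x:A. ?d x)"
      using g_bd gI[OF that] by (intro set_integral_mono) (auto simp: that intro: set_integrable_abs)
    finally show ?thesis .
  qed
  have "(LINT x|lborel. g x) = 0"
    using int by (simp add: g_def right_diff_distrib Nh_def)
  moreover have "(LBINT x:{..w} \<union> {w<..}. g x) = (LBINT x:{..w}. g x) + (LBINT x:{w<..}. g x)" for w
    by (intro set_integral_Un gI) auto
  moreover have "{..w} \<union> {w<..} = (UNIV :: real set)" for w by auto
  ultimately have G_alt: "G w = - (LBINT x:{w<..}. g x)" for w
    by (simp add: G_def set_lebesgue_integral_def eq_neg_iff_add_eq_0)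
  have G_le1: "\<bar>G w\<bar> \<le> (LBINT x:{..w}. ?d x)" for w
    using set_bd[of "{..w}"] by (simp add: G_def)
  have G_le2: "\<bar>G w\<bar> \<le> (LBINT x:{w..}. ?d x)" for w
  proof -
    have "\<bar>G w\<bar> \<le> (LBINT x:{w<..}. ?d x)" using set_bd[of "{w<..}"] by (simp add: G_alt)
    also have "\<dots> \<le> (LBINT x:{w..}. ?d x)" 
      unfolding set_lebesgue_integral_def
      by (intro integral_mono set_integrable_std_normal_density[unfolded set_integrable_def])
         (auto simp: indicator_def)
    finally show ?thesis .
  qed
  have G_le3: "\<bar>G w\<bar> \<le> 1" for w
  proof -
    have "0 \<le> (LBINT x:{w<..}. ?d x)"
      unfolding set_lebesgue_integral_def
      by (intro Bochner_Integration.integral_nonneg) (auto simp: indicator_def)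
    then show ?thesis using G_le1[of w] std_normal_cdf_bounds(2)[of w] by linarith
  qed
  have d_pos: "?d w > 0" for w by (simp add: normal_density_pos)
  have wG: "\<bar>w * G w\<bar> \<le> ?d w" for w
  proof (cases "w \<ge> 0")
    case True
    have "\<bar>w * G w\<bar> \<le> w * (LBINT x:{w..}. ?d x)"
      using True G_le2[of w] by (auto simp: abs_mult intro: mult_left_mono)
    then show ?thesis using std_normal_upper_tail[OF True] by linarith
  next
    case False
    have "\<bar>w * G w\<bar> \<le> - w * (LBINT x:{..w}. ?d x)"
      using False G_le1[of w] by (auto simp: abs_mult intro!: mult_left_mono_neg)
    then show ?thesis using std_normal_lower_tail[of w] False by linarith
  qed
  define f where "f = (\<lambda>w. G w / ?d w)"
  define f' where "f' = (\<lambda>w. w * f w + h w - Nh)"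
  have wf: "\<bar>w * f w\<bar> \<le> 1" for w
    using wG[of w] d_pos[of w] by (simp add: f_def abs_mult)
  have f5: "\<bar>f w\<bar> \<le> 5" for w
  proof (cases "\<bar>w\<bar> \<ge> 1")
    case True
    have "1 * \<bar>f w\<bar> \<le> \<bar>w\<bar> * \<bar>f w\<bar>" by (intro mult_right_mono True) auto
    then show ?thesis using wf[of w] by (simp add: abs_mult)
  next
    case False
    (* the reciprocal density sqrt (2 pi) exp (w^2 / 2) has square at most 8 * 3 < 25 *)
    then have "w\<^sup>2 \<le> 1" using abs_square_le_1[of w] by auto
    then have "exp (w\<^sup>2) \<le> 3"
      using exp_le order_trans[of "exp (w\<^sup>2)" "exp 1" 3] by simp
    then have "(2 * pi) * exp (w\<^sup>2) \<le> 8 * 3"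
      using pi_less_4 by (intro mult_mono) auto
    moreover have "(sqrt (2 * pi) * exp (w\<^sup>2 / 2))\<^sup>2 = (2 * pi) * exp (w\<^sup>2)"
    proof -
      have "(exp (w\<^sup>2 / 2))\<^sup>2 = exp (2 * (w\<^sup>2 / 2))" by (rule exp_double[symmetric])
      moreover have "(sqrt (2 * pi))\<^sup>2 = 2 * pi" by simp
      ultimately show ?thesis by (simp only: power_mult_distrib times_divide_eq_right) auto
    qed
    ultimately have "(sqrt (2 * pi) * exp (w\<^sup>2 / 2))\<^sup>2 \<le> 5\<^sup>2" by simp
    then have "sqrt (2 * pi) * exp (w\<^sup>2 / 2) \<le> 5"
      by (rule power2_le_imp_le) simp
    moreover have "f w = G w * (sqrt (2 * pi) * exp (w\<^sup>2 / 2))"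
    proof -
      have "exp (- w\<^sup>2 / 2) = inverse (exp (w\<^sup>2 / 2))"
        using exp_minus[of "w\<^sup>2 / 2"] by (simp only: minus_divide_left)
      then show ?thesis by (simp only: f_def std_normal_density_def divide_inverse
            inverse_mult_distrib inverse_inverse_eq mult_1_left inverse_1)
    qed
    moreover have "\<bar>G w * (sqrt (2 * pi) * exp (w\<^sup>2 / 2))\<bar> \<le> 1 * (sqrt (2 * pi) * exp (w\<^sup>2 / 2))"
      unfolding abs_mult using G_le3[of w] by (intro mult_mono) auto
    ultimately show ?thesis by linarith
  qed
  show ?thesis
  proof (rule that[of f f'])
    fix w
    show "f' w = w * f w + h w - Nh" by (simp add: f'_def)
    show "\<bar>f w\<bar> \<le> 5" by (rule f5)
    have "\<bar>h w - Nh\<bar> \<le> 1" using h[of w] Nh by auto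
    then show "\<bar>f' w\<bar> \<le> 2" using wf[of w] unfolding f'_def by linarith
    have "(G has_real_derivative g w) (at w)"
      unfolding G_def by (rule indefinite_integral_derivative[OF g_int g_cont])
    then have "(f has_real_derivative (g w * ?d w - G w * (- (w * ?d w))) / (?d w * ?d w)) (at w)"
      unfolding f_def using d_pos[of w] by (intro DERIV_divide DERIV_std_normal_density) auto
    moreover have "(g w * ?d w - G w * (- (w * ?d w))) / (?d w * ?d w) = f' w"
      using d_pos[of w] by (simp add: f'_def f_def g_def field_simps)
    ultimately show "(f has_real_derivative f' w) (at w)" by simp
  qed
qed


text \<open>
  A Lipschitz substitute for the indicator of \<open>{..t}\<close>: it equals 1 on \<open>{..t}\<close>, vanishes on \<open>{t + e..}\<close> and
  is linear in between.
\<close>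

definition ramp :: "real \<Rightarrow> real \<Rightarrow> real \<Rightarrow> real" where
  "ramp t e x = max 0 (min 1 ((t + e - x) / e))"

lemma ramp_bounds: "0 \<le> ramp t e x" "ramp t e x \<le> 1"
  by (auto simp: ramp_def)

lemma ramp_eq_1: "e > 0 \<Longrightarrow> x \<le> t \<Longrightarrow> ramp t e x = 1"
  by (auto simp: ramp_def field_simps)

lemma ramp_eq_0: "e > 0 \<Longrightarrow> x \<ge> t + e \<Longrightarrow> ramp t e x = 0"
  by (auto simp: ramp_def field_simps)

lemma continuous_on_ramp: "e > 0 \<Longrightarrow> continuous_on A (ramp t e)"
  unfolding ramp_def[abs_def] by (intro continuous_intros) auto

lemma ramp_lipschitz:
  assumes "e > 0"
  shows "\<bar>ramp t e x - ramp t e y\<bar> \<le> \<bar>x - y\<bar> / e"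
proof -
  have "\<bar>ramp t e x - ramp t e y\<bar> \<le> \<bar>(t + e - x) / e - (t + e - y) / e\<bar>"
    unfolding ramp_def by (auto simp: max_def min_def)
  also have "\<dots> = \<bar>x - y\<bar> / e"
    using assms by (simp flip: diff_divide_distrib add: abs_minus_commute)
  finally show ?thesis .
qed

lemma std_normal_ramp:
  assumes e: "e > 0"
  shows "(LBINT x:{..t}. std_normal_density x) \<le> (LINT x|lborel. std_normal_density x * ramp t e x)"
    and "(LINT x|lborel. std_normal_density x * ramp t e x) \<le> (LBINT x:{..t+e}. std_normal_density x)"
proof -
  have [measurable]: "ramp t e \<in> borel_measurable borel"
    using continuous_on_ramp[OF e] by (rule borel_measurable_continuous_onI)
  have int: "integrable lborel (\<lambda>x. std_normal_density x * ramp t e x)"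
    by (rule Bochner_Integration.integrable_bound[of _ std_normal_density]) 
       (auto simp: abs_mult ramp_bounds mult_left_le)
  show "(LBINT x:{..t}. std_normal_density x) \<le> (LINT x|lborel. std_normal_density x * ramp t e x)"
    unfolding set_lebesgue_integral_def using ramp_bounds ramp_eq_1[OF e]
    by (intro integral_mono int set_integrable_std_normal_density[unfolded set_integrable_def])
       (auto simp: indicator_def)
  show "(LINT x|lborel. std_normal_density x * ramp t e x) \<le> (LBINT x:{..t+e}. std_normal_density x)"
    unfolding set_lebesgue_integral_def using ramp_bounds ramp_eq_0[OF e]
    by (intro integral_mono int set_integrable_std_normal_density[unfolded set_integrable_def])
       (auto simp: indicator_def mult_left_le)
qed

section \<open>Averages over finite product sets\<close>

definition avg :: "'a set \<Rightarrow> ('a \<Rightarrow> real) \<Rightarrow> real" where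
  "avg A X = (\<Sum>x\<in>A. X x) / real (card A)"

lemma avg_add: "avg A (\<lambda>x. X x + Y x) = avg A X + avg A Y"
  by (simp add: avg_def sum.distrib add_divide_distrib)

lemma avg_diff: "avg A (\<lambda>x. X x - Y x) = avg A X - avg A Y"
  by (simp add: avg_def sum_subtractf diff_divide_distrib)

lemma avg_cmult: "avg A (\<lambda>x. c * X x) = c * avg A X"
  by (simp add: avg_def sum_distrib_left)

lemma avg_divide: "avg A (\<lambda>x. X x / c) = avg A X / c"
  by (simp add: avg_def flip: sum_divide_distrib)

lemma avg_sum: "avg A (\<lambda>x. \<Sum>i\<in>I. X i x) = (\<Sum>i\<in>I. avg A (X i))"
  unfolding avg_def by (subst sum.swap) (simp flip: sum_divide_distrib)

lemma avg_const: "finite A \<Longrightarrow> A \<noteq> {} \<Longrightarrow> avg A (\<lambda>_. c) = c"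
  by (simp add: avg_def)

lemma avg_mono: "(\<And>x. x \<in> A \<Longrightarrow> X x \<le> Y x) \<Longrightarrow> avg A X \<le> avg A Y"
  by (auto simp: avg_def intro!: divide_right_mono sum_mono)

lemma avg_cong: "(\<And>x. x \<in> A \<Longrightarrow> X x = Y x) \<Longrightarrow> avg A X = avg A Y"
  by (simp add: avg_def)

lemma avg_abs: "\<bar>avg A X\<bar> \<le> avg A (\<lambda>x. \<bar>X x\<bar>)"
  by (auto simp: avg_def abs_divide intro!: divide_right_mono sum_abs)

lemma avg_le_of_abs_diff:
  assumes "\<And>x. x \<in> A \<Longrightarrow> \<bar>X x - Y x\<bar> \<le> Z x"
  shows "\<bar>avg A X - avg A Y\<bar> \<le> avg A Z"
proof -
  have "\<bar>avg A X - avg A Y\<bar> \<le> avg A (\<lambda>x. \<bar>X x - Y x\<bar>)"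
    unfolding avg_diff[symmetric] by (rule avg_abs)
  also have "\<dots> \<le> avg A Z" using assms by (rule avg_mono)
  finally show ?thesis .
qed

lemma avg_bound: 
  assumes "finite A" "A \<noteq> {}" "\<And>x. x \<in> A \<Longrightarrow> \<bar>X x\<bar> \<le> c" 
  shows "\<bar>avg A X\<bar> \<le> c"
  using avg_abs[of A X] avg_mono[of A "\<lambda>x. \<bar>X x\<bar>" "\<lambda>_. c"] avg_const[of A c] assms by force

lemma avg_square_le: "(avg A X)\<^sup>2 \<le> avg A (\<lambda>x. (X x)\<^sup>2)"
proof (cases "finite A \<and> A \<noteq> {}")
  case True
  then have "(\<Sum>x\<in>A. X x)\<^sup>2 \<le> (\<Sum>x\<in>A. (X x)\<^sup>2) * real (card A)"
    by (intro sum_squared_le_sum_of_squares)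
  then have "(\<Sum>x\<in>A. X x)\<^sup>2 / (real (card A))\<^sup>2 \<le> (\<Sum>x\<in>A. (X x)\<^sup>2) * real (card A) / (real (card A))\<^sup>2"
    by (rule divide_right_mono) simp
  then show ?thesis using True by (simp add: avg_def power_divide power2_eq_square)
qed (auto simp: avg_def)

lemma avg_abs_le_sqrt: "avg A (\<lambda>x. \<bar>X x\<bar>) \<le> sqrt (avg A (\<lambda>x. (X x)\<^sup>2))"
  using avg_square_le[of A "\<lambda>x. \<bar>X x\<bar>"] by (intro real_le_rsqrt) simp

text \<open>
  Independence is expressed through coordinates: under the uniform distribution on a product set,
  functions of disjoint sets of coordinates are independent.
\<close>

definition depends_on :: "(('i \<Rightarrow> 'b) \<Rightarrow> real) \<Rightarrow> 'i set \<Rightarrow> bool" where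
  "depends_on X A \<longleftrightarrow> (\<forall>\<omega> \<omega>'. (\<forall>i\<in>A. \<omega> i = \<omega>' i) \<longrightarrow> X \<omega> = X \<omega>')"

lemma depends_onD: "depends_on X A \<Longrightarrow> (\<And>i. i \<in> A \<Longrightarrow> \<omega> i = \<omega>' i) \<Longrightarrow> X \<omega> = X \<omega>'"
  by (auto simp: depends_on_def)

lemma depends_on_mono: "depends_on X A \<Longrightarrow> A \<subseteq> B \<Longrightarrow> depends_on X B"
  unfolding depends_on_def by (meson subsetD)

lemma depends_on_sum: "(\<And>i. i \<in> I \<Longrightarrow> depends_on (X i) A) \<Longrightarrow> depends_on (\<lambda>\<omega>. \<Sum>i\<in>I. X i \<omega>) A"
  unfolding depends_on_def by (intro allI impI sum.cong refl) metis

lemma depends_on_mult: "depends_on X A \<Longrightarrow> depends_on Y A \<Longrightarrow> depends_on (\<lambda>\<omega>. X \<omega> * Y \<omega>) A"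
  unfolding depends_on_def by metis

lemma depends_on_compose: "depends_on X A \<Longrightarrow> depends_on (\<lambda>\<omega>. g (X \<omega>)) A"
  unfolding depends_on_def by metis

lemma avg_mult_indep:
  fixes X Y :: "('i \<Rightarrow> 'b) \<Rightarrow> real" and I :: "'i set" and R :: "'i \<Rightarrow> 'b set"
  assumes X: "depends_on X A" and Y: "depends_on Y B" and disj: "A \<inter> B = {}"
  defines "\<Omega> \<equiv> PiE I R"
  shows "avg \<Omega> (\<lambda>\<omega>. X \<omega> * Y \<omega>) = avg \<Omega> X * avg \<Omega> Y"
proof -
  define mrg where "mrg = (\<lambda>(\<omega> :: 'i \<Rightarrow> 'b) \<omega>' i. if i \<in> A then \<omega> i else \<omega>' i)"
  have mrg_in: "mrg \<omega> \<omega>' \<in> \<Omega>" if "\<omega> \<in> \<Omega>" "\<omega>' \<in> \<Omega>" for \<omega> \<omega>'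
    using that unfolding \<Omega>_def mrg_def by (auto simp: PiE_iff extensional_def)
  have X': "X (mrg \<omega> \<omega>') = X \<omega>" for \<omega> \<omega>'
    by (rule depends_onD[OF X]) (auto simp: mrg_def)
  have Y': "Y (mrg \<omega> \<omega>') = Y \<omega>'" for \<omega> \<omega>'
    using disj by (intro depends_onD[OF Y]) (auto simp: mrg_def)
  (* exchanging the coordinates outside A between the two points is an involution of \<Omega> \<times> \<Omega> *)
  have "(\<Sum>p\<in>\<Omega>\<times>\<Omega>. X (fst p) * Y (snd p)) = (\<Sum>p\<in>\<Omega>\<times>\<Omega>. X (fst p) * Y (fst p))"
    by (rule sum.reindex_bij_witness[where i="\<lambda>p. (mrg (fst p) (snd p), mrg (snd p) (fst p))"
          and j="\<lambda>p. (mrg (fst p) (snd p), mrg (snd p) (fst p))"])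
       (auto simp: mrg_in X' Y', auto simp: mrg_def)
  moreover have "(\<Sum>p\<in>\<Omega>\<times>\<Omega>. X (fst p) * Y (snd p)) = (\<Sum>\<omega>\<in>\<Omega>. X \<omega>) * (\<Sum>\<omega>\<in>\<Omega>. Y \<omega>)"
    by (simp add: sum_product sum.cartesian_product split_def)
  moreover have "(\<Sum>p\<in>\<Omega>\<times>\<Omega>. X (fst p) * Y (fst p)) = real (card \<Omega>) * (\<Sum>\<omega>\<in>\<Omega>. X \<omega> * Y \<omega>)"
    using sum.cartesian_product[of "\<lambda>\<omega> \<omega>'. X \<omega> * Y \<omega>" \<Omega> \<Omega>]
    by (simp add: split_def sum_distrib_left)
  ultimately have "real (card \<Omega>) * (\<Sum>\<omega>\<in>\<Omega>. X \<omega> * Y \<omega>) = (\<Sum>\<omega>\<in>\<Omega>. X \<omega>) * (\<Sum>\<omega>\<in>\<Omega>. Y \<omega>)"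
    by simp
  then show ?thesis by (cases "card \<Omega> = 0") (auto simp: avg_def field_simps)
qed

text \<open>
  In the variance only the pairs \<open>(j, k)\<close> at distance less than \<open>s\<close> survive; there are at most \<open>2 * s\<close> of
  them for each \<open>j\<close>, and each contributes at most \<open>4 * c\<^sup>2\<close>.
\<close>

lemma avg_square_local_sum:
  fixes T :: "nat \<Rightarrow> (nat \<Rightarrow> 'b) \<Rightarrow> real"
  assumes fin: "finite \<Omega>" "\<Omega> \<noteq> {}" and \<Omega>: "\<Omega> = PiE I R"
    and dep: "\<And>j. j < J \<Longrightarrow> depends_on (T j) (D j)"
    and disj: "\<And>j k. j + s \<le> k \<Longrightarrow> D j \<inter> D k = {}"
    and bd: "\<And>j \<omega>. j < J \<Longrightarrow> \<omega> \<in> \<Omega> \<Longrightarrow> \<bar>T j \<omega>\<bar> \<le> c"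
  shows "avg \<Omega> (\<lambda>\<omega>. ((\<Sum>j<J. T j \<omega>) - avg \<Omega> (\<lambda>\<omega>. \<Sum>j<J. T j \<omega>))\<^sup>2) \<le> real J * real (2 * s) * (4 * c\<^sup>2)"
proof -
  define U where "U = (\<lambda>j \<omega>. T j \<omega> - avg \<Omega> (T j))"
  have depU: "depends_on (U j) (D j)" if "j < J" for j
    unfolding U_def by (rule depends_on_compose[OF dep[OF that]])
  have U0: "avg \<Omega> (U j) = 0" for j
    unfolding U_def by (simp add: avg_diff avg_const fin)
  have Ubd: "\<bar>U j \<omega>\<bar> \<le> 2 * c" if "j < J" "\<omega> \<in> \<Omega>" for j \<omega>
  proof -
    have "\<bar>avg \<Omega> (T j)\<bar> \<le> c" using bd that by (intro avg_bound fin) auto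
    then show ?thesis unfolding U_def using bd[OF that] by linarith
  qed
  have "avg \<Omega> (\<lambda>\<omega>. ((\<Sum>j<J. T j \<omega>) - avg \<Omega> (\<lambda>\<omega>. \<Sum>j<J. T j \<omega>))\<^sup>2)
      = avg \<Omega> (\<lambda>\<omega>. \<Sum>j<J. \<Sum>k<J. U j \<omega> * U k \<omega>)"
    by (simp add: avg_sum U_def sum_subtractf power2_eq_square sum_product[symmetric])
  also have "\<dots> = (\<Sum>j<J. \<Sum>k<J. avg \<Omega> (\<lambda>\<omega>. U j \<omega> * U k \<omega>))"
    by (simp add: avg_sum)
  also have "\<dots> \<le> (\<Sum>j<J. real (2 * s) * (4 * c\<^sup>2))"
  proof (rule sum_mono)
    fix j assume "j \<in> {..<J}" then have j: "j < J" by simp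
    have "(\<Sum>k<J. avg \<Omega> (\<lambda>\<omega>. U j \<omega> * U k \<omega>)) \<le> (\<Sum>k<J. if k < j + s \<and> j < k + s then 4 * c\<^sup>2 else 0)"
    proof (rule sum_mono)
      fix k assume "k \<in> {..<J}" then have k: "k < J" by simp
      show "avg \<Omega> (\<lambda>\<omega>. U j \<omega> * U k \<omega>) \<le> (if k < j + s \<and> j < k + s then 4 * c\<^sup>2 else 0)"
      proof (cases "j + s \<le> k \<or> k + s \<le> j")
        case True
        then have "D j \<inter> D k = {}" using disj by blast
        then have "avg \<Omega> (\<lambda>\<omega>. U j \<omega> * U k \<omega>) = 0"
          unfolding \<Omega> by (subst avg_mult_indep[OF depU[OF j] depU[OF k]]) (auto simp: U0[unfolded \<Omega>])
        then show ?thesis by simp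
      next
        case False
        have "\<bar>avg \<Omega> (\<lambda>\<omega>. U j \<omega> * U k \<omega>)\<bar> \<le> (2*c) * (2*c)"
        proof (intro avg_bound fin)
          fix \<omega> assume \<omega>: "\<omega> \<in> \<Omega>"
          show "\<bar>U j \<omega> * U k \<omega>\<bar> \<le> (2*c) * (2*c)"
            unfolding abs_mult using Ubd[OF j \<omega>] Ubd[OF k \<omega>] by (intro mult_mono) auto
        qed
        then show ?thesis using False by (auto simp: power2_eq_square)
      qed
    qed
    also have "\<dots> = real (card {k\<in>{..<J}. k < j + s \<and> j < k + s}) * (4 * c\<^sup>2)"
      by (simp add: sum.If_cases Int_def)
    also have "\<dots> \<le> real (2 * s) * (4 * c\<^sup>2)"
    proof -
      have "card {k\<in>{..<J}. k < j + s \<and> j < k + s} \<le> card {j-s..<j+s}"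
        by (intro card_mono) auto
      also have "\<dots> \<le> 2 * s" by auto
      finally show ?thesis by (intro mult_right_mono) auto
    qed
    finally show "(\<Sum>k<J. avg \<Omega> (\<lambda>\<omega>. U j \<omega> * U k \<omega>)) \<le> real (2 * s) * (4 * c\<^sup>2)" .
  qed
  also have "\<dots> = real J * real (2 * s) * (4 * c\<^sup>2)" by simp
  finally show ?thesis .
qed

section \<open>Stein's method for locally dependent variables\<close>

text \<open>
  Let \<open>\<eta> j\<close> collect the summands that may share a coordinate with \<open>\<xi> j\<close>. Since \<open>\<xi> j\<close> has mean zero and is
  independent of \<open>W - \<eta> j\<close>, the average of \<open>W * f W\<close> equals that of
  \<open>\<Sum>j. \<xi> j * (f W - f (W - \<eta> j))\<close>, whose first-order part is \<open>f' W * S\<close> with \<open>S = (\<Sum>j. \<xi> j * \<eta> j)\<close>. By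
  Stein's equation the distance to the Gaussian mean is thus the average of \<open>f' W * (1 - S)\<close> up to a
  second-order remainder. Here \<open>S\<close> has the mean of \<open>W\<^sup>2\<close>, and its variance is small because its terms
  are again locally dependent. The remainder is controlled by a Lipschitz bound for \<open>f'\<close> read off from
  Stein's equation; it grows linearly in \<open>W\<close>, which is harmless after averaging.
\<close>

lemma stein_local_dependence:
  fixes \<xi> :: "nat \<Rightarrow> (nat \<Rightarrow> 'b) \<Rightarrow> real" and h :: "real \<Rightarrow> real"
  assumes fin: "finite \<Omega>" "\<Omega> \<noteq> {}" and \<Omega>: "\<Omega> = PiE I R" and m: "m \<ge> 1"
    and dep: "\<And>j. j < J \<Longrightarrow> depends_on (\<xi> j) {j..<j+m}"
    and mean: "\<And>j. j < J \<Longrightarrow> avg \<Omega> (\<xi> j) = 0"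
    and bd: "\<And>j \<omega>. j < J \<Longrightarrow> \<omega> \<in> \<Omega> \<Longrightarrow> \<bar>\<xi> j \<omega>\<bar> \<le> \<beta>" and \<beta>: "0 \<le> \<beta>"
    and e: "e > 0" and cont: "continuous_on UNIV h" and h: "\<And>x. 0 \<le> h x" "\<And>x. h x \<le> 1"
    and lip: "\<And>x y. \<bar>h x - h y\<bar> \<le> \<bar>x - y\<bar> / e"
  defines "W \<equiv> (\<lambda>\<omega>. \<Sum>j<J. \<xi> j \<omega>)"
  shows "\<bar>avg \<Omega> (\<lambda>\<omega>. h (W \<omega>)) - (LINT x|lborel. std_normal_density x * h x)\<bar>
     \<le> 2 * \<bar>1 - avg \<Omega> (\<lambda>\<omega>. (W \<omega>)\<^sup>2)\<bar> + 2 * sqrt (96 * real m ^ 3 * real J) * \<beta>\<^sup>2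
        + 4 * (real m)\<^sup>2 * real J * \<beta> ^ 3 * (6 + avg \<Omega> (\<lambda>\<omega>. (W \<omega>)\<^sup>2) + 1 / e)"
proof -
  define Nh where "Nh = (LINT x|lborel. std_normal_density x * h x)"
  obtain f f' where 
    f: "\<And>w. (f has_real_derivative f' w) (at w)"
    and f': "\<And>w. f' w = w * f w + h w - Nh" 
    and f5: "\<And>w. \<bar>f w\<bar> \<le> 5" and f2: "\<And>w. \<bar>f' w\<bar> \<le> 2"
    using stein_solution[OF cont h] unfolding Nh_def by blast
  define near where "near = (\<lambda>j. {i. i < J \<and> i < j + m \<and> j < i + m})"
  define \<eta> where "\<eta> = (\<lambda>j \<omega>. \<Sum>i\<in>near j. \<xi> i \<omega>)"
  define V where "V = (\<lambda>j \<omega>. \<Sum>i\<in>{..<J} - near j. \<xi> i \<omega>)"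
  have fin_near: "finite (near j)" for j unfolding near_def by auto
  have card_near: "card (near j) \<le> 2 * m" for j
  proof -
    have "card (near j) \<le> card {j-m..<j+m}" unfolding near_def by (intro card_mono) auto
    also have "\<dots> \<le> 2 * m" by auto
    finally show ?thesis .
  qed
  have W_split: "W \<omega> = V j \<omega> + \<eta> j \<omega>" for j \<omega>
    unfolding W_def V_def \<eta>_def by (rule sum.subset_diff) (auto simp: near_def)
  have \<eta>_bd: "\<bar>\<eta> j \<omega>\<bar> \<le> 2 * real m * \<beta>" if "\<omega> \<in> \<Omega>" for j \<omega>
  proof -
    have "\<bar>\<eta> j \<omega>\<bar> \<le> (\<Sum>i\<in>near j. \<beta>)"
      unfolding \<eta>_def by (rule order_trans[OF sum_abs]) (intro sum_mono bd that, simp add: near_def)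
    also have "\<dots> \<le> real (2 * m) * \<beta>" 
      using card_near[of j] \<beta> by (simp only: sum_constant) (intro mult_right_mono, auto)
    finally show ?thesis by simp
  qed
  have V_indep: "avg \<Omega> (\<lambda>\<omega>. \<xi> j \<omega> * g (V j \<omega>)) = 0" if j: "j < J" for j g
  proof -
    have "depends_on (V j) (\<Union>i\<in>{..<J} - near j. {i..<i+m})"
      unfolding V_def by (intro depends_on_sum depends_on_mono[OF dep]) auto
    then have "depends_on (\<lambda>\<omega>. g (V j \<omega>)) (\<Union>i\<in>{..<J} - near j. {i..<i+m})"
      by (rule depends_on_compose)
    moreover have "{j..<j+m} \<inter> (\<Union>i\<in>{..<J} - near j. {i..<i+m}) = {}"
      by (auto simp: near_def)
    ultimately have "avg \<Omega> (\<lambda>\<omega>. \<xi> j \<omega> * g (V j \<omega>)) = avg \<Omega> (\<xi> j) * avg \<Omega> (\<lambda>\<omega>. g (V j \<omega>))"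
      unfolding \<Omega> by (intro avg_mult_indep[OF dep[OF j]])
    then show ?thesis using mean[OF j] by simp
  qed
  define T where "T = (\<lambda>j \<omega>. \<xi> j \<omega> * \<eta> j \<omega>)"
  define S where "S = (\<lambda>\<omega>. \<Sum>j<J. T j \<omega>)"
  have ES: "avg \<Omega> S = avg \<Omega> (\<lambda>\<omega>. (W \<omega>)\<^sup>2)"
  proof -
    have "avg \<Omega> (\<lambda>\<omega>. (W \<omega>)\<^sup>2) = avg \<Omega> (\<lambda>\<omega>. \<Sum>j<J. \<xi> j \<omega> * W \<omega>)"
      by (simp add: power2_eq_square W_def sum_distrib_right)
    also have "\<dots> = avg \<Omega> (\<lambda>\<omega>. \<Sum>j<J. T j \<omega> + \<xi> j \<omega> * V j \<omega>)"
    proof (intro avg_cong sum.cong refl)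
      fix \<omega> j
      show "\<xi> j \<omega> * W \<omega> = T j \<omega> + \<xi> j \<omega> * V j \<omega>"
        unfolding W_split[of \<omega> j] by (simp add: T_def algebra_simps)
    qed
    also have "\<dots> = avg \<Omega> S"
      unfolding S_def avg_sum avg_add using V_indep[where g="\<lambda>x. x"] by simp
    finally show ?thesis by simp
  qed
  have VarS: "avg \<Omega> (\<lambda>\<omega>. (S \<omega> - avg \<Omega> S)\<^sup>2) \<le> 96 * real m ^ 3 * real J * \<beta> ^ 4"
  proof -
    have "avg \<Omega> (\<lambda>\<omega>. (S \<omega> - avg \<Omega> S)\<^sup>2) \<le> real J * real (2 * (3 * m)) * (4 * (\<beta> * (2 * real m * \<beta>))\<^sup>2)"
      unfolding S_def
    proof (rule avg_square_local_sum[OF fin \<Omega>])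
      show "depends_on (T j) {i. j < i + m \<and> i < j + 2 * m}" if "j < J" for j
        unfolding T_def \<eta>_def 
        by (intro depends_on_mult depends_on_sum depends_on_mono[OF dep[OF that]])
           (use m in auto, auto intro!: depends_on_mono[OF dep] simp: near_def)
      show "\<bar>T j \<omega>\<bar> \<le> \<beta> * (2 * real m * \<beta>)" if "j < J" "\<omega> \<in> \<Omega>" for j \<omega>
        unfolding T_def abs_mult using bd[OF that] \<eta>_bd[OF that(2)] \<beta> by (intro mult_mono) auto
    qed auto
    also have "\<dots> = 96 * real m ^ 3 * real J * \<beta> ^ 4"
      by (simp add: power2_eq_square power3_eq_cube power4_eq_xxxx)
    finally show ?thesis .
  qed
  have E1S: "avg \<Omega> (\<lambda>\<omega>. \<bar>1 - S \<omega>\<bar>) \<le> \<bar>1 - avg \<Omega> (\<lambda>\<omega>. (W \<omega>)\<^sup>2)\<bar> + sqrt (96 * real m ^ 3 * real J) * \<beta>\<^sup>2"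
  proof -
    have "avg \<Omega> (\<lambda>\<omega>. \<bar>1 - S \<omega>\<bar>) \<le> avg \<Omega> (\<lambda>\<omega>. \<bar>1 - avg \<Omega> S\<bar> + \<bar>S \<omega> - avg \<Omega> S\<bar>)"
      by (intro avg_mono) linarith
    also have "\<dots> = \<bar>1 - avg \<Omega> S\<bar> + avg \<Omega> (\<lambda>\<omega>. \<bar>S \<omega> - avg \<Omega> S\<bar>)"
      by (simp add: avg_add avg_const fin)
    also have "avg \<Omega> (\<lambda>\<omega>. \<bar>S \<omega> - avg \<Omega> S\<bar>) \<le> sqrt (avg \<Omega> (\<lambda>\<omega>. (S \<omega> - avg \<Omega> S)\<^sup>2))"
      by (rule avg_abs_le_sqrt)
    also have "\<dots> \<le> sqrt (96 * real m ^ 3 * real J * \<beta> ^ 4)"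
      using VarS by (rule real_sqrt_le_mono)
    also have "\<dots> = sqrt (96 * real m ^ 3 * real J) * \<beta>\<^sup>2"
    proof -
      have "\<beta> ^ 4 = (\<beta>\<^sup>2)\<^sup>2" by simp
      then show ?thesis by (simp only: real_sqrt_mult real_sqrt_abs) simp
    qed
    finally show ?thesis by (simp add: ES)
  qed
  (* h is only Lipschitz, so the increment of f' is estimated through the equation instead of a derivative *)
  have taylor: "\<bar>f (w + u) - f w - u * f' (w + u)\<bar> \<le> u\<^sup>2 * (2 * \<bar>w + u\<bar> + 5 + 1 / e)" for w u
  proof -
    have lipf: "\<bar>f x - f y\<bar> \<le> 2 * \<bar>x - y\<bar>" for x y
      using field_differentiable_bound[of UNIV f f' 2 x y] f f2
      by (auto simp: dist_norm)
    have "\<exists>z. \<bar>z - (w + u)\<bar> \<le> \<bar>u\<bar> \<and> f (w + u) - f w = u * f' z"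
    proof (cases u "0::real" rule: linorder_cases)
      case less
      then obtain z where "z > w + u" "z < w" "f w - f (w + u) = (w - (w + u)) * f' z"
        using MVT2[of "w+u" w f f'] f by auto
      then show ?thesis by (intro exI[of _ z]) (auto simp: algebra_simps)
    next
      case greater
      then obtain z where "z < w + u" "z > w" "f (w + u) - f w = ((w + u) - w) * f' z"
        using MVT2[of w "w+u" f f'] f by auto
      then show ?thesis by (intro exI[of _ z]) (auto simp: algebra_simps)
    qed auto
    then obtain z where z: "\<bar>z - (w + u)\<bar> \<le> \<bar>u\<bar>" "f (w + u) - f w = u * f' z" by blast
    define y where "y = w + u"
    have "f' z - f' y = y * (f z - f y) + (z - y) * f z + (h z - h y)"
      by (simp add: f' algebra_simps)
    then have "\<bar>f' z - f' y\<bar> \<le> \<bar>y * (f z - f y)\<bar> + \<bar>(z - y) * f z\<bar> + \<bar>h z - h y\<bar>"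
      by linarith
    also have "\<dots> \<le> \<bar>y\<bar> * (2 * \<bar>u\<bar>) + \<bar>u\<bar> * 5 + \<bar>u\<bar> / e"
    proof (intro add_mono)
      have "\<bar>f z - f y\<bar> \<le> 2 * \<bar>u\<bar>" using lipf[of z y] z(1) by (simp add: y_def)
      then show "\<bar>y * (f z - f y)\<bar> \<le> \<bar>y\<bar> * (2 * \<bar>u\<bar>)"
        unfolding abs_mult by (rule mult_left_mono) simp
      show "\<bar>(z - y) * f z\<bar> \<le> \<bar>u\<bar> * 5"
        unfolding abs_mult using z(1) f5 by (intro mult_mono) (auto simp: y_def)
      have "\<bar>z - y\<bar> / e \<le> \<bar>u\<bar> / e" using z(1) e by (intro divide_right_mono) (auto simp: y_def)
      then show "\<bar>h z - h y\<bar> \<le> \<bar>u\<bar> / e" using lip[of z y] by linarith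
    qed
    also have "\<dots> = \<bar>u\<bar> * (2 * \<bar>y\<bar> + 5 + 1 / e)" by (simp add: algebra_simps)
    finally have *: "\<bar>f' z - f' y\<bar> \<le> \<bar>u\<bar> * (2 * \<bar>y\<bar> + 5 + 1 / e)" .
    have "f (w + u) - f w - u * f' (w + u) = u * (f' z - f' y)"
      using z(2) by (simp add: y_def algebra_simps)
    then have "\<bar>f (w + u) - f w - u * f' (w + u)\<bar> = \<bar>u\<bar> * \<bar>f' z - f' y\<bar>" by (simp add: abs_mult)
    also have "\<dots> \<le> \<bar>u\<bar> * (\<bar>u\<bar> * (2 * \<bar>y\<bar> + 5 + 1 / e))" using * by (rule mult_left_mono) simp
    also have "\<dots> = u\<^sup>2 * (2 * \<bar>w + u\<bar> + 5 + 1 / e)" 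
      by (simp add: y_def power2_eq_square flip: mult.assoc abs_mult)
    finally show ?thesis .
  qed
  define r where "r = (\<lambda>j \<omega>. f (W \<omega>) - f (V j \<omega>) - \<eta> j \<omega> * f' (W \<omega>))"
  have r_bd: "\<bar>\<xi> j \<omega> * r j \<omega>\<bar> \<le> \<beta> * ((2 * real m * \<beta>)\<^sup>2 * (2 * \<bar>W \<omega>\<bar> + 5 + 1 / e))"
    if "j < J" "\<omega> \<in> \<Omega>" for j \<omega>
  proof -
    have "(\<eta> j \<omega>)\<^sup>2 \<le> (2 * real m * \<beta>)\<^sup>2"
      using \<eta>_bd[OF that(2), of j] \<beta> by (intro power2_le_iff_abs_le[THEN iffD2]) auto
    then have "(\<eta> j \<omega>)\<^sup>2 * (2 * \<bar>W \<omega>\<bar> + 5 + 1 / e) \<le> (2 * real m * \<beta>)\<^sup>2 * (2 * \<bar>W \<omega>\<bar> + 5 + 1 / e)"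
      using e by (intro mult_right_mono) auto
    then have "\<bar>r j \<omega>\<bar> \<le> (2 * real m * \<beta>)\<^sup>2 * (2 * \<bar>W \<omega>\<bar> + 5 + 1 / e)"
      using taylor[of "V j \<omega>" "\<eta> j \<omega>"] unfolding r_def W_split[of \<omega> j] by linarith
    then show ?thesis unfolding abs_mult using bd[OF that] \<beta> by (intro mult_mono) auto
  qed
  have key: "avg \<Omega> (\<lambda>\<omega>. h (W \<omega>)) - Nh = avg \<Omega> (\<lambda>\<omega>. f' (W \<omega>) * (1 - S \<omega>)) - avg \<Omega> (\<lambda>\<omega>. \<Sum>j<J. \<xi> j \<omega> * r j \<omega>)"
  proof -
    have "avg \<Omega> (\<lambda>\<omega>. h (W \<omega>)) - Nh = avg \<Omega> (\<lambda>\<omega>. h (W \<omega>)) - avg \<Omega> (\<lambda>\<omega>. Nh)"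
      by (simp add: avg_const fin)
    also have "\<dots> = avg \<Omega> (\<lambda>\<omega>. f' (W \<omega>) - W \<omega> * f (W \<omega>))"
      unfolding avg_diff[symmetric] by (rule avg_cong) (simp add: f')
    also have "\<dots> = avg \<Omega> (\<lambda>\<omega>. f' (W \<omega>) * (1 - S \<omega>) - ((\<Sum>j<J. \<xi> j \<omega> * r j \<omega>) + (\<Sum>j<J. \<xi> j \<omega> * f (V j \<omega>))))"
    proof (rule avg_cong)
      fix \<omega>
      have "(\<Sum>j<J. \<xi> j \<omega> * r j \<omega>) + (\<Sum>j<J. \<xi> j \<omega> * f (V j \<omega>)) = (\<Sum>j<J. \<xi> j \<omega> * f (W \<omega>) - T j \<omega> * f' (W \<omega>))"
        unfolding sum.distrib[symmetric] by (intro sum.cong) (auto simp: r_def T_def algebra_simps)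
      also have "\<dots> = W \<omega> * f (W \<omega>) - S \<omega> * f' (W \<omega>)"
        by (simp add: sum_subtractf W_def S_def sum_distrib_right)
      finally show "f' (W \<omega>) - W \<omega> * f (W \<omega>) = f' (W \<omega>) * (1 - S \<omega>) - ((\<Sum>j<J. \<xi> j \<omega> * r j \<omega>) + (\<Sum>j<J. \<xi> j \<omega> * f (V j \<omega>)))"
        by (simp add: algebra_simps)
    qed
    also have "\<dots> = avg \<Omega> (\<lambda>\<omega>. f' (W \<omega>) * (1 - S \<omega>)) - (avg \<Omega> (\<lambda>\<omega>. \<Sum>j<J. \<xi> j \<omega> * r j \<omega>) + 0)"
      unfolding avg_diff avg_add using V_indep[where g=f] by (simp add: avg_sum)
    finally show ?thesis by simp
  qed
  have A1: "\<bar>avg \<Omega> (\<lambda>\<omega>. f' (W \<omega>) * (1 - S \<omega>))\<bar> \<le> 2 * avg \<Omega> (\<lambda>\<omega>. \<bar>1 - S \<omega>\<bar>)"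
  proof -
    have "\<bar>avg \<Omega> (\<lambda>\<omega>. f' (W \<omega>) * (1 - S \<omega>))\<bar> \<le> avg \<Omega> (\<lambda>\<omega>. \<bar>f' (W \<omega>) * (1 - S \<omega>)\<bar>)" by (rule avg_abs)
    also have "\<dots> \<le> avg \<Omega> (\<lambda>\<omega>. 2 * \<bar>1 - S \<omega>\<bar>)"
      unfolding abs_mult using f2 by (intro avg_mono mult_right_mono) auto
    finally show ?thesis by (simp only: avg_cmult)
  qed
  have A2: "\<bar>avg \<Omega> (\<lambda>\<omega>. \<Sum>j<J. \<xi> j \<omega> * r j \<omega>)\<bar> \<le> 4 * (real m)\<^sup>2 * real J * \<beta> ^ 3 * (6 + avg \<Omega> (\<lambda>\<omega>. (W \<omega>)\<^sup>2) + 1 / e)"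
  proof -
    have "\<bar>avg \<Omega> (\<lambda>\<omega>. \<Sum>j<J. \<xi> j \<omega> * r j \<omega>)\<bar> \<le> avg \<Omega> (\<lambda>\<omega>. \<bar>\<Sum>j<J. \<xi> j \<omega> * r j \<omega>\<bar>)" by (rule avg_abs)
    also have "\<dots> \<le> avg \<Omega> (\<lambda>\<omega>. (4 * (real m)\<^sup>2 * real J * \<beta> ^ 3) * ((W \<omega>)\<^sup>2 + (6 + 1 / e)))"
    proof (rule avg_mono)
      fix \<omega> assume \<omega>: "\<omega> \<in> \<Omega>"
      have "\<bar>\<Sum>j<J. \<xi> j \<omega> * r j \<omega>\<bar> \<le> (\<Sum>j<J. \<beta> * ((2 * real m * \<beta>)\<^sup>2 * (2 * \<bar>W \<omega>\<bar> + 5 + 1 / e)))"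
        by (rule order_trans[OF sum_abs]) (intro sum_mono r_bd \<omega>, simp)
      also have "\<dots> = (4 * (real m)\<^sup>2 * real J * \<beta> ^ 3) * (2 * \<bar>W \<omega>\<bar> + 5 + 1 / e)"
        by (simp add: power2_eq_square power3_eq_cube)
      also have "\<dots> \<le> (4 * (real m)\<^sup>2 * real J * \<beta> ^ 3) * ((W \<omega>)\<^sup>2 + (6 + 1 / e))"
      proof (rule mult_left_mono)
        have "0 \<le> (\<bar>W \<omega>\<bar> - 1)\<^sup>2" by simp
        then show "2 * \<bar>W \<omega>\<bar> + 5 + 1 / e \<le> (W \<omega>)\<^sup>2 + (6 + 1 / e)"
          by (simp add: power2_diff)
      qed (use \<beta> in auto)
      finally show "\<bar>\<Sum>j<J. \<xi> j \<omega> * r j \<omega>\<bar> \<le> (4 * (real m)\<^sup>2 * real J * \<beta> ^ 3) * ((W \<omega>)\<^sup>2 + (6 + 1 / e))" .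
    qed
    also have "\<dots> = (4 * (real m)\<^sup>2 * real J * \<beta> ^ 3) * (avg \<Omega> (\<lambda>\<omega>. (W \<omega>)\<^sup>2) + (6 + 1 / e))"
      unfolding avg_cmult avg_add avg_const[OF fin] ..
    finally show ?thesis by (simp add: algebra_simps)
  qed
  have "\<bar>avg \<Omega> (\<lambda>\<omega>. h (W \<omega>)) - Nh\<bar> \<le> 2 * avg \<Omega> (\<lambda>\<omega>. \<bar>1 - S \<omega>\<bar>)
       + 4 * (real m)\<^sup>2 * real J * \<beta> ^ 3 * (6 + avg \<Omega> (\<lambda>\<omega>. (W \<omega>)\<^sup>2) + 1 / e)"
    using key A1 A2 by linarith
  then show ?thesis using E1S unfolding Nh_def by (simp add: algebra_simps)
qed

section \<open>A monotone majorant for functions of bounded variation\<close>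

text \<open>
  Serves both the periodic function (with \<open>V = 0\<close>) and its majorant, which gains \<open>V\<close> in each period.
\<close>

lemma quasi_periodic_int:
  fixes v :: "real \<Rightarrow> real"
  assumes "\<And>x. v (x + 1) = v x + V"
  shows "v (x + of_int n) = v x + of_int n * V"
proof (induction n rule: int_induct[of _ 0])
  case (step1 i)
  have "v (x + of_int (i + 1)) = v (x + of_int i + 1)" by (simp add: add.assoc)
  also have "\<dots> = v (x + of_int i) + V" by (rule assms)
  finally show ?case using step1 by (simp add: algebra_simps)
next
  case (step2 i)
  have "v (x + of_int i) = v (x + of_int (i - 1) + 1)" by simp
  also have "\<dots> = v (x + of_int (i - 1)) + V" by (rule assms)
  finally show ?case using step2 by (simp add: algebra_simps)
qed simp

lemma variation_sums_extend:
  assumes s: "s \<in> variation_sums f a x" and xy: "x < y"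
  shows "s + \<bar>f y - f x\<bar> \<in> variation_sums f a y"
proof -
  obtain n X where X: "s = (\<Sum>i<n. \<bar>f (X (Suc i)) - f (X i)\<bar>)" "X 0 = a" "X n = x"
      "\<forall>i<n. X i < X (Suc i)"
    using s by (auto simp: variation_sums_def)
  define Y where "Y = (\<lambda>i. if i \<le> n then X i else y)"
  have "s + \<bar>f y - f x\<bar> = (\<Sum>i<Suc n. \<bar>f (Y (Suc i)) - f (Y i)\<bar>)"
    using X by (simp add: Y_def)
  moreover have "Y 0 = a" "Y (Suc n) = y" using X by (auto simp: Y_def)
  moreover have "\<forall>i<Suc n. Y i < Y (Suc i)"
    using X xy by (auto simp: Y_def less_Suc_eq)
  ultimately show ?thesis unfolding variation_sums_def by blast
qed

lemma variation_sums_nonempty: "a \<le> x \<Longrightarrow> variation_sums f a x \<noteq> {}"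
proof -
  have *: "0 \<in> variation_sums f a a"
    unfolding variation_sums_def by (auto intro!: exI[of _ 0] exI[of _ "\<lambda>_. a"])
  assume "a \<le> x"
  then show ?thesis using * variation_sums_extend[OF *, of x] by (cases "a = x") auto
qed

lemma total_variation_step:
  assumes bv: "bounded_variation_on f 0 1" and xy: "0 \<le> x" "x \<le> y" "y \<le> 1"
  shows "total_variation f 0 x + \<bar>f y - f x\<bar> \<le> total_variation f 0 y"
proof (cases "x = y")
  case False
  with xy have "x < y" by simp
  have bdd: "bdd_above (variation_sums f 0 y)"
  proof (cases "y = 1")
    case False
    with xy have "y < 1" by simp
    show ?thesis
    proof (rule bdd_aboveI)
      fix s assume "s \<in> variation_sums f 0 y"
      then have "s + \<bar>f 1 - f y\<bar> \<in> variation_sums f 0 1"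
        using \<open>y < 1\<close> by (rule variation_sums_extend)
      then have "s + \<bar>f 1 - f y\<bar> \<le> total_variation f 0 1"
        unfolding total_variation_def using bv by (intro cSup_upper) (auto simp: bounded_variation_on_def)
      then show "s \<le> total_variation f 0 1" by linarith
    qed
  qed (use bv in \<open>simp add: bounded_variation_on_def\<close>)
  have "total_variation f 0 x \<le> total_variation f 0 y - \<bar>f y - f x\<bar>"
    unfolding total_variation_def[of f 0 x]
  proof (rule cSup_least)
    show "variation_sums f 0 x \<noteq> {}" using xy by (intro variation_sums_nonempty) auto
    fix s assume "s \<in> variation_sums f 0 x"
    then have "s + \<bar>f y - f x\<bar> \<le> total_variation f 0 y"
      unfolding total_variation_def using \<open>x < y\<close> bdd by (intro cSup_upper variation_sums_extend)
    then show "s \<le> total_variation f 0 y - \<bar>f y - f x\<bar>" by simp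
  qed
  then show ?thesis by simp
qed simp

text \<open>
  The variation function \<open>x \<mapsto> total_variation f 0 x\<close> on \<open>{0..1}\<close>, continued so that it gains the full variation
  in each period. For points in different periods one passes through the integers between them,
  where \<open>f\<close> takes the same value.
\<close>

lemma bounded_variation_majorant:
  fixes f :: "real \<Rightarrow> real"
  assumes per: "\<And>x. f (x + 1) = f x" and bv: "bounded_variation_on f 0 1"
  obtains v where "\<And>x. v (x + 1) = v x + total_variation f 0 1"
    and "\<And>x y. x \<le> y \<Longrightarrow> \<bar>f y - f x\<bar> \<le> v y - v x"
proof -
  define V where "V = total_variation f 0 1"
  define T where "T = total_variation f 0"
  have T0: "0 \<le> T 0"
  proof -
    have "0 \<in> variation_sums f 0 0"
      unfolding variation_sums_def by (auto intro!: exI[of _ 0] exI[of _ "\<lambda>_. 0"])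
    moreover have "s = 0" if s: "s \<in> variation_sums f 0 0" for s
    proof -
      obtain n X where X: "s = (\<Sum>i<n. \<bar>f (X (Suc i)) - f (X i)\<bar>)" "X 0 = 0" "X n = 0"
        "\<forall>i<n. X i < X (Suc i)" using s by (auto simp: variation_sums_def)
      have "k \<le> n \<Longrightarrow> 0 < k \<Longrightarrow> X 0 < X k" for k
      proof (induction k)
        case (Suc k)
        then show ?case using X(4) by (cases "k = 0") (auto intro: less_trans[of _ "X k"] simp: Suc_le_eq)
      qed simp
      then have "n = 0" using X by (cases n) force+
      then show ?thesis using X by simp
    qed
    ultimately have "variation_sums f 0 0 = {0}" by blast
    then show ?thesis by (simp add: T_def total_variation_def)
  qed
  have step: "T x + \<bar>f y - f x\<bar> \<le> T y" if "0 \<le> x" "x \<le> y" "y \<le> 1" for x y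
    unfolding T_def by (rule total_variation_step[OF bv that])
  have V0: "0 \<le> V" using step[of 0 1] T0 by (simp add: V_def T_def)
  define v where "v = (\<lambda>x. of_int \<lfloor>x\<rfloor> * V + T (frac x))"
  have f_frac: "f (frac x) = f x" for x
    using quasi_periodic_int[of f 0 x "- \<lfloor>x\<rfloor>"] per by (simp add: frac_def)
  have frac01: "0 \<le> frac x" "frac x \<le> 1" for x :: real
    using frac_lt_1[of x] by (auto simp: frac_ge_0)
  show ?thesis
  proof (rule that[of v])
    show "v (x + 1) = v x + total_variation f 0 1" for x
      by (simp add: v_def frac_def V_def algebra_simps)
    show "\<bar>f y - f x\<bar> \<le> v y - v x" if "x \<le> y" for x y
    proof (cases "\<lfloor>x\<rfloor> = \<lfloor>y\<rfloor>")
      case True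
      then have "frac x \<le> frac y" using that by (simp add: frac_def)
      from step[OF _ this] show ?thesis
        using True frac01 by (simp add: v_def f_frac)
    next
      case False
      then have "\<lfloor>x\<rfloor> + 1 \<le> \<lfloor>y\<rfloor>" using floor_mono[OF that] by simp
      then have "1 * V \<le> of_int (\<lfloor>y\<rfloor> - \<lfloor>x\<rfloor>) * V" using V0 by (intro mult_right_mono) auto
      moreover have "T (frac x) + \<bar>f 1 - f x\<bar> \<le> V"
        using step[of "frac x" 1] frac01 by (simp add: f_frac V_def T_def)
      moreover have "\<bar>f y - f 0\<bar> \<le> T (frac y)"
        using step[of 0 "frac y"] frac01[of y] T0 by (simp add: f_frac)
      moreover have "f 1 = f 0" using per[of 0] by simp
      ultimately show ?thesis by (simp add: v_def algebra_simps)
    qed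
  qed
qed

lemma has_integral_periodic_shift:
  fixes f :: "real \<Rightarrow> real"
  assumes per: "\<And>x. f (x + 1) = f x" and int: "(f has_integral I) {0..1}" and c: "0 \<le> c" "c \<le> 1"
  shows "((\<lambda>y. f (y + c)) has_integral I) {0..1}"
proof -
  have "f integrable_on {0..1}" using int by (auto simp: integrable_on_def)
  then have "f integrable_on {0..c}" "f integrable_on {c..1}"
    using c by (auto intro: integrable_on_subinterval)
  then obtain I1 I2 where I: "(f has_integral I1) {0..c}" "(f has_integral I2) {c..1}"
    by (auto simp: integrable_on_def)
  have "(f has_integral (I1 + I2)) {0..1}" using c I by (intro has_integral_combine[of 0 c 1])
  then have I_eq: "I = I1 + I2" using int has_integral_unique by blast
  have "((\<lambda>y. f (y + c)) has_integral I2) {c-c..1-c}"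
    using I(2) by (rule has_integral_shift_real_ivl)
  moreover have "((\<lambda>y. f (y + (c - 1))) has_integral I1) {0-(c-1)..c-(c-1)}"
    using I(1) by (rule has_integral_shift_real_ivl)
  then have "((\<lambda>y. f (y + (c - 1))) has_integral I1) {1-c..1}" by simp
  moreover have "f (y + (c - 1)) = f (y + c)" for y
    using per[of "y + (c - 1)"] by (simp add: algebra_simps)
  ultimately have "((\<lambda>y. f (y + c)) has_integral I2) {0..1-c}" "((\<lambda>y. f (y + c)) has_integral I1) {1-c..1}"
    by simp_all
  then show ?thesis
    unfolding I_eq using c has_integral_combine[of 0 "1-c" 1 "\<lambda>y. f (y + c)" I2 I1] by (simp add: add.commute)
qed

section \<open>Denominators of the convergents\<close>

text \<open>
  The denominators of the convergents of \<open>[0; a, a, \<dots>]\<close>, preceded by 0. Starting at 0 makes the numerator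
  belonging to \<open>cdenom a (Suc n)\<close> equal to \<open>cdenom a n\<close>.
\<close>

fun cdenom :: "nat \<Rightarrow> nat \<Rightarrow> nat" where
  "cdenom a 0 = 0"
| "cdenom a (Suc 0) = 1"
| "cdenom a (Suc (Suc n)) = a * cdenom a (Suc n) + cdenom a n"

lemma cdenom_add: "cdenom a (Suc (m + n)) = cdenom a (Suc m) * cdenom a (Suc n) + cdenom a m * cdenom a n"
proof (induction m rule: induct_nat_012)
  case (ge2 m)
  have "cdenom a (Suc (Suc (Suc m) + n)) = a * cdenom a (Suc (Suc m + n)) + cdenom a (Suc (m + n))"
    by simp
  also have "\<dots> = (a * cdenom a (Suc (Suc m)) + cdenom a (Suc m)) * cdenom a (Suc n)
      + (a * cdenom a (Suc m) + cdenom a m) * cdenom a n"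
    unfolding ge2.IH by (simp only: algebra_simps)
  finally show ?case by (simp only: cdenom.simps)
qed simp_all

lemma coprime_cdenom: "coprime (cdenom a n) (cdenom a (Suc n))"
proof (induction n)
  case (Suc n)
  have "gcd (cdenom a (Suc n)) (a * cdenom a (Suc n) + cdenom a n) = gcd (cdenom a (Suc n)) (cdenom a n)"
    by (metis gcd_add_mult mult.commute add.commute)
  then show ?case using Suc by (simp add: coprime_iff_gcd_eq_1 gcd.commute)
qed simp

text \<open>
  The quadratic equation characterises \<open>[0; a, a, \<dots>]\<close> among the positive reals.
\<close>

locale quadratic_rotation =
  fixes a :: nat and \<alpha> :: real
  assumes a1: "a \<ge> 1" and \<alpha>_pos: "\<alpha> > 0" and \<alpha>_eq: "\<alpha>\<^sup>2 + real a * \<alpha> = 1"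
begin

abbreviation "q \<equiv> cdenom a"

lemma \<alpha>_lt_1: "\<alpha> < 1"
proof (rule ccontr)
  assume "\<not> \<alpha> < 1"
  then have "\<alpha>\<^sup>2 \<ge> 1" "real a * \<alpha> \<ge> 1 * 1"
    using a1 by (simp_all only: one_le_power not_less) (intro mult_mono, auto)
  then show False using \<alpha>_eq by simp
qed

lemma cdenom_mono_Suc: "q n \<le> q (Suc n)"
proof (cases n)
  case (Suc m)
  then show ?thesis using a1 by (simp add: trans_le_add1)
qed simp

lemma cdenom_mono: "m \<le> n \<Longrightarrow> q m \<le> q n"
  by (rule lift_Suc_mono_le[of q]) (auto intro: cdenom_mono_Suc)

lemma cdenom_pos: "q (Suc n) > 0"
  using cdenom_mono[of 1 "Suc n"] by simp

lemma cdenom_alpha: "real (q (Suc n)) * \<alpha> = real (q n) + (-1) ^ n * \<alpha> ^ Suc n"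
proof (induction n rule: less_induct)
  case (less n)
  consider "n = 0" | "n = 1" | m where "n = Suc (Suc m)"
    by (metis One_nat_def not0_implies_Suc)
  then show ?case
  proof cases
    case 2
    then show ?thesis using \<alpha>_eq by (simp add: power2_eq_square algebra_simps)
  next
    case 3
    have "real (q (Suc n)) * \<alpha> = real a * (real (q (Suc (Suc m))) * \<alpha>) + real (q (Suc m)) * \<alpha>"
      by (simp add: 3 algebra_simps del: cdenom.simps(3)) (simp add: algebra_simps)
    also have "\<dots> = real a * (real (q (Suc m)) + (-1) ^ Suc m * \<alpha> ^ Suc (Suc m)) + (real (q m) + (-1) ^ m * \<alpha> ^ Suc m)"
      using less[of m] less[of "Suc m"] 3 by simp
    also have "\<dots> = real (a * q (Suc m) + q m) + (-1) ^ m * \<alpha> ^ Suc m * (1 - real a * \<alpha>)"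
      by (simp add: algebra_simps)
    also have "1 - real a * \<alpha> = \<alpha>\<^sup>2" using \<alpha>_eq by simp
    finally show ?thesis using 3 by (simp add: power2_eq_square)
  qed simp
qed

text \<open>
  An exact form of the growth rate \<open>\<alpha> ^ (- n)\<close>: the bracket is multiplied by \<open>1 / \<alpha> = a + \<alpha>\<close> in each step.
\<close>

lemma cdenom_power: "(real (q (Suc n)) + \<alpha> * real (q n)) * \<alpha> ^ n = 1"
proof (induction n)
  case (Suc n)
  have "(real (q (Suc (Suc n))) + \<alpha> * real (q (Suc n))) * \<alpha> ^ Suc n
    = ((real a * \<alpha> + \<alpha>\<^sup>2) * real (q (Suc n)) + \<alpha> * real (q n)) * \<alpha> ^ n"
    by (simp add: algebra_simps power2_eq_square)
  also have "real a * \<alpha> + \<alpha>\<^sup>2 = 1" using \<alpha>_eq by simp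
  finally show ?case using Suc by simp
qed simp

lemma cdenom_upper: "real (q (Suc n)) * \<alpha> ^ n \<le> 1"
proof -
  have "0 \<le> \<alpha> * real (q n) * \<alpha> ^ n" using \<alpha>_pos by simp
  then show ?thesis using cdenom_power[of n] by (simp add: algebra_simps)
qed

lemma cdenom_lower: "1 \<le> 2 * (real (q (Suc n)) * \<alpha> ^ n)"
proof -
  have "\<alpha> * real (q n) \<le> 1 * real (q (Suc n))"
    using \<alpha>_lt_1 \<alpha>_pos cdenom_mono_Suc[of n] by (intro mult_mono) auto
  then have "(real (q (Suc n)) + \<alpha> * real (q n)) * \<alpha> ^ n \<le> (2 * real (q (Suc n))) * \<alpha> ^ n"
    using \<alpha>_pos by (intro mult_right_mono) auto
  then show ?thesis using cdenom_power[of n] by simp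
qed

text \<open>
  The fraction \<open>q k / q (Suc k)\<close> is in lowest terms, so its multiples run modulo 1 through all fractions with
  denominator \<open>q (Suc k)\<close>.
\<close>

lemma sum_over_lattice:
  fixes G :: "real \<Rightarrow> real"
  assumes per: "\<And>x. G (x + 1) = G x"
  shows "(\<Sum>n=1..q (Suc k). G (x + real n * real (q k) / real (q (Suc k)))) = (\<Sum>i<q (Suc k). G (x + real i / real (q (Suc k))))"
proof -
  define Q where "Q = q (Suc k)"
  define p where "p = q k"
  have Q: "Q > 0" unfolding Q_def by (rule cdenom_pos)
  have cop: "coprime p Q" unfolding p_def Q_def by (rule coprime_cdenom)
  have inj: "inj_on (\<lambda>n. n * p mod Q) {1..Q}"
  proof (rule inj_onI)
    fix m n assume mn: "m \<in> {1..Q}" "n \<in> {1..Q}" "m * p mod Q = n * p mod Q"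
    then have "[m * p = n * p] (mod Q)" by (simp add: cong_def)
    then have "[m = n] (mod Q)" using cop by (simp add: cong_mult_rcancel_nat)
    then have "[int m = int n] (mod int Q)" by (simp add: cong_int_iff)
    then have "int Q dvd int m - int n" by (simp add: cong_iff_dvd_diff)
    then show "m = n" using mn dvd_imp_le_int[of "int m - int n" "int Q"] by (cases "m = n") auto
  qed
  have "(\<lambda>n. n * p mod Q) ` {1..Q} = {..<Q}"
    using Q inj by (intro card_subset_eq) (auto simp: card_image)
  then have bij: "bij_betw (\<lambda>n. n * p mod Q) {1..Q} {..<Q}"
    using inj by (simp add: bij_betw_def)
  have "G (x + real n * real p / real Q) = G (x + real (n * p mod Q) / real Q)" for n
  proof -
    have "real n * real p / real Q = real (n * p mod Q) / real Q + of_int (int (n * p div Q))"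
    proof -
      have e: "real n * real p = real Q * real (n * p div Q) + real (n * p mod Q)"
        by (metis mult_div_mod_eq of_nat_add of_nat_mult)
      show ?thesis unfolding e using Q by (simp add: add_divide_distrib)
    qed
    then show ?thesis using quasi_periodic_int[of G 0 "x + real (n * p mod Q) / real Q" "int (n * p div Q)"] per
      by (simp add: add.assoc)
  qed
  then show ?thesis unfolding Q_def[symmetric] p_def[symmetric]
    using sum.reindex_bij_betw[OF bij, of "\<lambda>i. G (x + real i / real Q)"] by simp
qed

lemma orbit_near_lattice:
  assumes "n \<le> q (Suc k)"
  shows "\<bar>real n * \<alpha> - real n * real (q k) / real (q (Suc k))\<bar> \<le> 1 / real (q (Suc k))"
proof -
  define Q where "Q = real (q (Suc k))"
  have Q: "Q > 0" unfolding Q_def using cdenom_pos by simp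
  have "real n * \<alpha> - real n * real (q k) / Q = (real n / Q) * (Q * \<alpha> - real (q k))"
    using Q by (simp add: field_simps)
  also have "\<dots> = (real n / Q) * ((-1) ^ k * \<alpha> ^ Suc k)"
    unfolding Q_def cdenom_alpha by simp
  finally have "\<bar>real n * \<alpha> - real n * real (q k) / Q\<bar> = (real n / Q) * (\<alpha> * \<alpha> ^ k)"
    using Q \<alpha>_pos by (simp add: abs_mult power_abs)
  also have "\<dots> \<le> 1 * (1 * \<alpha> ^ k)"
    using Q assms \<alpha>_pos \<alpha>_lt_1 by (intro mult_mono) (auto simp: Q_def)
  also have "\<dots> \<le> 1 / Q" using cdenom_upper[of k] Q by (simp add: Q_def field_simps)
  finally show ?thesis by (simp add: Q_def)
qed

end

section \<open>The Denjoy--Koksma inequality\<close>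

text \<open>
  The majorant \<open>v\<close> is the only trace of bounded variation: all that follows uses the variation \<open>V\<close> as
  the gain of \<open>v\<close> over a period.
\<close>

locale rotation_bv = quadratic_rotation a \<alpha> for a \<alpha> +
  fixes f v :: "real \<Rightarrow> real" and V :: real
  assumes f_periodic: "f (x + 1) = f x"
    and v_shift: "v (x + 1) = v x + V"
    and f_incr: "x \<le> y \<Longrightarrow> \<bar>f y - f x\<bar> \<le> v y - v x"
    and f_mean: "(f has_integral 0) {0..1}"
begin

lemma v_mono: "x \<le> y \<Longrightarrow> v x \<le> v y"
  using f_incr[of x y] by linarith

lemma V_nonneg: "V \<ge> 0"
  using v_mono[of 0 1] v_shift[of 0] by simp

lemma f_diff_le_near: "\<bar>y - z\<bar> \<le> c \<Longrightarrow> \<bar>f y - f z\<bar> \<le> v (z + c) - v (z - c)"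
proof (cases "z \<le> y")
  case True
  assume *: "\<bar>y - z\<bar> \<le> c"
  then have "v y \<le> v (z + c)" "v (z - c) \<le> v z" by (auto intro!: v_mono)
  then show ?thesis using f_incr[OF True] by linarith
next
  case False
  assume *: "\<bar>y - z\<bar> \<le> c"
  then have "v z \<le> v (z + c)" "v (z - c) \<le> v y" by (auto intro!: v_mono)
  then show ?thesis using f_incr[of y z] False by linarith
qed

text \<open>
  The intervals of length \<open>r / Q\<close> starting at the points \<open>i / Q\<close> cover a period \<open>r\<close> times, and the sum of the
  increments of \<open>v\<close> over one period telescopes to \<open>V\<close>.
\<close>

lemma v_lattice_sum:
  assumes Q: "Q > (0::nat)"
  shows "(\<Sum>i<Q. v (x + (real i + real r) / real Q) - v (x + real i / real Q)) = real r * V"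
proof (induction r)
  case (Suc r)
  define g where "g = (\<lambda>i::nat. v (x + (real i + real r) / real Q))"
  have "(\<Sum>i<Q. g (Suc i) - g i) = g Q - g 0" by (rule sum_lessThan_telescope)
  also have "\<dots> = V"
    using v_shift[of "x + real r / real Q"] Q by (simp add: g_def add_divide_distrib algebra_simps)
  finally have "(\<Sum>i<Q. g (Suc i) - g i) = V" .
  moreover have "(\<Sum>i<Q. v (x + (real i + real (Suc r)) / real Q) - v (x + real i / real Q))
    = (\<Sum>i<Q. g (Suc i) - g i) + (\<Sum>i<Q. v (x + (real i + real r) / real Q) - v (x + real i / real Q))"
    unfolding sum.distrib[symmetric] by (intro sum.cong) (auto simp: g_def add_ac)
  ultimately show ?case using Suc by (simp add: algebra_simps)
qed simp

lemma v_lattice_osc: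
  "(\<Sum>n=1..q (Suc k). v (x + real n * real (q k) / real (q (Suc k)) + real s / real (q (Suc k)))
     - v (x + real n * real (q k) / real (q (Suc k)) - real s / real (q (Suc k)))) = 2 * real s * V"
proof -
  define Q where "Q = q (Suc k)"
  have Q: "Q > 0" unfolding Q_def by (rule cdenom_pos)
  have per: "v (y + 1 + real s / real Q) - v (y + 1 - real s / real Q) = v (y + real s / real Q) - v (y - real s / real Q)" for y
    using v_shift[of "y + real s / real Q"] v_shift[of "y - real s / real Q"] by (simp add: algebra_simps)
  have "(\<Sum>n=1..Q. v (x + real n * real (q k) / real Q + real s / real Q)
     - v (x + real n * real (q k) / real Q - real s / real Q))
     = (\<Sum>i<Q. v (x + real i / real Q + real s / real Q) - v (x + real i / real Q - real s / real Q))"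
    using sum_over_lattice[of "\<lambda>y. v (y + real s / real Q) - v (y - real s / real Q)", OF per, where k=k and x=x]
    unfolding Q_def by simp
  also have "\<dots> = (\<Sum>i<Q. v ((x - real s / real Q) + (real i + real (2 * s)) / real Q) - v ((x - real s / real Q) + real i / real Q))"
    by (intro sum.cong) (auto simp: add_divide_distrib algebra_simps)
  also have "\<dots> = 2 * real s * V" using v_lattice_sum[OF Q, of "x - real s / real Q" "2 * s"] by (simp only: of_nat_mult of_nat_numeral)
  finally show ?thesis unfolding Q_def .
qed

text \<open>
  Each of the first \<open>q (Suc k)\<close> orbit points lies within \<open>1 / q (Suc k)\<close> of its own lattice point, so enlarging
  the neighbourhoods by that amount reduces the claim to the lattice.
\<close>

lemma v_orbit_osc:
  assumes c: "c \<le> real b / real (q (Suc k))"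
  shows "(\<Sum>n=1..q (Suc k). v (x + real n * \<alpha> + c) - v (x + real n * \<alpha> - c)) \<le> 2 * real (b + 1) * V"
proof -
  define Q where "Q = q (Suc k)"
  have "(\<Sum>n=1..Q. v (x + real n * \<alpha> + c) - v (x + real n * \<alpha> - c)) 
    \<le> (\<Sum>n=1..Q. v (x + real n * real (q k) / real Q + real (b + 1) / real Q)
     - v (x + real n * real (q k) / real Q - real (b + 1) / real Q))"
  proof (rule sum_mono)
    fix n assume "n \<in> {1..Q}"
    then have "\<bar>real n * \<alpha> - real n * real (q k) / real Q\<bar> \<le> 1 / real Q"
      unfolding Q_def by (intro orbit_near_lattice) auto
    moreover have "c \<le> real b / real Q" using c by (simp add: Q_def)
    moreover have "real (b + 1) / real Q = real b / real Q + 1 / real Q" by (simp add: add_divide_distrib)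
    ultimately have "v (x + real n * \<alpha> + c) \<le> v (x + real n * real (q k) / real Q + real (b + 1) / real Q)"
      "v (x + real n * real (q k) / real Q - real (b + 1) / real Q) \<le> v (x + real n * \<alpha> - c)"
      by (auto intro!: v_mono simp: abs_le_iff)
    then show "v (x + real n * \<alpha> + c) - v (x + real n * \<alpha> - c) \<le> v (x + real n * real (q k) / real Q + real (b + 1) / real Q)
     - v (x + real n * real (q k) / real Q - real (b + 1) / real Q)" by linarith
  qed
  also have "\<dots> = 2 * real (b + 1) * V" unfolding Q_def by (rule v_lattice_osc)
  finally show ?thesis unfolding Q_def .
qed

text \<open>
  As a function of \<open>x\<close> the sum is \<open>1 / Q\<close>-periodic and has mean zero, and over one of its periods it
  varies by at most \<open>V\<close>.
\<close>

lemma f_lattice_bound: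
  assumes Q: "Q > (0::nat)"
  shows "\<bar>\<Sum>i<Q. f (x + real i / real Q)\<bar> \<le> V"
proof -
  define g where "g = (\<lambda>x. \<Sum>i<Q. f (x + real i / real Q))"
  have g_shift: "g (y + 1 / real Q) = g y" for y
  proof -
    have "g (y + 1 / real Q) - g y = (\<Sum>i<Q. f (y + real (Suc i) / real Q) - f (y + real i / real Q))"
      by (simp add: g_def sum_subtractf add_divide_distrib add_ac)
    also have "\<dots> = f (y + real Q / real Q) - f (y + real 0 / real Q)"
      by (rule sum_lessThan_telescope)
    finally show ?thesis using Q f_periodic[of y] by simp
  qed
  have g_int: "g (y + of_int s / real Q) = g y" for y s
  proof -
    have "g ((z + 1) / real Q) = g (z / real Q) + 0" for z
      using g_shift[of "z / real Q"] by (simp add: add_divide_distrib)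
    from quasi_periodic_int[of "\<lambda>z. g (z / real Q)", OF this, of "y * real Q" s]
    show ?thesis using Q by (simp add: add_divide_distrib)
  qed
  have osc: "\<bar>g y - g x\<bar> \<le> V" for y
  proof -
    (* translate y by a multiple of 1 / Q into the interval of length 1 / Q to the right of x *)
    define s where "s = \<lfloor>(y - x) * real Q\<rfloor>"
    define z where "z = y - of_int s / real Q"
    have "of_int s \<le> (y - x) * real Q" "(y - x) * real Q \<le> of_int s + 1"
      by (auto simp: s_def)
    then have "of_int s / real Q \<le> y - x" "y - x \<le> (of_int s + 1) / real Q"
      using Q by (simp_all add: pos_le_divide_eq pos_divide_le_eq)
    then have z: "x \<le> z" "z \<le> x + 1 / real Q"
      by (simp_all add: z_def add_divide_distrib)
    have "g z = g y" using g_int[of z s] by (simp add: z_def)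
    then have "\<bar>g y - g x\<bar> = \<bar>\<Sum>i<Q. f (z + real i / real Q) - f (x + real i / real Q)\<bar>"
      by (simp add: g_def sum_subtractf)
    also have "\<dots> \<le> (\<Sum>i<Q. v (x + (real i + real 1) / real Q) - v (x + real i / real Q))"
    proof (rule order_trans[OF sum_abs], rule sum_mono)
      fix i
      have "\<bar>f (z + real i / real Q) - f (x + real i / real Q)\<bar> \<le> v (z + real i / real Q) - v (x + real i / real Q)"
        using z by (intro f_incr) auto
      also have "v (z + real i / real Q) \<le> v (x + (real i + real 1) / real Q)"
        using z by (intro v_mono) (auto simp: add_divide_distrib)
      finally show "\<bar>f (z + real i / real Q) - f (x + real i / real Q)\<bar> \<le> v (x + (real i + real 1) / real Q) - v (x + real i / real Q)"
        by simp
    qed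
    also have "\<dots> = V" using v_lattice_sum[OF Q, of x 1] by simp
    finally show ?thesis .
  qed
  have "((\<lambda>y. f (y + real i / real Q)) has_integral 0) {0..1}" if "i < Q" for i
    using that by (intro has_integral_periodic_shift f_periodic f_mean) auto
  then have g0: "(g has_integral 0) {0..1}"
    unfolding g_def using has_integral_sum[of "{..<Q}" "\<lambda>i y. f (y + real i / real Q)" "\<lambda>_. 0" "{0..1}"] by simp
  have const: "((\<lambda>_::real. c) has_integral c) {0..1}" for c :: real
    using has_integral_const_real[of c 0 1] by simp
  have "0 \<le> g x + V" 
    by (rule has_integral_le[OF g0 const]) (use osc in \<open>simp add: abs_le_iff algebra_simps\<close>)
  moreover have "g x - V \<le> 0"
    by (rule has_integral_le[OF const g0]) (use osc in \<open>simp add: abs_le_iff algebra_simps\<close>)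
  ultimately show ?thesis by (simp add: g_def abs_le_iff)
qed

definition orbit_sum :: "real \<Rightarrow> nat \<Rightarrow> real" where
  "orbit_sum x n = (\<Sum>i=1..n. f (x + real i * \<alpha>))"

lemma orbit_sum_add: "orbit_sum x (m + n) = orbit_sum x m + orbit_sum (x + real m * \<alpha>) n"
proof -
  have "orbit_sum x (m + n) = orbit_sum x m + (\<Sum>i=m+1..m+n. f (x + real i * \<alpha>))"
    unfolding orbit_sum_def using sum.ub_add_nat[of 1 m "\<lambda>i. f (x + real i * \<alpha>)" n] by simp
  also have "(\<Sum>i=m+1..m+n. f (x + real i * \<alpha>)) = (\<Sum>i=1..n. f (x + real (i + m) * \<alpha>))"
    using sum.shift_bounds_cl_nat_ivl[of "\<lambda>i. f (x + real i * \<alpha>)" 1 m n] by (simp add: add.commute)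
  also have "\<dots> = orbit_sum (x + real m * \<alpha>) n"
    unfolding orbit_sum_def by (simp add: algebra_simps)
  finally show ?thesis .
qed

text \<open>
  Compare the orbit with the lattice: moving the points costs \<open>2 * V\<close>, and the lattice sum is at most \<open>V\<close>.
\<close>

lemma denjoy_koksma: "\<bar>orbit_sum x (q (Suc k))\<bar> \<le> 3 * V"
proof -
  define Q where "Q = q (Suc k)"
  have Q: "Q > 0" unfolding Q_def by (rule cdenom_pos)
  have "\<bar>orbit_sum x Q - (\<Sum>n=1..Q. f (x + real n * real (q k) / real Q))\<bar>
    = \<bar>\<Sum>n=1..Q. f (x + real n * \<alpha>) - f (x + real n * real (q k) / real Q)\<bar>"
    by (simp add: orbit_sum_def sum_subtractf)
  also have "\<dots> \<le> (\<Sum>n=1..Q. v (x + real n * real (q k) / real Q + real 1 / real Q)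
     - v (x + real n * real (q k) / real Q - real 1 / real Q))"
  proof (rule order_trans[OF sum_abs], rule sum_mono, rule f_diff_le_near)
    fix n assume "n \<in> {1..Q}"
    then have "\<bar>real n * \<alpha> - real n * real (q k) / real Q\<bar> \<le> 1 / real Q"
      unfolding Q_def by (intro orbit_near_lattice) auto
    then show "\<bar>x + real n * \<alpha> - (x + real n * real (q k) / real Q)\<bar> \<le> real 1 / real Q" by simp
  qed
  also have "\<dots> = 2 * V" unfolding Q_def using v_lattice_osc[of x k 1] by simp
  also have "(\<Sum>n=1..Q. f (x + real n * real (q k) / real Q)) = (\<Sum>i<Q. f (x + real i / real Q))"
    unfolding Q_def by (rule sum_over_lattice[where G=f, OF f_periodic])
  finally show ?thesis using f_lattice_bound[OF Q, of x] unfolding Q_def by linarith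
qed

text \<open>
  Orbit sums of length \<open>n\<close> are bounded by \<open>c\<close> variations, wherever they start. The bound is inherited by sums
  and, because orbit segments may also be removed, by differences of lengths.
\<close>

definition sum_cost :: "nat \<Rightarrow> nat \<Rightarrow> bool" where
  "sum_cost n c \<longleftrightarrow> (\<forall>x. \<bar>orbit_sum x n\<bar> \<le> real c * V)"

lemma sum_cost_0: "sum_cost 0 c"
  using V_nonneg by (simp add: sum_cost_def orbit_sum_def)

lemma sum_cost_mono: "sum_cost n c \<Longrightarrow> c \<le> d \<Longrightarrow> sum_cost n d"
  unfolding sum_cost_def by (meson V_nonneg mult_right_mono of_nat_mono order_trans)

lemma sum_cost_add: "sum_cost m c \<Longrightarrow> sum_cost n d \<Longrightarrow> sum_cost (m + n) (c + d)"
  unfolding sum_cost_def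
proof (intro allI)
  fix x assume "\<forall>x. \<bar>orbit_sum x m\<bar> \<le> real c * V" "\<forall>x. \<bar>orbit_sum x n\<bar> \<le> real d * V"
  then have "\<bar>orbit_sum x m\<bar> \<le> real c * V" "\<bar>orbit_sum (x + real m * \<alpha>) n\<bar> \<le> real d * V" by auto
  then show "\<bar>orbit_sum x (m + n)\<bar> \<le> real (c + d) * V"
    unfolding orbit_sum_add by (simp add: algebra_simps)
qed

lemma sum_cost_diff: 
  assumes "sum_cost (m + n) c" "sum_cost n d"
  shows "sum_cost m (c + d)"
  unfolding sum_cost_def
proof (intro allI)
  fix x
  have "\<bar>orbit_sum x (m + n)\<bar> \<le> real c * V" "\<bar>orbit_sum (x + real m * \<alpha>) n\<bar> \<le> real d * V" 
    using assms by (auto simp: sum_cost_def)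
  then show "\<bar>orbit_sum x m\<bar> \<le> real (c + d) * V"
    unfolding orbit_sum_add by (simp add: algebra_simps)
qed

lemma sum_cost_mult: "sum_cost n c \<Longrightarrow> sum_cost (d * n) (d * c)"
  by (induction d) (auto simp: sum_cost_0 intro: sum_cost_add)

lemma sum_cost_cdenom: "sum_cost (q k) 3"
  using denjoy_koksma by (cases k) (auto simp: sum_cost_def orbit_sum_def V_nonneg)

text \<open>
  By \<open>cdenom_add\<close> the product \<open>q (Suc m) * q (Suc n)\<close> is \<open>q (Suc (m + n)) - q m * q n\<close>; iterating this
  writes \<open>q m * q n\<close> as an alternating sum of at most \<open>m\<close> denominators.
\<close>

lemma sum_cost_cdenom_prod: "sum_cost (q m * q n) (3 * m)"
proof (induction m arbitrary: n)
  case 0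
  then show ?case by (simp add: sum_cost_0)
next
  case (Suc m)
  show ?case
  proof (cases n)
    case 0
    then show ?thesis by (simp add: sum_cost_0)
  next
    case (Suc n')
    have "sum_cost (q (Suc m) * q n + q m * q n') 3"
      using sum_cost_cdenom[of "Suc (m + n')"] Suc by (simp only: cdenom_add)
    from sum_cost_diff[OF this Suc.IH[of n']] show ?thesis by (simp add: add.commute)
  qed
qed

text \<open>
  Expand \<open>u\<close> greedily: it has at most \<open>k\<close> digits, each at most \<open>a\<close>, and every digit costs at most \<open>3 * k\<close> by
  \<open>sum_cost_cdenom_prod\<close>.
\<close>

lemma sum_cost_digits: "u < q (Suc k) \<Longrightarrow> sum_cost (u * q n) (3 * a * k\<^sup>2)"
proof (induction k arbitrary: u)
  case 0
  then show ?case by (simp add: sum_cost_0)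
next
  case (Suc k)
  define d where "d = u div q (Suc k)"
  define w where "w = u mod q (Suc k)"
  have w: "w < q (Suc k)" unfolding w_def using cdenom_pos by simp
  have u: "u = d * q (Suc k) + w" unfolding d_def w_def by (rule div_mult_mod_eq[symmetric])
  have "q k \<le> q (Suc k)" by (rule cdenom_mono_Suc)
  then have "u < (a + 1) * q (Suc k)" using Suc.prems by simp
  then have "d < a + 1" unfolding d_def by (simp add: less_mult_imp_div_less)
  then have d: "d \<le> a" by simp
  have "sum_cost (d * (q (Suc k) * q n) + w * q n) (d * (3 * Suc k) + 3 * a * k\<^sup>2)"
    by (intro sum_cost_add sum_cost_mult sum_cost_cdenom_prod Suc.IH w)
  moreover have "d * (3 * Suc k) + 3 * a * k\<^sup>2 \<le> 3 * a * (Suc k)\<^sup>2"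
  proof -
    have "d * (3 * Suc k) \<le> a * (3 * Suc k)" using d by (rule mult_le_mono1)
    moreover have "a * (3 * Suc k) + 3 * a * k\<^sup>2 \<le> 3 * a * (Suc k)\<^sup>2"
      by (simp add: power2_eq_square algebra_simps)
    ultimately show ?thesis by linarith
  qed
  ultimately have "sum_cost (d * (q (Suc k) * q n) + w * q n) (3 * a * (Suc k)\<^sup>2)"
    by (rule sum_cost_mono)
  moreover have "u * q n = d * (q (Suc k) * q n) + w * q n" 
    unfolding u by (simp only: add_mult_distrib mult.assoc)
  ultimately show ?case by simp
qed

end

section \<open>Mixed radix expansions with independent digits\<close>

text \<open>
  Fubini for a single coordinate.
\<close>

lemma avg_coordinate:
  fixes H :: "'b \<Rightarrow> ('i \<Rightarrow> 'b) \<Rightarrow> real"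
  assumes I: "finite I" "k \<in> I" and F: "\<And>i. i \<in> I \<Longrightarrow> finite (F i) \<and> F i \<noteq> {}"
    and H: "\<And>u. u \<in> F k \<Longrightarrow> depends_on (H u) (- {k})"
  shows "avg (PiE I F) (\<lambda>\<omega>. H (\<omega> k) \<omega>) = (\<Sum>u\<in>F k. avg (PiE I F) (H u)) / real (card (F k))"
proof -
  let ?\<Omega> = "PiE I F"
  have F1: "finite (F i)" and F2: "F i \<noteq> {}" if "i \<in> I" for i using F[OF that] by auto
  have fin: "finite ?\<Omega>" by (rule finite_PiE[OF I(1) F1])
  have prob: "avg ?\<Omega> (\<lambda>\<omega>. of_bool (\<omega> k = u)) = 1 / real (card (F k))" if u: "u \<in> F k" for u
  proof -
    have "{\<omega> \<in> ?\<Omega>. \<omega> k = u} = PiE I (F(k := {u}))"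
    proof (intro set_eqI iffI)
      fix \<omega> assume "\<omega> \<in> PiE I (F(k := {u}))"
      then have mem: "\<And>i. i \<in> I \<Longrightarrow> \<omega> i \<in> (F(k := {u})) i" and ext: "\<omega> \<in> extensional I"
        by (auto simp: PiE_iff)
      have "\<omega> k = u" using mem[OF I(2)] by simp
      moreover have "\<omega> i \<in> F i" if "i \<in> I" for i
        using mem[OF that] u by (cases "i = k") auto
      ultimately show "\<omega> \<in> {\<omega> \<in> ?\<Omega>. \<omega> k = u}" using ext by (simp add: PiE_iff)
    qed (auto simp: PiE_iff)
    then have "card {\<omega> \<in> ?\<Omega>. \<omega> k = u} = (\<Prod>i\<in>I. card ((F(k := {u})) i))"
      using I(1) by (simp add: card_PiE)
    also have "\<dots> = (\<Prod>i\<in>I-{k}. card (F i))"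
      using I by (subst prod.remove[of I k]) (auto intro!: prod.cong)
    finally have 1: "card {\<omega> \<in> ?\<Omega>. \<omega> k = u} = (\<Prod>i\<in>I-{k}. card (F i))" .
    have 2: "card ?\<Omega> = card (F k) * (\<Prod>i\<in>I-{k}. card (F i))"
      using I by (simp add: card_PiE prod.remove[of I k])
    have "(\<Prod>i\<in>I-{k}. card (F i)) > 0"
      by (intro prod_pos) (simp add: card_gt_0_iff F1 F2)
    moreover have "(\<Sum>\<omega>\<in>?\<Omega>. of_bool (\<omega> k = u) :: real) = real (card {\<omega> \<in> ?\<Omega>. \<omega> k = u})"
      using fin by (simp add: of_bool_def sum.If_cases Int_def)
    ultimately show ?thesis unfolding avg_def 1 2 by (simp del: of_nat_prod)
  qed
  have "avg ?\<Omega> (\<lambda>\<omega>. H (\<omega> k) \<omega>) = avg ?\<Omega> (\<lambda>\<omega>. \<Sum>u\<in>F k. of_bool (\<omega> k = u) * H u \<omega>)"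
  proof (rule avg_cong)
    fix \<omega> assume "\<omega> \<in> ?\<Omega>"
    then have "\<omega> k \<in> F k" using I by auto
    then show "H (\<omega> k) \<omega> = (\<Sum>u\<in>F k. of_bool (\<omega> k = u) * H u \<omega>)"
      using F[OF I(2)] by (simp add: of_bool_def if_distrib sum.delta if_distribR cong: if_cong)
  qed
  also have "\<dots> = (\<Sum>u\<in>F k. avg ?\<Omega> (\<lambda>\<omega>. of_bool (\<omega> k = u) * H u \<omega>))" by (rule avg_sum)
  also have "\<dots> = (\<Sum>u\<in>F k. avg ?\<Omega> (H u) / real (card (F k)))"
  proof (rule sum.cong[OF refl])
    fix u assume u: "u \<in> F k"
    have "depends_on (\<lambda>\<omega>::'i \<Rightarrow> 'b. of_bool (\<omega> k = u)) {k}" by (auto simp: depends_on_def)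
    then show "avg ?\<Omega> (\<lambda>\<omega>. of_bool (\<omega> k = u) * H u \<omega>) = avg ?\<Omega> (H u) / real (card (F k))"
      by (subst avg_mult_indep[OF _ H[OF u]]) (auto simp: prob[OF u])
  qed
  finally show ?thesis by (simp flip: sum_divide_distrib)
qed

text \<open>
  Both averages weigh the first \<open>P\<close> values; the normalisations differ by the proportion \<open>(S - P) / S\<close>, and the
  values from \<open>P\<close> on have that same weight.
\<close>

lemma avg_initial_segment:
  assumes P: "0 < P" "P \<le> S" and g: "\<And>n. n < S \<Longrightarrow> \<bar>g n\<bar> \<le> G" and G: "0 \<le> G"
  shows "\<bar>avg {..<P} g - avg {..<S} g\<bar> \<le> 2 * G * (real S - real P) / real S"
proof -
  have split: "(\<Sum>n<S. g n) = (\<Sum>n<P. g n) + (\<Sum>n=P..<S. g n)"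
    using P by (metis atLeast0LessThan le0 sum.atLeastLessThan_concat)
  have b1: "\<bar>\<Sum>n<P. g n\<bar> \<le> real P * G"
    by (rule order_trans[OF sum_abs]) (rule order_trans[OF sum_bounded_above[of _ _ G]], use g P in auto)
  have b2: "\<bar>\<Sum>n=P..<S. g n\<bar> \<le> (real S - real P) * G"
    by (rule order_trans[OF sum_abs]) (rule order_trans[OF sum_bounded_above[of _ _ G]], use g P in \<open>auto simp: of_nat_diff\<close>)
  have "avg {..<P} g - avg {..<S} g = ((\<Sum>n<P. g n) * ((real S - real P) / real P) - (\<Sum>n=P..<S. g n)) / real S"
    unfolding avg_def split using P by (simp add: field_simps)
  then have "\<bar>avg {..<P} g - avg {..<S} g\<bar> = \<bar>(\<Sum>n<P. g n) * ((real S - real P) / real P) - (\<Sum>n=P..<S. g n)\<bar> / real S"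
    by simp
  also have "\<dots> \<le> (real P * G * ((real S - real P) / real P) + (real S - real P) * G) / real S"
  proof (intro divide_right_mono)
    have "\<bar>(\<Sum>n<P. g n) * ((real S - real P) / real P)\<bar> \<le> real P * G * ((real S - real P) / real P)"
      unfolding abs_mult using b1 P by (intro mult_mono) auto
    then show "\<bar>(\<Sum>n<P. g n) * ((real S - real P) / real P) - (\<Sum>n=P..<S. g n)\<bar> \<le> real P * G * ((real S - real P) / real P) + (real S - real P) * G"
      using b2 by linarith
  qed simp
  also have "\<dots> = 2 * G * (real S - real P) / real S" using P by (simp add: field_simps)
  finally show ?thesis .
qed

lemma sum_consecutive_blocks:
  fixes g :: "nat \<Rightarrow> real"
  shows "(\<Sum>u<r. \<Sum>n<m. g (n + m * u)) = (\<Sum>n<m * r. g n)"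
proof -
  have "(\<Sum>n<m. g (n + m * u)) = sum g {u*m..<u*m+m}" for u
    using sum.shift_bounds_nat_ivl[of g 0 "u*m" m]
    by (simp add: atLeast0LessThan add.commute mult.commute)
  then show ?thesis using sum.nat_group[of g m r] by (simp add: mult.commute)
qed

text \<open>
  The quotients \<open>R (Suc i) / R i\<close> need not be integers. Digits below the rounded quotient \<open>r i\<close> therefore reach
  only the values below \<open>R i * r i\<close>, possibly short of \<open>R (Suc i)\<close>.
\<close>

locale mixed_radix =
  fixes R :: "nat \<Rightarrow> nat" and J :: nat
  assumes R0: "R 0 = 1" and R_mono: "i < J \<Longrightarrow> R i \<le> R (Suc i)"
begin

definition "r i = R (Suc i) div R i"
definition "\<Omega> = PiE {..<J} (\<lambda>i. {..<r i})"
definition "partial_value k \<omega> = (\<Sum>i<k. R i * \<omega> i)"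

lemma R_pos: "i \<le> J \<Longrightarrow> R i > 0"
proof (induction i)
  case (Suc i)
  then show ?case using R_mono[of i] by simp
qed (simp add: R0)

lemma r_pos: "i < J \<Longrightarrow> r i > 0"
  using R_pos[of i] R_mono[of i] by (simp add: r_def div_greater_zero_iff)

lemma R_r_le: "R i * r i \<le> R (Suc i)"
  unfolding r_def by simp

lemma R_r_gt: "i < J \<Longrightarrow> R (Suc i) < R i * r i + R i"
  using R_pos[of i] mod_less_divisor[of "R i" "R (Suc i)"] mult_div_mod_eq[of "R i" "R (Suc i)"] 
  unfolding r_def by linarith

lemma finite_\<Omega>: "finite \<Omega>" and \<Omega>_nonempty: "\<Omega> \<noteq> {}"
  using r_pos by (auto simp: \<Omega>_def PiE_eq_empty_iff intro!: finite_PiE)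

lemma digit_less: "\<omega> \<in> \<Omega> \<Longrightarrow> i < J \<Longrightarrow> \<omega> i < r i"
  by (auto simp: \<Omega>_def PiE_iff)

lemma partial_value_less:
  assumes "\<omega> \<in> \<Omega>"
  shows "k \<le> J \<Longrightarrow> partial_value k \<omega> < R k"
proof (induction k)
  case (Suc k)
  have "Suc (\<omega> k) \<le> r k" using digit_less[OF assms, of k] Suc by simp
  then have "R k * Suc (\<omega> k) \<le> R k * r k" by (rule mult_le_mono2)
  then show ?case using Suc R_r_le[of k] by (simp add: partial_value_def)
qed (simp add: partial_value_def R0)

lemma depends_on_partial_value: "depends_on (\<lambda>\<omega>. g (partial_value k \<omega>)) {..<k}"
  unfolding depends_on_def partial_value_def by (auto intro!: arg_cong[of _ _ g] sum.cong)

text \<open>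
  Adding \<open>R k * u\<close> with \<open>u\<close> uniform on \<open>{..<r k}\<close> to a uniform variable on \<open>{..<R k}\<close> gives exactly the uniform
  distribution on \<open>{..<R k * r k}\<close>; replacing this set by \<open>{..<R (Suc k)}\<close> loses at most
  \<open>2 * R k / R (Suc k)\<close>. Errors add up over the digits.
\<close>

lemma partial_value_almost_uniform:
  assumes "k \<le> J" and g: "\<And>n. n < R k \<Longrightarrow> \<bar>g n\<bar> \<le> G" and G: "0 \<le> G"
  shows "\<bar>avg \<Omega> (\<lambda>\<omega>. g (partial_value k \<omega>)) - avg {..<R k} g\<bar> \<le> G * (\<Sum>i<k. 2 * real (R i) / real (R (Suc i)))"
  using assms(1) g
proof (induction k arbitrary: g)
  case 0
  then show ?case by (simp add: partial_value_def R0 avg_const finite_\<Omega> \<Omega>_nonempty) (simp add: avg_def)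
next
  case (Suc k)
  define \<tau> where "\<tau> = (\<Sum>i<k. 2 * real (R i) / real (R (Suc i)))"
  define S where "S = (\<Sum>u<r k. avg {..<R k} (\<lambda>n. g (n + R k * u))) / real (r k)"
  have rk: "r k > 0" and Rk: "R k > 0" using Suc.prems r_pos[of k] R_pos[of k] by auto
  have "avg \<Omega> (\<lambda>\<omega>. g (partial_value (Suc k) \<omega>)) = avg \<Omega> (\<lambda>\<omega>. (\<lambda>u \<omega>. g (partial_value k \<omega> + R k * u)) (\<omega> k) \<omega>)"
    by (simp add: partial_value_def)
  also have "\<dots> = (\<Sum>u<r k. avg \<Omega> (\<lambda>\<omega>. g (partial_value k \<omega> + R k * u))) / real (r k)"
    unfolding \<Omega>_def using Suc.prems(1) r_pos
    by (subst avg_coordinate)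
       (auto intro!: depends_on_mono[OF depends_on_partial_value[of "\<lambda>n. g (n + R k * u)" for u]])
  finally have "avg \<Omega> (\<lambda>\<omega>. g (partial_value (Suc k) \<omega>)) - S
     = (\<Sum>u<r k. avg \<Omega> (\<lambda>\<omega>. g (partial_value k \<omega> + R k * u)) - avg {..<R k} (\<lambda>n. g (n + R k * u))) / real (r k)"
    by (simp add: S_def diff_divide_distrib sum_subtractf)
  also have "\<bar>\<dots>\<bar> \<le> (\<Sum>u<r k. G * \<tau>) / real (r k)"
    unfolding abs_divide
  proof (intro frac_le order_trans[OF sum_abs] sum_mono)
    fix u assume "u \<in> {..<r k}"
    then have "Suc u \<le> r k" by simp
    then have "R k * Suc u \<le> R k * r k" by (rule mult_le_mono2)
    then have "R k + R k * u \<le> R (Suc k)" using R_r_le[of k] by simp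
    then show "\<bar>avg \<Omega> (\<lambda>\<omega>. g (partial_value k \<omega> + R k * u)) - avg {..<R k} (\<lambda>n. g (n + R k * u))\<bar> \<le> G * \<tau>"
      unfolding \<tau>_def using Suc.prems by (intro Suc.IH) auto
  qed (use rk in \<open>auto simp: G \<tau>_def intro!: sum_nonneg mult_nonneg_nonneg\<close>)
  also have "\<dots> = G * \<tau>" using rk by simp
  finally have 1: "\<bar>avg \<Omega> (\<lambda>\<omega>. g (partial_value (Suc k) \<omega>)) - S\<bar> \<le> G * \<tau>" .
  have "S = avg {..<R k * r k} g"
    unfolding S_def avg_def sum_divide_distrib[symmetric] sum_consecutive_blocks by simp
  moreover have "\<bar>avg {..<R k * r k} g - avg {..<R (Suc k)} g\<bar> \<le> 2 * G * (real (R (Suc k)) - real (R k * r k)) / real (R (Suc k))"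
    using rk Rk R_r_le[of k] Suc.prems G by (intro avg_initial_segment) auto
  moreover have "2 * G * (real (R (Suc k)) - real (R k * r k)) / real (R (Suc k)) \<le> G * (2 * real (R k) / real (R (Suc k)))"
  proof -
    have "real (R (Suc k)) - real (R k * r k) \<le> real (R k)"
    proof -
      have "real (R (Suc k)) \<le> real (R k * r k + R k)"
        using R_r_gt[of k] Suc.prems(1) by (simp only: of_nat_le_iff less_imp_le Suc_le_eq)
      then show ?thesis by simp
    qed
    then have "2 * G * (real (R (Suc k)) - real (R k * r k)) / real (R (Suc k)) \<le> 2 * G * real (R k) / real (R (Suc k))"
      using G by (intro divide_right_mono mult_left_mono) auto
    then show ?thesis by (simp add: mult_ac)
  qed
  ultimately show ?case using 1 by (simp add: \<tau>_def algebra_simps)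
qed

end

section \<open>Splitting the orbit into blocks\<close>

text \<open>
  \<open>J\<close> blocks of \<open>l\<close> convergents each fit below \<open>M\<close>, and one more does not. The last radix is \<open>M\<close> itself, so the
  top digit may range over up to two blocks, but its range is never short.
\<close>

locale block_decomposition = rotation_bv a \<alpha> f v V for a \<alpha> f v V +
  fixes l J M :: nat
  assumes l1: "l \<ge> 1" and J1: "J \<ge> 1" and small: "\<alpha> ^ l \<le> 1 / 2"
    and M_lower: "q (Suc (J * l)) \<le> M" and M_upper: "M < q (Suc (Suc J * l))"
begin

definition "R i = (if i < J then q (Suc (i * l)) else M)"

definition "\<epsilon> = \<alpha> ^ l"

lemma \<epsilon>_pos: "\<epsilon> > 0" and \<epsilon>_half: "\<epsilon> \<le> 1 / 2"
  using small \<alpha>_pos by (auto simp: \<epsilon>_def)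

lemma \<epsilon>_power: "\<epsilon> ^ i = \<alpha> ^ (i * l)"
  by (simp add: \<epsilon>_def mult.commute flip: power_mult)

sublocale mixed_radix R J
proof
  show "R 0 = 1" using J1 by (simp add: R_def)
  show "R i \<le> R (Suc i)" if "i < J" for i
  proof (cases "Suc i < J")
    case True
    then show ?thesis using that by (auto simp: R_def intro!: cdenom_mono)
  next
    case False
    then have "Suc i = J" using that by simp
    have "q (Suc (i * l)) \<le> q (Suc (J * l))" using that by (intro cdenom_mono) simp
    then show ?thesis using that M_lower \<open>Suc i = J\<close> by (simp add: R_def)
  qed
qed

lemma R_upper: "i < J \<Longrightarrow> real (R i) * \<epsilon> ^ i \<le> 1"
  using cdenom_upper[of "i * l"] by (simp add: R_def \<epsilon>_power)

lemma R_le_cdenom: "i \<le> J \<Longrightarrow> R i \<le> q (Suc (Suc i * l))"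
  using M_upper cdenom_mono[of "Suc (i * l)" "Suc (Suc i * l)"] by (cases "i = J") (auto simp: R_def)

lemma R_upper': "i \<le> J \<Longrightarrow> real (R i) * \<epsilon> ^ Suc i \<le> 1"
proof -
  assume "i \<le> J"
  then have "real (R i) * \<epsilon> ^ Suc i \<le> real (q (Suc (Suc i * l))) * \<epsilon> ^ Suc i"
    using R_le_cdenom[of i] \<epsilon>_pos by (intro mult_right_mono) auto
  also have "\<dots> \<le> 1" unfolding \<epsilon>_power by (rule cdenom_upper)
  finally show ?thesis .
qed

lemma R_lower: "i \<le> J \<Longrightarrow> 1 \<le> 2 * (real (R i) * \<epsilon> ^ i)"
proof -
  assume "i \<le> J"
  then have "q (Suc (i * l)) \<le> R i" using M_lower by (cases "i = J") (auto simp: R_def)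
  then have "real (q (Suc (i * l))) * \<epsilon> ^ i \<le> real (R i) * \<epsilon> ^ i"
    using \<epsilon>_pos by (intro mult_right_mono) auto
  then show ?thesis using cdenom_lower[of "i * l"] by (simp add: \<epsilon>_power)
qed

lemma R_ratio: 
  assumes "i < J" 
  shows "real (R i) \<le> 2 * \<epsilon> * real (R (Suc i))"
proof -
  have "real (R i) * \<epsilon> ^ i \<le> 2 * (real (R (Suc i)) * \<epsilon> ^ Suc i)"
    using R_upper[of i] R_lower[of "Suc i"] assms by linarith
  then have "real (R i) * \<epsilon> ^ i \<le> (2 * \<epsilon> * real (R (Suc i))) * \<epsilon> ^ i" by (simp add: mult_ac)
  then show ?thesis using \<epsilon>_pos by (subst (asm) mult_le_cancel_right_pos) auto
qed

text \<open>
  The exponent 2 instead of 1 is caused by the top digit.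
\<close>

lemma r_upper: 
  assumes "i < J" 
  shows "real (r i) * \<epsilon>\<^sup>2 \<le> 2"
proof -
  have "real (r i) * \<epsilon>\<^sup>2 * 1 \<le> real (r i) * \<epsilon>\<^sup>2 * (2 * (real (R i) * \<epsilon> ^ i))"
    using R_lower[of i] assms by (intro mult_left_mono) auto
  also have "\<dots> = 2 * (real (R i * r i) * \<epsilon> ^ Suc (Suc i))"
    by (simp add: power2_eq_square mult_ac)
  also have "\<dots> \<le> 2 * (real (R (Suc i)) * \<epsilon> ^ Suc (Suc i))"
    using R_r_le[of i] \<epsilon>_pos by (intro mult_left_mono mult_right_mono) (simp_all only: of_nat_le_iff zero_le_power less_imp_le zero_le_numeral)
  also have "\<dots> \<le> 2 * 1" using R_upper'[of "Suc i"] assms by (intro mult_left_mono) auto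
  finally show ?thesis by simp
qed

lemma r_lower: 
  assumes "i < J" 
  shows "1 \<le> 4 * \<epsilon> * real (r i)"
proof -
  have "R i * 1 \<le> R i * r i" using r_pos[OF assms] by (intro mult_le_mono2) simp
  then have "R (Suc i) \<le> 2 * (R i * r i)" using R_r_gt[OF assms] by linarith
  then have "real (R (Suc i)) \<le> real (2 * (R i * r i))" by (simp only: of_nat_le_iff)
  then have "2 * \<epsilon> * real (R (Suc i)) \<le> 2 * \<epsilon> * real (2 * (R i * r i))"
    using \<epsilon>_pos by (intro mult_left_mono) auto
  with R_ratio[OF assms] have "1 * real (R i) \<le> (4 * \<epsilon> * real (r i)) * real (R i)"
    by (simp add: mult_ac)
  then show ?thesis using R_pos[of i] assms by (subst (asm) mult_le_cancel_right_pos) auto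
qed

lemma digit_cdenom:
  assumes "i < J" "\<omega> \<in> \<Omega>"
  shows "\<omega> i < q (Suc (2 * l + 2))"
proof -
  have "R i * r i \<le> q (Suc (Suc (Suc i) * l))" 
    using R_r_le[of i] R_le_cdenom[of "Suc i"] assms(1) by linarith
  also have "Suc (Suc (Suc i) * l) = Suc (i * l + 2 * l)" by simp
  also have "q (Suc (i * l + 2 * l)) = q (Suc (i * l)) * q (Suc (2 * l)) + q (i * l) * q (2 * l)"
    by (rule cdenom_add)
  also have "\<dots> \<le> q (Suc (i * l)) * q (Suc (2 * l)) + q (Suc (i * l)) * q (Suc (2 * l))"
    by (intro add_left_mono mult_mono cdenom_mono) auto
  also have "\<dots> = R i * (2 * q (Suc (2 * l)))" using assms by (simp add: R_def)
  finally have "r i \<le> 2 * q (Suc (2 * l))" using R_pos[of i] assms by simp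
  also have "\<dots> \<le> q (Suc (2 * l + 2))"
  proof -
    have "1 * q (Suc (2 * l)) \<le> a * q (Suc (Suc (2 * l)))"
      using a1 cdenom_mono_Suc[of "Suc (2 * l)"] by (intro mult_mono) auto
    then show ?thesis by simp
  qed
  finally show ?thesis using digit_less[OF assms(2,1)] by simp
qed

text \<open>
  The length \<open>R j * \<omega> j\<close> is a denominator times a number with \<open>2 * l + 2\<close> digits.
\<close>

lemma block_bound:
  assumes "j < J" "\<omega> \<in> \<Omega>"
  shows "\<bar>orbit_sum x (R j * \<omega> j)\<bar> \<le> 48 * real a * (real l)\<^sup>2 * V"
proof -
  have "sum_cost (\<omega> j * q (Suc (j * l))) (3 * a * (2 * l + 2)\<^sup>2)"
    by (rule sum_cost_digits[OF digit_cdenom[OF assms]])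
  then have "\<bar>orbit_sum x (R j * \<omega> j)\<bar> \<le> real (3 * a * (2 * l + 2)\<^sup>2) * V"
    using assms by (simp add: sum_cost_def R_def mult.commute)
  also have "\<dots> \<le> (3 * real a * (4 * real l)\<^sup>2) * V"
  proof (rule mult_right_mono[OF _ V_nonneg])
    have "(2 * l + 2)\<^sup>2 \<le> (4 * l)\<^sup>2" using l1 by (intro power_mono) auto
    then have "real (3 * a * (2 * l + 2)\<^sup>2) \<le> real (3 * a * (4 * l)\<^sup>2)" 
      by (simp only: of_nat_le_iff mult_le_mono2)
    then show "real (3 * a * (2 * l + 2)\<^sup>2) \<le> 3 * real a * (4 * real l)\<^sup>2" by simp
  qed
  finally show ?thesis by (simp add: power_mult_distrib)
qed

definition tail_value :: "nat \<Rightarrow> (nat \<Rightarrow> nat) \<Rightarrow> nat" where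
  "tail_value j \<omega> = (\<Sum>i\<in>{j..<J}. R i * \<omega> i)"

text \<open>
  Three digits from \<open>j\<close> on. Together with the block's own digit this makes a window of four.
\<close>

definition window_value :: "nat \<Rightarrow> (nat \<Rightarrow> nat) \<Rightarrow> nat" where
  "window_value j \<omega> = (\<Sum>i\<in>{j..<min (j + 3) J}. R i * \<omega> i)"

definition block :: "nat \<Rightarrow> (nat \<Rightarrow> nat) \<Rightarrow> real" where
  "block j \<omega> = orbit_sum (real (tail_value (Suc j) \<omega>) * \<alpha>) (R j * \<omega> j)"

definition local_block :: "nat \<Rightarrow> (nat \<Rightarrow> nat) \<Rightarrow> real" where
  "local_block j \<omega> = orbit_sum (real (window_value (Suc j) \<omega>) * \<alpha>) (R j * \<omega> j)"

lemma orbit_sum_blocks: "orbit_sum 0 (partial_value J \<omega>) = (\<Sum>j<J. block j \<omega>)"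
proof -
  have "orbit_sum 0 (tail_value (J - k) \<omega>) = (\<Sum>j\<in>{J-k..<J}. block j \<omega>)" if "k \<le> J" for k
    using that
  proof (induction k)
    case (Suc k)
    define j where "j = J - Suc k"
    have j: "J - k = Suc j" "j < J" using Suc.prems by (auto simp: j_def)
    have "tail_value j \<omega> = tail_value (Suc j) \<omega> + R j * \<omega> j"
      using j by (simp add: tail_value_def sum.atLeast_Suc_lessThan)
    then have "orbit_sum 0 (tail_value j \<omega>) = orbit_sum 0 (tail_value (Suc j) \<omega>) + block j \<omega>"
      by (simp add: orbit_sum_add block_def)
    then show ?case using Suc j by (simp add: sum.atLeast_Suc_lessThan[of j J] flip: j_def)
  qed (simp add: tail_value_def orbit_sum_def)
  from this[of J] show ?thesis by (simp add: tail_value_def partial_value_def atLeast0LessThan)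
qed

lemma depends_on_local_block: "j < J \<Longrightarrow> depends_on (local_block j) {j..<j + 4}"
  unfolding depends_on_def local_block_def window_value_def
  by (intro allI impI arg_cong2[of _ _ _ _ orbit_sum] arg_cong[of _ _ "\<lambda>n. real n * \<alpha>"] sum.cong arg_cong2[of _ _ _ _ times]) auto

lemma local_block_bound: "j < J \<Longrightarrow> \<omega> \<in> \<Omega> \<Longrightarrow> \<bar>local_block j \<omega>\<bar> \<le> 48 * real a * (real l)\<^sup>2 * V"
  unfolding local_block_def by (rule block_bound)

lemma geometric_tail: "(\<Sum>i\<in>{m..<n}. \<epsilon> ^ i) \<le> 2 * \<epsilon> ^ m"
proof (cases "m \<le> n")
  case True
  then have "(\<Sum>i\<in>{m..<n}. \<epsilon> ^ i) + 2 * \<epsilon> ^ n \<le> 2 * \<epsilon> ^ m"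
  proof (induction n rule: nat_induct_at_least)
    case (Suc n)
    have "2 * \<epsilon> * \<epsilon> ^ n \<le> 1 * \<epsilon> ^ n" using \<epsilon>_half \<epsilon>_pos by (intro mult_right_mono) auto
    then show ?case using Suc by simp
  qed simp
  moreover have "0 \<le> 2 * \<epsilon> ^ n" using \<epsilon>_pos by simp
  ultimately show ?thesis by linarith
qed (use \<epsilon>_pos in simp)

lemma f_periodic_nat: "f (x + real n) = f x"
  using quasi_periodic_int[of f 0 x "int n"] f_periodic by simp

text \<open>
  Modulo 1, the digits from \<open>j + 4\<close> on shift the starting point of block \<open>j\<close> by the sum of
  \<open>\<omega> i * \<alpha> ^ (i * l + 1)\<close> with signs, a geometric series whose first term dominates. With digits up to
  \<open>2 / \<epsilon>\<^sup>2\<close> this is at most \<open>4 * \<epsilon> ^ (j + 2)\<close>.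
\<close>

lemma block_approx_pointwise:
  assumes j: "j + 4 < J" and \<omega>: "\<omega> \<in> \<Omega>"
  defines "c \<equiv> 4 * \<epsilon> ^ (j + 2)"
  shows "\<bar>block j \<omega> - local_block j \<omega>\<bar> \<le> (\<Sum>n=1..R (Suc j). v (real (window_value (Suc j) \<omega> + n) * \<alpha> + c) - v (real (window_value (Suc j) \<omega> + n) * \<alpha> - c))"
proof -
  define \<theta> where "\<theta> = (\<Sum>i\<in>{j+4..<J}. real (\<omega> i) * ((-1) ^ (i * l) * \<alpha> ^ Suc (i * l)))"
  (* \<theta> is the distance of the dropped part of the rotation to the integer p *)
  define p where "p = (\<Sum>i\<in>{j+4..<J}. \<omega> i * q (i * l))"
  define w where "w = window_value (Suc j) \<omega>"
  have "tail_value (Suc j) \<omega> = w + (\<Sum>i\<in>{j+4..<J}. R i * \<omega> i)"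
    using j sum.atLeastLessThan_concat[of "Suc j" "j + 4" J "\<lambda>i. R i * \<omega> i"]
    by (simp add: tail_value_def window_value_def w_def min_def eval_nat_numeral)
  moreover have "real (\<Sum>i\<in>{j+4..<J}. R i * \<omega> i) * \<alpha> = \<theta> + real p"
    unfolding \<theta>_def p_def of_nat_sum sum_distrib_right sum.distrib[symmetric]
  proof (rule sum.cong[OF refl])
    fix i assume "i \<in> {j+4..<J}"
    then have "real (R i) * \<alpha> = real (q (i * l)) + (-1) ^ (i * l) * \<alpha> ^ Suc (i * l)"
      using cdenom_alpha[of "i * l"] by (simp add: R_def)
    then have "real (\<omega> i) * (real (R i) * \<alpha>) = real (\<omega> i) * (real (q (i * l)) + (-1) ^ (i * l) * \<alpha> ^ Suc (i * l))"
      by simp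
    then show "real (R i * \<omega> i) * \<alpha> = real (\<omega> i) * ((-1) ^ (i * l) * \<alpha> ^ Suc (i * l)) + real (\<omega> i * q (i * l))"
      by (simp add: algebra_simps)
  qed
  ultimately have shift: "real (tail_value (Suc j) \<omega>) * \<alpha> = real w * \<alpha> + \<theta> + real p"
    by (simp add: algebra_simps)
  have "\<epsilon>\<^sup>2 * \<bar>\<theta>\<bar> \<le> \<epsilon>\<^sup>2 * (\<Sum>i\<in>{j+4..<J}. real (\<omega> i) * \<epsilon> ^ i)"
  proof (intro mult_left_mono)
    show "\<bar>\<theta>\<bar> \<le> (\<Sum>i\<in>{j+4..<J}. real (\<omega> i) * \<epsilon> ^ i)"
      unfolding \<theta>_def
    proof (rule order_trans[OF sum_abs], rule sum_mono)
      fix i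
      have "\<alpha> ^ Suc (i * l) \<le> \<alpha> ^ (i * l)" using \<alpha>_pos \<alpha>_lt_1 by (intro power_decreasing) auto
      then have "real (\<omega> i) * \<alpha> ^ Suc (i * l) \<le> real (\<omega> i) * \<epsilon> ^ i"
        unfolding \<epsilon>_power by (intro mult_left_mono) auto
      then show "\<bar>real (\<omega> i) * ((-1) ^ (i * l) * \<alpha> ^ Suc (i * l))\<bar> \<le> real (\<omega> i) * \<epsilon> ^ i"
        using \<alpha>_pos by (simp add: abs_mult power_abs)
    qed
  qed simp
  also have "\<dots> = (\<Sum>i\<in>{j+4..<J}. (real (\<omega> i) * \<epsilon>\<^sup>2) * \<epsilon> ^ i)"
    by (simp add: sum_distrib_left mult_ac)
  also have "\<dots> \<le> (\<Sum>i\<in>{j+4..<J}. 2 * \<epsilon> ^ i)"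
  proof (intro sum_mono mult_right_mono)
    fix i assume "i \<in> {j+4..<J}"
    then have i: "i < J" by simp
    have "real (\<omega> i) * \<epsilon>\<^sup>2 \<le> real (r i) * \<epsilon>\<^sup>2"
      using digit_less[OF \<omega> i] by (intro mult_right_mono) auto
    then show "real (\<omega> i) * \<epsilon>\<^sup>2 \<le> 2" using r_upper[OF i] by linarith
  qed (use \<epsilon>_pos in auto)
  also have "\<dots> \<le> 2 * (2 * \<epsilon> ^ (j + 4))" 
    unfolding sum_distrib_left[symmetric] by (intro mult_left_mono geometric_tail) auto
  also have "\<dots> = \<epsilon>\<^sup>2 * c" by (simp add: c_def power_add power2_eq_square eval_nat_numeral)
  finally have \<theta>_le: "\<bar>\<theta>\<bar> \<le> c" using \<epsilon>_pos by (subst (asm) mult_le_cancel_left_pos) auto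
  define o' where "o' = (\<lambda>n. v (real (w + n) * \<alpha> + c) - v (real (w + n) * \<alpha> - c))"
  have "block j \<omega> - local_block j \<omega> = (\<Sum>n=1..R j * \<omega> j. f (real (tail_value (Suc j) \<omega>) * \<alpha> + real n * \<alpha>) - f (real w * \<alpha> + real n * \<alpha>))"
    by (simp add: block_def local_block_def orbit_sum_def sum_subtractf w_def)
  also have "\<bar>\<dots>\<bar> \<le> (\<Sum>n=1..R j * \<omega> j. o' n)"
  proof (rule order_trans[OF sum_abs], rule sum_mono)
    fix n
    have "f (real (tail_value (Suc j) \<omega>) * \<alpha> + real n * \<alpha>) = f (real (w + n) * \<alpha> + \<theta>)"
      using f_periodic_nat[of "real (w + n) * \<alpha> + \<theta>" p] unfolding shift by (simp add: algebra_simps)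
    moreover have "\<bar>f (real (w + n) * \<alpha> + \<theta>) - f (real (w + n) * \<alpha>)\<bar> \<le> o' n"
      unfolding o'_def using \<theta>_le by (intro f_diff_le_near) simp
    ultimately show "\<bar>f (real (tail_value (Suc j) \<omega>) * \<alpha> + real n * \<alpha>) - f (real w * \<alpha> + real n * \<alpha>)\<bar> \<le> o' n"
      by (simp add: algebra_simps)
  qed
  also have "\<dots> \<le> (\<Sum>n=1..R (Suc j). o' n)"
  proof (rule sum_mono2)
    have "R j * \<omega> j \<le> R j * r j" using digit_less[OF \<omega>, of j] j by (intro mult_le_mono2) simp
    then have "R j * \<omega> j \<le> R (Suc j)" using R_r_le[of j] by (rule order_trans)
    then show "{1..R j * \<omega> j} \<subseteq> {1..R (Suc j)}" by simp
    fix n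
    have "0 \<le> c" using \<epsilon>_pos by (simp add: c_def)
    then show "0 \<le> o' n" unfolding o'_def using v_mono by simp
  qed simp
  finally show ?thesis by (simp add: o'_def w_def)
qed

text \<open>
  Average over the digit \<open>j + 1\<close> alone. As it varies, the intervals over which the oscillations are summed
  tile an interval of at most \<open>R (j + 2)\<close> orbit points. At that scale the neighbourhoods have a radius
  comparable to the spacing, so the total is at most \<open>10 * V\<close>, and it is shared among \<open>r (j + 1)\<close> values
  of the digit.
\<close>

lemma block_approx:
  assumes j: "j < J"
  shows "avg \<Omega> (\<lambda>\<omega>. \<bar>block j \<omega> - local_block j \<omega>\<bar>) \<le> 40 * \<epsilon> * V"
proof (cases "j + 4 < J")
  case False
  then have "min (Suc j + 3) J = J" by simp
  then have "block j \<omega> = local_block j \<omega>" for \<omega>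
    by (simp add: block_def local_block_def tail_value_def window_value_def)
  then show ?thesis using avg_const[OF finite_\<Omega> \<Omega>_nonempty, of 0] \<epsilon>_pos V_nonneg by simp
next
  case True
  define c where "c = 4 * \<epsilon> ^ (j + 2)"
  define g where "g = (\<lambda>m::nat. v (real m * \<alpha> + c) - v (real m * \<alpha> - c))"
  have c0: "0 \<le> c" using \<epsilon>_pos by (simp add: c_def)
  have g0: "0 \<le> g m" for m unfolding g_def using v_mono c0 by simp
  define rest where "rest = (\<lambda>\<omega>. \<Sum>i\<in>{j+2..<j+4}. R i * \<omega> i)"
  define K where "K = (\<lambda>u \<omega>. \<Sum>n<R (Suc j). g (rest \<omega> + 1 + (n + R (Suc j) * u)))"
  have shift: "(\<Sum>n=1..m. h n) = (\<Sum>n<m. h (Suc n))" for m and h :: "nat \<Rightarrow> real"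
    using sum.atLeast1_atMost_eq[of h m] by simp
  have window: "window_value (Suc j) \<omega> = R (Suc j) * \<omega> (Suc j) + rest \<omega>" for \<omega>
    using True by (simp add: window_value_def rest_def sum.atLeast_Suc_lessThan min_def)
  have "avg \<Omega> (\<lambda>\<omega>. \<bar>block j \<omega> - local_block j \<omega>\<bar>) \<le> avg \<Omega> (\<lambda>\<omega>. K (\<omega> (Suc j)) \<omega>)"
  proof (rule avg_mono)
    fix \<omega> assume "\<omega> \<in> \<Omega>"
    from block_approx_pointwise[OF True this]
    have "\<bar>block j \<omega> - local_block j \<omega>\<bar> \<le> (\<Sum>n=1..R (Suc j). g (window_value (Suc j) \<omega> + n))"
      by (simp only: g_def c_def)
    also have "\<dots> = K (\<omega> (Suc j)) \<omega>"
      unfolding shift K_def window by (intro sum.cong arg_cong[of _ _ g]) auto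
    finally show "\<bar>block j \<omega> - local_block j \<omega>\<bar> \<le> K (\<omega> (Suc j)) \<omega>" .
  qed
  also have "\<dots> = (\<Sum>u<r (Suc j). avg \<Omega> (K u)) / real (card {..<r (Suc j)})"
    unfolding \<Omega>_def
  proof (rule avg_coordinate)
    show "depends_on (K u) (- {Suc j})" for u
      unfolding depends_on_def K_def rest_def
      by (auto intro!: sum.cong arg_cong[of _ _ g])
    show "finite {..<r i} \<and> {..<r i} \<noteq> {}" if "i \<in> {..<J}" for i
      using r_pos[of i] that by auto
  qed (use True in auto)
  also have "\<dots> = avg \<Omega> (\<lambda>\<omega>. \<Sum>u<r (Suc j). K u \<omega>) / real (r (Suc j))"
    by (simp add: avg_sum)
  also have "\<dots> \<le> (10 * V) / real (r (Suc j))"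
  proof (rule divide_right_mono)
    have "avg \<Omega> (\<lambda>\<omega>. \<Sum>u<r (Suc j). K u \<omega>) \<le> avg \<Omega> (\<lambda>_. 10 * V)"
    proof (rule avg_mono)
      fix \<omega>
      have "(\<Sum>u<r (Suc j). K u \<omega>) = (\<Sum>n<R (Suc j) * r (Suc j). g (rest \<omega> + 1 + n))"
        unfolding K_def by (rule sum_consecutive_blocks)
      also have "\<dots> \<le> (\<Sum>n<R (Suc (Suc j)). g (rest \<omega> + 1 + n))"
        using R_r_le[of "Suc j"] by (intro sum_mono2 g0) auto
      also have "\<dots> = (\<Sum>n=1..R (Suc (Suc j)). g (rest \<omega> + n))"
        unfolding shift by simp
      also have "\<dots> = (\<Sum>n=1..q (Suc ((j + 2) * l)). v (real (rest \<omega>) * \<alpha> + real n * \<alpha> + c) - v (real (rest \<omega>) * \<alpha> + real n * \<alpha> - c))"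
        using True by (simp add: R_def g_def algebra_simps)
      also have "\<dots> \<le> 2 * real (4 + 1) * V"
      proof (rule v_orbit_osc)
        have "real (q (Suc ((j + 2) * l))) * \<epsilon> ^ (j + 2) \<le> 1"
          unfolding \<epsilon>_power by (rule cdenom_upper)
        then show "c \<le> real 4 / real (q (Suc ((j + 2) * l)))"
          using cdenom_pos[of "(j + 2) * l"] by (simp add: c_def pos_le_divide_eq mult_ac del: cdenom.simps)
      qed
      finally show "(\<Sum>u<r (Suc j). K u \<omega>) \<le> 10 * V" by simp
    qed
    then show "avg \<Omega> (\<lambda>\<omega>. \<Sum>u<r (Suc j). K u \<omega>) \<le> 10 * V"
      by (simp add: avg_const finite_\<Omega> \<Omega>_nonempty)
  qed simp
  also have "\<dots> \<le> 40 * \<epsilon> * V"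
  proof -
    have "1 * (10 * V) \<le> (4 * \<epsilon> * real (r (Suc j))) * (10 * V)"
      using r_lower[of "Suc j"] True V_nonneg by (intro mult_right_mono) auto
    then show ?thesis using r_pos[of "Suc j"] True by (simp add: pos_divide_le_eq mult_ac)
  qed
  finally show ?thesis .
qed

end

section \<open>Normal approximation for a fixed block length\<close>

context block_decomposition
begin

lemma M_pos: "M > 0"
  using R_pos[of J] by (simp add: R_def)

lemma value_almost_uniform:
  assumes g: "\<And>n. n \<le> M \<Longrightarrow> \<bar>g n\<bar> \<le> G"
  shows "\<bar>avg {1..M} g - avg \<Omega> (\<lambda>\<omega>. g (partial_value J \<omega>))\<bar> \<le> 8 * (real J * \<epsilon>) * G"
proof -
  have G: "0 \<le> G" using g[of 0] by simp
  have RJ: "R J = M" by (simp add: R_def)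
  have "(\<Sum>i<J. 2 * real (R i) / real (R (Suc i))) \<le> (\<Sum>i<J. 4 * \<epsilon>)"
  proof (rule sum_mono)
    fix i assume "i \<in> {..<J}"
    then have "real (R i) \<le> 2 * \<epsilon> * real (R (Suc i))" "0 < R (Suc i)" using R_ratio[of i] R_pos[of "Suc i"] by auto
    then show "2 * real (R i) / real (R (Suc i)) \<le> 4 * \<epsilon>" by (simp add: pos_divide_le_eq)
  qed
  then have "G * (\<Sum>i<J. 2 * real (R i) / real (R (Suc i))) \<le> G * (\<Sum>i<J. 4 * \<epsilon>)"
    using G by (rule mult_left_mono)
  then have 1: "\<bar>avg \<Omega> (\<lambda>\<omega>. g (partial_value J \<omega>)) - avg {..<M} g\<bar> \<le> 4 * (real J * \<epsilon>) * G"
    using partial_value_almost_uniform[of J g G] g G by (simp add: RJ mult_ac)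
  have "(\<Sum>n=1..M. g n) = (\<Sum>n<M. g n) + g M - g 0"
    using sum.atLeast1_atMost_eq[of g M] sum_lessThan_telescope[of g M] by (simp add: sum_subtractf)
  then have "avg {1..M} g - avg {..<M} g = (g M - g 0) / real M"
    by (simp add: avg_def diff_divide_distrib add_divide_distrib)
  then have "\<bar>avg {1..M} g - avg {..<M} g\<bar> \<le> (2 * G) / real M"
    using g[of M] g[of 0] by (simp add: abs_divide) (intro divide_right_mono, auto)
  also have "\<dots> \<le> 4 * (real J * \<epsilon>) * G"
  proof -
    have "1 \<le> 2 * (real M * \<epsilon> ^ J)" using R_lower[of J] RJ by simp
    also have "\<dots> \<le> 2 * (real M * (real J * \<epsilon>))"
    proof (intro mult_left_mono)
      have "\<epsilon> ^ J \<le> \<epsilon> ^ 1" using J1 \<epsilon>_pos \<epsilon>_half by (intro power_decreasing) auto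
      also have "\<dots> \<le> real J * \<epsilon>" using J1 \<epsilon>_pos by simp
      finally show "\<epsilon> ^ J \<le> real J * \<epsilon>" .
    qed auto
    finally have "1 * (2 * G) \<le> 2 * (real M * (real J * \<epsilon>)) * (2 * G)" using G by (intro mult_right_mono) auto
    then show ?thesis using M_pos by (simp add: pos_divide_le_eq mult_ac)
  qed
  finally show ?thesis using 1 by linarith
qed

text \<open>
  An a priori bound for all the sums that occur, used where a crude estimate is compensated by the factor \<open>\<epsilon>\<close>.
\<close>

definition "Y = 48 * real a * (real (J * l))\<^sup>2 * V"

lemma V_le_Y: "V \<le> Y"
proof -
  have "1 * 1 \<le> (48 * real a) * (real (J * l))\<^sup>2" 
    using a1 J1 l1 by (intro mult_mono one_le_power) (auto simp: Suc_le_eq simp flip: of_nat_mult)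
  then have "1 * V \<le> ((48 * real a) * (real (J * l))\<^sup>2) * V"
    using V_nonneg by (intro mult_right_mono) auto
  then show ?thesis by (simp add: Y_def)
qed

lemma Y_nonneg: "0 \<le> Y"
  using V_le_Y V_nonneg by linarith

lemma orbit_sum_bound:
  assumes "n \<le> M"
  shows "\<bar>orbit_sum 0 n\<bar> \<le> Y"
proof -
  have "n < q (Suc (Suc J * l))" using assms M_upper by linarith
  from sum_cost_digits[OF this, of 1] have "\<bar>orbit_sum 0 n\<bar> \<le> real (3 * a * (Suc J * l)\<^sup>2) * V"
    by (simp add: sum_cost_def)
  also have "\<dots> \<le> (3 * real a * (4 * real (J * l))\<^sup>2) * V"
  proof (rule mult_right_mono[OF _ V_nonneg])
    have "Suc J * l \<le> (4 * J) * l" using J1 by (intro mult_le_mono1) simp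
    then have "(Suc J * l)\<^sup>2 \<le> (4 * J * l)\<^sup>2" by (intro power_mono) auto
    then have "real (3 * a * (Suc J * l)\<^sup>2) \<le> real (3 * a * (4 * J * l)\<^sup>2)"
      by (simp only: of_nat_le_iff mult_le_mono2)
    then show "real (3 * a * (Suc J * l)\<^sup>2) \<le> 3 * real a * (4 * real (J * l))\<^sup>2" by (simp add: mult_ac)
  qed
  also have "\<dots> = Y" by (simp add: Y_def power_mult_distrib)
  finally show ?thesis .
qed

lemma local_sum_bound:
  assumes "\<omega> \<in> \<Omega>"
  shows "\<bar>\<Sum>j<J. local_block j \<omega>\<bar> \<le> Y"
proof -
  have "\<bar>\<Sum>j<J. local_block j \<omega>\<bar> \<le> (\<Sum>j<J. 48 * real a * (real l)\<^sup>2 * V)"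
    by (rule order_trans[OF sum_abs]) (intro sum_mono local_block_bound assms, simp)
  also have "\<dots> = real J * (48 * real a * (real l)\<^sup>2 * V)" by simp
  also have "\<dots> \<le> (real J)\<^sup>2 * (48 * real a * (real l)\<^sup>2 * V)"
    using J1 V_nonneg by (intro mult_right_mono) (auto simp: power2_eq_square)
  also have "\<dots> = Y" by (simp add: Y_def power_mult_distrib)
  finally show ?thesis .
qed

lemma birkhoff_sum_eq: "birkhoff_sum \<alpha> f n = orbit_sum 0 n"
  by (simp add: birkhoff_sum_def orbit_sum_def)

lemma birkhoff_mean_eq: "birkhoff_mean \<alpha> f M = avg {1..M} (orbit_sum 0)"
  by (simp add: birkhoff_mean_def avg_def birkhoff_sum_eq)

lemma birkhoff_sd_eq: 
  "(birkhoff_sd \<alpha> f M)\<^sup>2 = avg {1..M} (\<lambda>n. (orbit_sum 0 n - birkhoff_mean \<alpha> f M)\<^sup>2)"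
  by (simp add: birkhoff_sd_def avg_def birkhoff_sum_eq sum_nonneg)

lemma mean_bound: "\<bar>birkhoff_mean \<alpha> f M\<bar> \<le> Y"
  unfolding birkhoff_mean_eq using M_pos orbit_sum_bound by (intro avg_bound) auto

abbreviation "random_sum \<omega> \<equiv> orbit_sum 0 (partial_value J \<omega>)"
abbreviation "local_sum \<omega> \<equiv> \<Sum>j<J. local_block j \<omega>"

lemma random_sum_bound: "\<omega> \<in> \<Omega> \<Longrightarrow> \<bar>random_sum \<omega>\<bar> \<le> Y"
  using partial_value_less[of \<omega> J] by (intro orbit_sum_bound) (simp add: R_def)

lemma local_sum_approx: "avg \<Omega> (\<lambda>\<omega>. \<bar>local_sum \<omega> - random_sum \<omega>\<bar>) \<le> 40 * (real J * \<epsilon>) * V"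
proof -
  have "avg \<Omega> (\<lambda>\<omega>. \<bar>local_sum \<omega> - random_sum \<omega>\<bar>) \<le> avg \<Omega> (\<lambda>\<omega>. \<Sum>j<J. \<bar>block j \<omega> - local_block j \<omega>\<bar>)"
  proof (rule avg_mono)
    fix \<omega>
    have "local_sum \<omega> - random_sum \<omega> = (\<Sum>j<J. local_block j \<omega> - block j \<omega>)"
      by (simp add: orbit_sum_blocks sum_subtractf)
    then show "\<bar>local_sum \<omega> - random_sum \<omega>\<bar> \<le> (\<Sum>j<J. \<bar>block j \<omega> - local_block j \<omega>\<bar>)"
      using sum_abs[of "\<lambda>j. local_block j \<omega> - block j \<omega>" "{..<J}"] by (simp add: abs_minus_commute)
  qed
  also have "\<dots> \<le> (\<Sum>j<J. 40 * \<epsilon> * V)"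
    unfolding avg_sum by (intro sum_mono block_approx) simp
  finally show ?thesis by simp
qed

text \<open>
  Two replacements: blocks by local blocks, and the random digits by a uniform \<open>N\<close>.
\<close>

lemma mean_approx: "\<bar>avg \<Omega> local_sum - birkhoff_mean \<alpha> f M\<bar> \<le> 48 * (real J * \<epsilon>) * Y"
proof -
  have "\<bar>avg \<Omega> local_sum - avg \<Omega> random_sum\<bar> \<le> 40 * (real J * \<epsilon>) * V"
    using avg_le_of_abs_diff[of \<Omega> local_sum "\<lambda>\<omega>. random_sum \<omega>" "\<lambda>\<omega>. \<bar>local_sum \<omega> - random_sum \<omega>\<bar>"] local_sum_approx by simp
  also have "\<dots> \<le> 40 * (real J * \<epsilon>) * Y" using V_le_Y \<epsilon>_pos by (intro mult_left_mono) auto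
  finally have "\<bar>avg \<Omega> local_sum - avg \<Omega> random_sum\<bar> \<le> 40 * (real J * \<epsilon>) * Y" .
  moreover have "\<bar>birkhoff_mean \<alpha> f M - avg \<Omega> random_sum\<bar> \<le> 8 * (real J * \<epsilon>) * Y"
    unfolding birkhoff_mean_eq by (rule value_almost_uniform[OF orbit_sum_bound])
  ultimately show ?thesis by (simp add: abs_le_iff algebra_simps)
qed

lemma variance_approx:
  "\<bar>avg \<Omega> (\<lambda>\<omega>. (local_sum \<omega> - avg \<Omega> local_sum)\<^sup>2) - (birkhoff_sd \<alpha> f M)\<^sup>2\<bar> \<le> 384 * (real J * \<epsilon>) * Y\<^sup>2"
proof -
  define A where "A = birkhoff_mean \<alpha> f M"
  define A' where "A' = avg \<Omega> local_sum"
  have A': "\<bar>A'\<bar> \<le> Y" unfolding A'_def by (intro avg_bound finite_\<Omega> \<Omega>_nonempty local_sum_bound)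
  have A: "\<bar>A\<bar> \<le> Y" unfolding A_def by (rule mean_bound)
  have diff: "\<bar>A' - A\<bar> \<le> 48 * (real J * \<epsilon>) * Y" unfolding A_def A'_def by (rule mean_approx)
  have "\<bar>avg \<Omega> (\<lambda>\<omega>. (local_sum \<omega> - A')\<^sup>2) - avg \<Omega> (\<lambda>\<omega>. (random_sum \<omega> - A)\<^sup>2)\<bar> 
     \<le> avg \<Omega> (\<lambda>\<omega>. 4 * Y * (\<bar>local_sum \<omega> - random_sum \<omega>\<bar> + \<bar>A' - A\<bar>))"
  proof (rule avg_le_of_abs_diff)
    fix \<omega> assume \<omega>: "\<omega> \<in> \<Omega>"
    have "\<bar>(local_sum \<omega> - A')\<^sup>2 - (random_sum \<omega> - A)\<^sup>2\<bar> 
        = \<bar>(local_sum \<omega> - A') + (random_sum \<omega> - A)\<bar> * \<bar>(local_sum \<omega> - A') - (random_sum \<omega> - A)\<bar>"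
      unfolding abs_mult[symmetric] by (simp add: power2_eq_square algebra_simps)
    also have "\<dots> \<le> (4 * Y) * (\<bar>local_sum \<omega> - random_sum \<omega>\<bar> + \<bar>A' - A\<bar>)"
    proof (rule mult_mono)
      show "\<bar>(local_sum \<omega> - A') + (random_sum \<omega> - A)\<bar> \<le> 4 * Y"
        using random_sum_bound[OF \<omega>] local_sum_bound[OF \<omega>] A A' by linarith
    qed (use Y_nonneg in auto)
    finally show "\<bar>(local_sum \<omega> - A')\<^sup>2 - (random_sum \<omega> - A)\<^sup>2\<bar> \<le> 4 * Y * (\<bar>local_sum \<omega> - random_sum \<omega>\<bar> + \<bar>A' - A\<bar>)" .
  qed
  also have "\<dots> = 4 * Y * (avg \<Omega> (\<lambda>\<omega>. \<bar>local_sum \<omega> - random_sum \<omega>\<bar>) + \<bar>A' - A\<bar>)"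
    by (simp only: avg_cmult avg_add avg_const[OF finite_\<Omega> \<Omega>_nonempty])
  also have "\<dots> \<le> 4 * Y * (40 * (real J * \<epsilon>) * Y + 48 * (real J * \<epsilon>) * Y)"
  proof (intro mult_left_mono add_mono diff)
    show "avg \<Omega> (\<lambda>\<omega>. \<bar>local_sum \<omega> - random_sum \<omega>\<bar>) \<le> 40 * (real J * \<epsilon>) * Y"
      using local_sum_approx mult_left_mono[OF V_le_Y, of "40 * (real J * \<epsilon>)"] \<epsilon>_pos by auto
  qed (use Y_nonneg in simp)
  finally have 1: "\<bar>avg \<Omega> (\<lambda>\<omega>. (local_sum \<omega> - A')\<^sup>2) - avg \<Omega> (\<lambda>\<omega>. (random_sum \<omega> - A)\<^sup>2)\<bar> \<le> 352 * (real J * \<epsilon>) * Y\<^sup>2"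
    by (simp add: power2_eq_square algebra_simps)
  have "\<bar>avg {1..M} (\<lambda>n. (orbit_sum 0 n - A)\<^sup>2) - avg \<Omega> (\<lambda>\<omega>. (random_sum \<omega> - A)\<^sup>2)\<bar> \<le> 8 * (real J * \<epsilon>) * (2 * Y)\<^sup>2"
  proof (rule value_almost_uniform)
    fix n assume "n \<le> M"
    then have "\<bar>orbit_sum 0 n - A\<bar> \<le> \<bar>2 * Y\<bar>" using orbit_sum_bound[of n] A by linarith
    then show "\<bar>(orbit_sum 0 n - A)\<^sup>2\<bar> \<le> (2 * Y)\<^sup>2" by (simp only: abs_power2 abs_le_square_iff)
  qed
  then have 2: "\<bar>(birkhoff_sd \<alpha> f M)\<^sup>2 - avg \<Omega> (\<lambda>\<omega>. (random_sum \<omega> - A)\<^sup>2)\<bar> \<le> 32 * (real J * \<epsilon>) * Y\<^sup>2"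
    unfolding birkhoff_sd_eq A_def by (simp add: power_mult_distrib)
  show ?thesis using 1 2 unfolding A'_def[symmetric] by (simp add: abs_le_iff algebra_simps)
qed

text \<open>
  The first two terms pay for replacing the uniform \<open>N\<close> by random digits and the blocks by local blocks
  inside the Lipschitz function \<open>h\<close>; the others come from \<open>stein_local_dependence\<close> with windows of
  four digits, where \<open>B\<close> instead of the exact standard deviation of the local sum is used for scaling.
\<close>

lemma smooth_normal_approximation:
  fixes \<delta> s :: real
  assumes B: "birkhoff_sd \<alpha> f M > 0" and \<delta>: "\<delta> > 0"
  defines "B \<equiv> birkhoff_sd \<alpha> f M" and "A \<equiv> birkhoff_mean \<alpha> f M" and "\<kappa> \<equiv> real J * \<epsilon>"
  defines "\<beta> \<equiv> 96 * real a * (real l)\<^sup>2 * V / B" and "h \<equiv> ramp s \<delta>"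
  shows "\<bar>avg {1..M} (\<lambda>N. h ((orbit_sum 0 N - A) / B)) - (LINT x|lborel. std_normal_density x * h x)\<bar>
    \<le> 8 * \<kappa> + 88 * \<kappa> * Y / (\<delta> * B) + 768 * \<kappa> * Y\<^sup>2 / B\<^sup>2 + 2 * sqrt (6144 * real J) * \<beta>\<^sup>2
       + 64 * real J * \<beta> ^ 3 * (7 + 384 * \<kappa> * Y\<^sup>2 / B\<^sup>2 + 1 / \<delta>)"
proof -
  define A' where "A' = avg \<Omega> local_sum"
  define \<xi> where "\<xi> = (\<lambda>j \<omega>. (local_block j \<omega> - avg \<Omega> (local_block j)) / B)"
  define W where "W = (\<lambda>\<omega>. \<Sum>j<J. \<xi> j \<omega>)"
  note h_bounds = ramp_bounds[of s \<delta>, folded h_def]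
  note h_lip = ramp_lipschitz[OF \<delta>, of s, folded h_def]
  have B0: "B > 0" using B by (simp add: B_def)
  have \<kappa>0: "\<kappa> \<ge> 0" using \<epsilon>_pos by (simp add: \<kappa>_def)
  have W_eq: "W \<omega> = (local_sum \<omega> - A') / B" for \<omega>
    by (simp add: W_def \<xi>_def A'_def avg_sum sum_subtractf flip: sum_divide_distrib)
  have "avg \<Omega> (\<lambda>\<omega>. (W \<omega>)\<^sup>2) = avg \<Omega> (\<lambda>\<omega>. (local_sum \<omega> - A')\<^sup>2) / B\<^sup>2"
    by (simp add: W_eq power_divide avg_divide)
  then have "avg \<Omega> (\<lambda>\<omega>. (W \<omega>)\<^sup>2) - 1 = (avg \<Omega> (\<lambda>\<omega>. (local_sum \<omega> - A')\<^sup>2) - B\<^sup>2) / B\<^sup>2"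
    using B0 by (simp add: diff_divide_distrib)
  then have "\<bar>avg \<Omega> (\<lambda>\<omega>. (W \<omega>)\<^sup>2) - 1\<bar> = \<bar>avg \<Omega> (\<lambda>\<omega>. (local_sum \<omega> - A')\<^sup>2) - B\<^sup>2\<bar> / B\<^sup>2"
    by (simp add: abs_divide)
  also have "\<dots> \<le> 384 * \<kappa> * Y\<^sup>2 / B\<^sup>2"
    using variance_approx unfolding A'_def B_def \<kappa>_def by (intro divide_right_mono) auto
  finally have varW: "\<bar>avg \<Omega> (\<lambda>\<omega>. (W \<omega>)\<^sup>2) - 1\<bar> \<le> 384 * \<kappa> * Y\<^sup>2 / B\<^sup>2" .
  define \<Xi> where "\<Xi> = avg \<Omega> (\<lambda>\<omega>. (W \<omega>)\<^sup>2)"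
  have \<beta>0: "0 \<le> \<beta>" using B0 V_nonneg by (simp add: \<beta>_def)
  have J0: "0 \<le> 64 * real J * \<beta> ^ 3" using \<beta>0 by simp
  have "\<bar>avg \<Omega> (\<lambda>\<omega>. h (W \<omega>)) - (LINT x|lborel. std_normal_density x * h x)\<bar>
     \<le> 2 * \<bar>1 - \<Xi>\<bar> + 2 * sqrt (96 * real 4 ^ 3 * real J) * \<beta>\<^sup>2
        + 4 * (real 4)\<^sup>2 * real J * \<beta> ^ 3 * (6 + \<Xi> + 1 / \<delta>)"
    unfolding W_def \<Xi>_def
  proof (rule stein_local_dependence[OF finite_\<Omega> \<Omega>_nonempty \<Omega>_def])
    show "depends_on (\<xi> j) {j..<j + 4}" if "j < J" for j
      unfolding \<xi>_def by (rule depends_on_compose[OF depends_on_local_block[OF that]])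
    show "avg \<Omega> (\<xi> j) = 0" for j
      by (simp add: \<xi>_def avg_divide avg_diff avg_const finite_\<Omega> \<Omega>_nonempty)
    show "\<bar>\<xi> j \<omega>\<bar> \<le> \<beta>" if "j < J" "\<omega> \<in> \<Omega>" for j \<omega>
    proof -
      have "\<bar>avg \<Omega> (local_block j)\<bar> \<le> 48 * real a * (real l)\<^sup>2 * V"
        using local_block_bound that by (intro avg_bound finite_\<Omega> \<Omega>_nonempty) auto
      then have "\<bar>local_block j \<omega> - avg \<Omega> (local_block j)\<bar> \<le> 96 * real a * (real l)\<^sup>2 * V"
        using local_block_bound[OF that] by linarith
      then show ?thesis unfolding \<xi>_def \<beta>_def abs_divide using B0 by (simp add: divide_right_mono)
    qed
    show "continuous_on UNIV h" unfolding h_def by (rule continuous_on_ramp[OF \<delta>])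
  qed (use \<beta>0 \<delta> h_bounds h_lip in auto)
  also have "\<dots> = 2 * \<bar>\<Xi> - 1\<bar> + 2 * sqrt (6144 * real J) * \<beta>\<^sup>2 + 64 * real J * \<beta> ^ 3 * (6 + \<Xi> + 1 / \<delta>)"
    by (simp add: abs_minus_commute power3_eq_cube power2_eq_square)
  also have "\<dots> \<le> 2 * (384 * \<kappa> * Y\<^sup>2 / B\<^sup>2) + 2 * sqrt (6144 * real J) * \<beta>\<^sup>2 
      + 64 * real J * \<beta> ^ 3 * (7 + 384 * \<kappa> * Y\<^sup>2 / B\<^sup>2 + 1 / \<delta>)"
  proof -
    have "\<bar>\<Xi> - 1\<bar> \<le> 384 * \<kappa> * Y\<^sup>2 / B\<^sup>2" using varW by (simp only: \<Xi>_def)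
    moreover from this have "64 * real J * \<beta> ^ 3 * (6 + \<Xi> + 1 / \<delta>) \<le> 64 * real J * \<beta> ^ 3 * (7 + 384 * \<kappa> * Y\<^sup>2 / B\<^sup>2 + 1 / \<delta>)"
      by (intro mult_left_mono J0) linarith
    ultimately show ?thesis by (intro add_mono order_refl mult_left_mono[of "\<bar>\<Xi> - 1\<bar>"]) simp_all
  qed
  finally have stein: "\<bar>avg \<Omega> (\<lambda>\<omega>. h (W \<omega>)) - (LINT x|lborel. std_normal_density x * h x)\<bar>
    \<le> 768 * \<kappa> * Y\<^sup>2 / B\<^sup>2 + 2 * sqrt (6144 * real J) * \<beta>\<^sup>2 
      + 64 * real J * \<beta> ^ 3 * (7 + 384 * \<kappa> * Y\<^sup>2 / B\<^sup>2 + 1 / \<delta>)" by simp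
  have coupling: "\<bar>avg {1..M} (\<lambda>N. h ((orbit_sum 0 N - A) / B)) - avg \<Omega> (\<lambda>\<omega>. h ((random_sum \<omega> - A) / B))\<bar> \<le> 8 * \<kappa> * 1"
    unfolding \<kappa>_def by (rule value_almost_uniform[where g="\<lambda>N. h ((orbit_sum 0 N - A) / B)"]) (simp add: h_bounds)
  have "\<bar>avg \<Omega> (\<lambda>\<omega>. h ((random_sum \<omega> - A) / B)) - avg \<Omega> (\<lambda>\<omega>. h (W \<omega>))\<bar>
     \<le> avg \<Omega> (\<lambda>\<omega>. (1 / (\<delta> * B)) * (\<bar>local_sum \<omega> - random_sum \<omega>\<bar> + \<bar>A' - A\<bar>))"
  proof (rule avg_le_of_abs_diff)
    fix \<omega>
    have "\<bar>h ((random_sum \<omega> - A) / B) - h (W \<omega>)\<bar> \<le> \<bar>(random_sum \<omega> - A) / B - W \<omega>\<bar> / \<delta>" by (rule h_lip)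
    also have "(random_sum \<omega> - A) / B - W \<omega> = ((random_sum \<omega> - A) - (local_sum \<omega> - A')) / B"
      unfolding W_eq by (rule diff_divide_distrib[symmetric])
    also have "\<bar>\<dots>\<bar> / \<delta> = \<bar>(random_sum \<omega> - A) - (local_sum \<omega> - A')\<bar> / (\<delta> * B)"
      using B0 by (simp add: abs_divide mult.commute)
    also have "\<dots> \<le> (\<bar>local_sum \<omega> - random_sum \<omega>\<bar> + \<bar>A' - A\<bar>) / (\<delta> * B)"
      using B0 \<delta> by (intro divide_right_mono) auto
    finally show "\<bar>h ((random_sum \<omega> - A) / B) - h (W \<omega>)\<bar> \<le> (1 / (\<delta> * B)) * (\<bar>local_sum \<omega> - random_sum \<omega>\<bar> + \<bar>A' - A\<bar>)"
      by simp
  qed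
  also have "\<dots> = (1 / (\<delta> * B)) * (avg \<Omega> (\<lambda>\<omega>. \<bar>local_sum \<omega> - random_sum \<omega>\<bar>) + \<bar>A' - A\<bar>)"
    by (simp only: avg_cmult avg_add avg_const[OF finite_\<Omega> \<Omega>_nonempty])
  also have "\<dots> \<le> (1 / (\<delta> * B)) * (40 * \<kappa> * Y + 48 * \<kappa> * Y)"
  proof (intro mult_left_mono add_mono)
    show "avg \<Omega> (\<lambda>\<omega>. \<bar>local_sum \<omega> - random_sum \<omega>\<bar>) \<le> 40 * \<kappa> * Y"
      using local_sum_approx mult_left_mono[OF V_le_Y, of "40 * \<kappa>"] \<kappa>0 by (auto simp: \<kappa>_def)
    show "\<bar>A' - A\<bar> \<le> 48 * \<kappa> * Y" unfolding A'_def A_def \<kappa>_def by (rule mean_approx)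
  qed (use B0 \<delta> in auto)
  finally have replace: "\<bar>avg \<Omega> (\<lambda>\<omega>. h ((random_sum \<omega> - A) / B)) - avg \<Omega> (\<lambda>\<omega>. h (W \<omega>))\<bar> \<le> 88 * \<kappa> * Y / (\<delta> * B)"
    by (simp add: algebra_simps)
  show ?thesis using coupling replace stein by linarith
qed

text \<open>
  The indicator of \<open>{..t}\<close> lies between the ramps ending and starting at \<open>t\<close>, and the Gaussian distribution
  function is 1-Lipschitz.
\<close>

lemma normal_approximation:
  fixes \<delta> t :: real
  assumes B: "birkhoff_sd \<alpha> f M > 0" and \<delta>: "\<delta> > 0"
  defines "B \<equiv> birkhoff_sd \<alpha> f M" and "\<kappa> \<equiv> real J * \<epsilon>"
  defines "\<beta> \<equiv> 96 * real a * (real l)\<^sup>2 * V / B"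
  shows "\<bar>(1 / real M) * real (card {N \<in> {1..M}. (birkhoff_sum \<alpha> f N - birkhoff_mean \<alpha> f M) / B \<le> t})
            - (LBINT x:{..t}. std_normal_density x)\<bar>
    \<le> \<delta> + (8 * \<kappa> + 88 * \<kappa> * Y / (\<delta> * B) + 768 * \<kappa> * Y\<^sup>2 / B\<^sup>2 + 2 * sqrt (6144 * real J) * \<beta>\<^sup>2
       + 64 * real J * \<beta> ^ 3 * (7 + 384 * \<kappa> * Y\<^sup>2 / B\<^sup>2 + 1 / \<delta>))"
    (is "\<bar>?P - ?\<Phi>\<bar> \<le> \<delta> + ?E")
proof -
  define w where "w = (\<lambda>N. (orbit_sum 0 N - birkhoff_mean \<alpha> f M) / B)"
  have smooth: "\<bar>avg {1..M} (\<lambda>N. ramp s \<delta> (w N)) - (LINT x|lborel. std_normal_density x * ramp s \<delta> x)\<bar> \<le> ?E" for s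
    using smooth_normal_approximation[OF B \<delta>, of s] unfolding w_def B_def \<kappa>_def \<beta>_def .
  have "(\<Sum>N\<in>{1..M}. of_bool (w N \<le> t) :: real) = real (card {N \<in> {1..M}. w N \<le> t})"
    by (simp add: of_bool_def sum.If_cases Int_def)
  then have P: "?P = avg {1..M} (\<lambda>N. of_bool (w N \<le> t))"
    by (simp add: avg_def w_def birkhoff_sum_eq)
  have "?P \<le> avg {1..M} (\<lambda>N. ramp t \<delta> (w N))"
    unfolding P using ramp_bounds ramp_eq_1[OF \<delta>] by (intro avg_mono) (auto simp: of_bool_def)
  moreover have "avg {1..M} (\<lambda>N. ramp (t - \<delta>) \<delta> (w N)) \<le> ?P"
    unfolding P using ramp_bounds ramp_eq_0[OF \<delta>, of "t - \<delta>"] by (intro avg_mono) (auto simp: of_bool_def)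
  moreover have "(LINT x|lborel. std_normal_density x * ramp t \<delta> x) \<le> ?\<Phi> + \<delta>"
    using std_normal_ramp(2)[OF \<delta>, of t] std_normal_cdf_lipschitz[of \<delta> t] \<delta> by linarith
  moreover have "?\<Phi> - \<delta> \<le> (LINT x|lborel. std_normal_density x * ramp (t - \<delta>) \<delta> x)"
    using std_normal_ramp(1)[OF \<delta>, of "t - \<delta>"] std_normal_cdf_lipschitz[of \<delta> "t - \<delta>"] \<delta> by simp
  ultimately show ?thesis using smooth[of t] smooth[of "t - \<delta>"] by linarith
qed

end

section \<open>Choice of the block length\<close>

text \<open>
  Here \<open>k ^ 3\<close> stands for \<open>ln M\<close>, \<open>L\<close> for \<open>ln (ln M)\<close>, \<open>y\<close> for \<open>V / B\<close> and \<open>u\<close> for the a priori bound in units of \<open>V\<close>. The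
  seventh power in the bound for \<open>\<kappa>\<close> beats the powers of \<open>ln M\<close> in \<open>u\<close> and in the lower bound for \<open>y\<close>. The
  decisive term is \<open>J * \<beta> ^ 3\<close>: it is at most a multiple of \<open>k ^ 3 * (L\<^sup>2 * y) ^ 3 = \<delta> ^ 3\<close>.
\<close>

lemma error_terms:
  fixes k L y \<delta> \<kappa> u \<beta> J c1 c2 c3 :: real
  assumes k: "k \<ge> 1" and L: "L \<ge> 1" and y: "y > 0" and \<delta>: "\<delta> = y * k * L\<^sup>2" "\<delta> \<le> 1"
    and \<kappa>: "0 \<le> \<kappa>" "\<kappa> \<le> c1 / (k ^ 3) ^ 7" and u: "0 \<le> u" "u \<le> c2 * (k ^ 3)\<^sup>2"
    and y_lower: "1 \<le> 2 * c2 * (k ^ 3)\<^sup>2 * y"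
    and J: "0 \<le> J" "J \<le> c1 * k ^ 3" and \<beta>: "0 \<le> \<beta>" "\<beta> \<le> c3 * L\<^sup>2 * y"
  shows "\<delta> + (8 * \<kappa> + 88 * \<kappa> * (u * y) / \<delta> + 768 * \<kappa> * (u * y)\<^sup>2 + 2 * sqrt (6144 * J) * \<beta>\<^sup>2
       + 64 * J * \<beta> ^ 3 * (7 + 384 * \<kappa> * (u * y)\<^sup>2 + 1 / \<delta>))
    \<le> (1 + 16 * c1 * c2 + 176 * c1 * c2\<^sup>2 + 768 * c1 * c2\<^sup>2 + 160 * sqrt c1 * c3\<^sup>2 
       + 64 * c1 * c3 ^ 3 * (8 + 384 * c1 * c2\<^sup>2)) * \<delta>"
proof -
  define K where "K = k ^ 3"
  have K1: "K \<ge> 1" using k by (simp add: K_def)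
  have c1: "0 \<le> c1" using J K1 unfolding K_def[symmetric] by (smt (verit) mult_neg_pos)
  have c2: "0 \<le> c2" using u K1 unfolding K_def[symmetric] by (smt (verit) mult_neg_pos zero_less_power)
  have yL: "0 < L\<^sup>2 * y" using L y by simp
  have c3: "0 \<le> c3" using \<beta> yL by (smt (verit) mult_neg_pos mult.assoc)
  have kL1: "1 * 1 \<le> k * L\<^sup>2" using k L by (intro mult_mono one_le_power) auto
  have y\<delta>: "y \<le> \<delta>" unfolding \<delta>(1) using kL1 y mult_left_mono[of 1 "k * L\<^sup>2" y] by (simp add: mult.assoc)
  have \<delta>0: "0 < \<delta>" using y y\<delta> by linarith
  have y1: "y \<le> 1" using y\<delta> \<delta> by linarith
  have K2: "1 / K\<^sup>2 \<le> 2 * c2 * y"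
    using y_lower K1 unfolding K_def[symmetric] by (simp add: pos_divide_le_eq mult_ac)
  have Kp: "1 / K ^ n \<le> 1 / K\<^sup>2" if "n \<ge> 2" for n
    using K1 that by (intro divide_left_mono power_increasing) auto
  have \<kappa>u: "\<kappa> * u \<le> c1 * c2 * (1 / K ^ 5)"
  proof -
    have "\<kappa> * u \<le> (c1 / K ^ 7) * (c2 * K\<^sup>2)"
      using \<kappa> u c1 K1 unfolding K_def[symmetric] by (intro mult_mono) auto
    also have "\<dots> = c1 * c2 * (1 / K ^ 5)" using K1 by (simp add: field_simps eval_nat_numeral)
    finally show ?thesis .
  qed
  have T1: "8 * \<kappa> \<le> 16 * c1 * c2 * \<delta>"
  proof -
    have "\<kappa> \<le> c1 * (1 / K ^ 7)" using \<kappa> by (simp add: K_def)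
    also have "\<dots> \<le> c1 * (2 * c2 * \<delta>)"
    proof (intro mult_left_mono c1)
      have "2 * c2 * y \<le> 2 * c2 * \<delta>" using y\<delta> c2 by (intro mult_left_mono) auto
      then show "1 / K ^ 7 \<le> 2 * c2 * \<delta>" using Kp[of 7] K2 by linarith
    qed
    finally show ?thesis by (simp add: mult_ac)
  qed
  have T2: "88 * \<kappa> * (u * y) / \<delta> \<le> 176 * c1 * c2\<^sup>2 * \<delta>"
  proof -
    have "y / \<delta> \<le> 1" using y\<delta> \<delta>0 by (simp add: pos_divide_le_eq)
    have "\<kappa> * u * (y / \<delta>) \<le> \<kappa> * u * 1"
      using \<kappa> u \<open>y / \<delta> \<le> 1\<close> by (intro mult_left_mono) auto
    also have "\<dots> \<le> c1 * c2 * (1 / K ^ 5)" using \<kappa>u by simp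
    also have "\<dots> \<le> c1 * c2 * (2 * c2 * \<delta>)"
    proof (intro mult_left_mono)
      have "2 * c2 * y \<le> 2 * c2 * \<delta>" using y\<delta> c2 by (intro mult_left_mono) auto
      then show "1 / K ^ 5 \<le> 2 * c2 * \<delta>" using Kp[of 5] K2 by linarith
    qed (use c1 c2 in auto)
    finally have "88 * (\<kappa> * u * (y / \<delta>)) \<le> 88 * (c1 * c2 * (2 * c2 * \<delta>))" by simp
    then show ?thesis by (simp add: power2_eq_square mult_ac)
  qed
  have \<kappa>uy: "\<kappa> * (u * y)\<^sup>2 \<le> c1 * c2\<^sup>2 * y"
  proof -
    have "\<kappa> * (u * y)\<^sup>2 = (\<kappa> * u) * u * y\<^sup>2" by (simp add: power2_eq_square mult_ac)
    also have "\<dots> \<le> (c1 * c2 * (1 / K ^ 5)) * (c2 * K\<^sup>2) * y\<^sup>2"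
    proof (rule mult_right_mono[OF mult_mono[OF \<kappa>u]])
      show "u \<le> c2 * K\<^sup>2" using u by (simp add: K_def)
    qed (use u c1 c2 K1 in auto)
    also have "\<dots> = c1 * c2\<^sup>2 * (y\<^sup>2 * (1 / K ^ 3))" using K1 by (simp add: field_simps eval_nat_numeral)
    also have "\<dots> \<le> c1 * c2\<^sup>2 * (y * 1)"
    proof (intro mult_left_mono mult_mono)
      show "y\<^sup>2 \<le> y" using y y1 by (simp add: power2_eq_square mult_left_le)
      show "1 / K ^ 3 \<le> 1" using K1 by simp
    qed (use c1 c2 K1 y in auto)
    finally show ?thesis by simp
  qed
  have \<kappa>uy1: "\<kappa> * (u * y)\<^sup>2 \<le> c1 * c2\<^sup>2"
    using \<kappa>uy mult_left_mono[OF y1, of "c1 * c2\<^sup>2"] c1 by simp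
  have T3: "768 * \<kappa> * (u * y)\<^sup>2 \<le> 768 * c1 * c2\<^sup>2 * \<delta>"
    using \<kappa>uy mult_left_mono[OF y\<delta>, of "c1 * c2\<^sup>2"] c1 by simp
  have T4: "2 * sqrt (6144 * J) * \<beta>\<^sup>2 \<le> 160 * sqrt c1 * c3\<^sup>2 * \<delta>"
  proof -
    have "6144 * J \<le> 6400 * (c1 * (k ^ 4))"
    proof -
      have "k ^ 3 \<le> k ^ 4" using k by (intro power_increasing) auto
      then have "c1 * k ^ 3 \<le> c1 * k ^ 4" using c1 by (rule mult_left_mono)
      then show ?thesis using J by linarith
    qed
    then have "sqrt (6144 * J) \<le> sqrt (6400 * (c1 * (k ^ 4)))" by (rule real_sqrt_le_mono)
    also have "6400 * (c1 * (k ^ 4)) = (80 * k\<^sup>2)\<^sup>2 * c1" by (simp add: power2_eq_square power4_eq_xxxx)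
    also have "sqrt \<dots> = 80 * k\<^sup>2 * sqrt c1" by (simp only: real_sqrt_mult real_sqrt_abs) simp
    finally have "2 * sqrt (6144 * J) * \<beta>\<^sup>2 \<le> 2 * (80 * k\<^sup>2 * sqrt c1) * (c3 * L\<^sup>2 * y)\<^sup>2"
      using \<beta> c1 J(1) by (intro mult_mono power_mono) auto
    also have "\<dots> = 160 * sqrt c1 * c3\<^sup>2 * \<delta>\<^sup>2"
      unfolding \<delta>(1) by (simp add: power2_eq_square mult_ac)
    also have "\<dots> \<le> 160 * sqrt c1 * c3\<^sup>2 * \<delta>"
      using \<delta> \<delta>0 c1 by (intro mult_left_mono) (auto simp: power2_eq_square mult_left_le)
    finally show ?thesis .
  qed
  have T5: "64 * J * \<beta> ^ 3 * (7 + 384 * \<kappa> * (u * y)\<^sup>2 + 1 / \<delta>) \<le> 64 * c1 * c3 ^ 3 * (8 + 384 * c1 * c2\<^sup>2) * \<delta>"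
  proof -
    have "64 * J * \<beta> ^ 3 \<le> 64 * (c1 * k ^ 3) * (c3 * L\<^sup>2 * y) ^ 3"
      using J \<beta> by (intro mult_mono power_mono) auto
    also have "\<dots> = 64 * c1 * c3 ^ 3 * \<delta> ^ 3"
      unfolding \<delta>(1) by (simp add: power2_eq_square power3_eq_cube mult_ac)
    finally have 1: "64 * J * \<beta> ^ 3 \<le> 64 * c1 * c3 ^ 3 * \<delta> ^ 3" .
    have \<delta>inv: "1 \<le> 1 / \<delta>" using \<delta> \<delta>0 by simp
    then have "(7 + 384 * (c1 * c2\<^sup>2)) * 1 \<le> (7 + 384 * (c1 * c2\<^sup>2)) * (1 / \<delta>)" using c1 by (intro mult_left_mono) auto
    then have 2: "7 + 384 * \<kappa> * (u * y)\<^sup>2 + 1 / \<delta> \<le> (8 + 384 * c1 * c2\<^sup>2) * (1 / \<delta>)"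
      using \<kappa>uy1 by (simp add: algebra_simps add_divide_distrib)
    have "64 * J * \<beta> ^ 3 * (7 + 384 * \<kappa> * (u * y)\<^sup>2 + 1 / \<delta>) 
        \<le> (64 * c1 * c3 ^ 3 * \<delta> ^ 3) * ((8 + 384 * c1 * c2\<^sup>2) * (1 / \<delta>))"
      by (rule mult_mono[OF 1 2]) (use \<kappa> \<delta>0 c1 c3 in auto)
    also have "\<dots> = 64 * c1 * c3 ^ 3 * (8 + 384 * c1 * c2\<^sup>2) * \<delta>\<^sup>2"
      using \<delta>0 by (simp add: power2_eq_square power3_eq_cube)
    also have "\<dots> \<le> 64 * c1 * c3 ^ 3 * (8 + 384 * c1 * c2\<^sup>2) * \<delta>"
      using \<delta> \<delta>0 c1 c3 by (intro mult_left_mono) (auto simp: power2_eq_square mult_left_le)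
    finally show ?thesis .
  qed
  show ?thesis unfolding distrib_right[of _ _ \<delta>] mult_1_left
    using T1 T2 T3 T4 T5 by linarith
qed

context quadratic_rotation
begin

lemma cdenom_ge: "n \<le> q (Suc n)"
proof (induction n rule: induct_nat_012)
  case (ge2 n)
  have "1 * q (Suc (Suc n)) \<le> a * q (Suc (Suc n))" using a1 by (intro mult_right_mono) auto
  moreover have "q (Suc (Suc (Suc n))) = a * q (Suc (Suc n)) + q (Suc n)" by simp
  ultimately show ?case using ge2 cdenom_pos[of n] by linarith
qed (use a1 in auto)

text \<open>
  The block length is chosen so that \<open>\<alpha> ^ l\<close> is at most \<open>(ln M) ^ (- 8)\<close>, which keeps \<open>l\<close> of the order of
  \<open>ln (ln M)\<close>; then \<open>J\<close> is the number of such blocks that fit below \<open>M\<close>.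
\<close>

lemma exists_block_lengths:
  fixes M :: nat
  defines "K \<equiv> ln (real M)" and "\<gamma> \<equiv> - ln \<alpha>"
  assumes M: "M > 0" and K: "3 \<le> K" and large: "8 * ln K + \<gamma> \<le> K"
  obtains l J where "l \<ge> 1" "J \<ge> 1" "\<alpha> ^ l \<le> 1 / K ^ 8" "real l \<le> (8 / \<gamma> + 1) * ln K"
    "real (J * l) \<le> (2 / \<gamma>) * K" "q (Suc (J * l)) \<le> M" "M < q (Suc (Suc J * l))"
proof -
  have \<gamma>: "\<gamma> > 0" using \<alpha>_pos \<alpha>_lt_1 by (simp add: \<gamma>_def)
  have "exp 1 \<le> K" using exp_le K by linarith
  then have L1: "1 \<le> ln K" using K by (simp add: ln_ge_iff)
  define l where "l = nat \<lceil>8 * ln K / \<gamma>\<rceil>"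
  have pos: "0 < 8 * ln K / \<gamma>" using L1 \<gamma> by simp
  then have l1: "l \<ge> 1" unfolding l_def by linarith
  have l_lower: "8 * ln K / \<gamma> \<le> real l" unfolding l_def by linarith
  have l_upper: "real l \<le> 8 * ln K / \<gamma> + 1" unfolding l_def using pos by linarith
  have pow: "\<alpha> ^ n = exp (- \<gamma> * real n)" for n
    using \<alpha>_pos by (simp add: \<gamma>_def mult.commute exp_of_nat_mult)
  have small: "\<alpha> ^ l \<le> 1 / K ^ 8"
  proof -
    have "8 * ln K \<le> \<gamma> * real l" using l_lower \<gamma> by (simp add: pos_divide_le_eq mult.commute)
    then have "\<alpha> ^ l \<le> exp (- (real 8 * ln K))" unfolding pow by simp
    also have "\<dots> = 1 / K ^ 8" using K by (simp only: exp_minus exp_of_nat_mult) (simp add: inverse_eq_divide)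
    finally show ?thesis .
  qed
  have ex: "\<exists>n. M < q (Suc (n * l))"
  proof
    have "M < Suc M * 1" by simp
    also have "\<dots> \<le> Suc M * l" using l1 by (rule mult_le_mono2)
    also have "\<dots> \<le> q (Suc (Suc M * l))" by (rule cdenom_ge)
    finally show "M < q (Suc (Suc M * l))" .
  qed
  define n where "n = (LEAST n. M < q (Suc (n * l)))"
  have n: "M < q (Suc (n * l))" unfolding n_def using ex by (rule LeastI_ex)
  have not_n: "q (Suc (m * l)) \<le> M" if "m < n" for m
    using not_less_Least[of m "\<lambda>n. M < q (Suc (n * l))"] that unfolding n_def by auto
  have "q (Suc l) \<le> M"
  proof -
    have "real (q (Suc l)) \<le> 1 / \<alpha> ^ l" using cdenom_upper[of l] \<alpha>_pos by (simp add: pos_le_divide_eq)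
    also have "\<dots> = exp (\<gamma> * real l)" unfolding pow by (simp add: exp_minus field_simps)
    also have "\<dots> \<le> exp K"
    proof -
      have "\<gamma> * real l \<le> \<gamma> * (8 * ln K / \<gamma> + 1)" using l_upper \<gamma> by (intro mult_left_mono) auto
      also have "\<dots> = 8 * ln K + \<gamma>" using \<gamma> by (simp add: field_simps)
      finally show ?thesis using large by simp
    qed
    also have "\<dots> = real M" using M by (simp add: K_def)
    finally show ?thesis by simp
  qed
  then have "n \<noteq> 1" using n by (intro notI) simp
  moreover have "n \<noteq> 0" using n M by (intro notI) simp
  ultimately have n2: "n \<ge> 2" by linarith
  define J where "J = n - 1"
  have J: "J \<ge> 1" "n = Suc J" using n2 by (auto simp: J_def)
  have qJ: "q (Suc (J * l)) \<le> M" using not_n[of J] J by simp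
  have "real (J * l) \<le> (2 / \<gamma>) * K"
  proof -
    have "exp (\<gamma> * real (J * l)) = 1 / \<alpha> ^ (J * l)" unfolding pow by (simp add: exp_minus field_simps)
    also have "\<dots> \<le> 2 * real (q (Suc (J * l)))"
      using cdenom_lower[of "J * l"] \<alpha>_pos by (simp add: pos_divide_le_eq)
    also have "\<dots> \<le> exp K * exp K"
    proof -
      have "real (q (Suc (J * l))) \<le> exp K" using qJ M by (simp add: K_def)
      moreover have "2 \<le> exp K" using exp_ge_add_one_self[of K] K by linarith
      ultimately show ?thesis by (intro mult_mono) auto
    qed
    also have "\<dots> = exp (2 * K)" by (simp add: mult_exp_exp)
    finally have "\<gamma> * real (J * l) \<le> 2 * K" by simp
    then show ?thesis using \<gamma> by (simp add: pos_le_divide_eq mult.commute)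
  qed
  moreover have "real l \<le> (8 / \<gamma> + 1) * ln K" using l_upper L1 by (simp add: algebra_simps)
  ultimately show ?thesis using that[of l J] l1 J small qJ n by simp
qed

end

lemma birkhoff_sd_le:
  assumes "M > 0" and bd: "\<And>N. N \<in> {1..M} \<Longrightarrow> \<bar>birkhoff_sum \<alpha> f N\<bar> \<le> G"
  shows "birkhoff_sd \<alpha> f M \<le> 2 * G"
proof -
  have G: "0 \<le> G" using bd[of 1] assms(1) by simp
  have "\<bar>avg {1..M} (birkhoff_sum \<alpha> f)\<bar> \<le> G" using assms by (intro avg_bound) auto
  then have mean: "\<bar>birkhoff_mean \<alpha> f M\<bar> \<le> G" by (simp add: birkhoff_mean_def avg_def)
  have "avg {1..M} (\<lambda>N. (birkhoff_sum \<alpha> f N - birkhoff_mean \<alpha> f M)\<^sup>2) \<le> avg {1..M} (\<lambda>_. (2 * G)\<^sup>2)"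
  proof (rule avg_mono)
    fix N assume "N \<in> {1..M}"
    then have "\<bar>birkhoff_sum \<alpha> f N - birkhoff_mean \<alpha> f M\<bar> \<le> \<bar>2 * G\<bar>" using bd[of N] mean by linarith
    then show "(birkhoff_sum \<alpha> f N - birkhoff_mean \<alpha> f M)\<^sup>2 \<le> (2 * G)\<^sup>2" by (simp only: abs_le_square_iff)
  qed
  also have "\<dots> = (2 * G)\<^sup>2" using assms(1) by (intro avg_const) auto
  finally show ?thesis unfolding birkhoff_sd_def avg_def using G
    by (intro real_le_lsqrt) (auto simp: sum_nonneg)
qed

lemma distribution_function_diff_le_1:
  "\<bar>(1 / real M) * real (card {N \<in> {1..M}. P N}) - (LBINT x:{..t}. std_normal_density x)\<bar> \<le> 1"
proof -
  have "card {N \<in> {1..M}. P N} \<le> card {1..M}" by (intro card_mono) auto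
  then have "real (card {N \<in> {1..M}. P N}) \<le> real M" by simp
  then have "(1 / real M) * real (card {N \<in> {1..M}. P N}) \<le> 1"
    by (cases "M = 0") (simp_all add: divide_le_eq)
  moreover have "0 \<le> (1 / real M) * real (card {N \<in> {1..M}. P N})" by simp
  moreover have "0 \<le> (LBINT x:{t<..}. std_normal_density x)"
    unfolding set_lebesgue_integral_def
    by (intro Bochner_Integration.integral_nonneg) (auto simp: indicator_def)
  ultimately show ?thesis using std_normal_cdf_bounds[of t] by linarith
qed

lemma (in rotation_bv) birkhoff_sum_trivial_bound: "\<bar>birkhoff_sum \<alpha> f N\<bar> \<le> 3 * real N * V"
proof -
  have "\<bar>orbit_sum 0 (N * q 1)\<bar> \<le> real (N * 3) * V"
    using sum_cost_mult[OF sum_cost_cdenom[of 1], of N] unfolding sum_cost_def by blast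
  then show ?thesis by (simp add: orbit_sum_def birkhoff_sum_def mult.commute)
qed

lemma (in rotation_bv) normal_approximation_long_orbit:
  fixes M :: nat
  defines "K \<equiv> ln (real M)" and "B \<equiv> birkhoff_sd \<alpha> f M"
  defines "c1 \<equiv> 2 / - ln \<alpha>" 
  defines "c2 \<equiv> 48 * real a * c1\<^sup>2" and "c3 \<equiv> 96 * real a * (8 / - ln \<alpha> + 1)\<^sup>2"
  defines "\<delta> \<equiv> V * K powr (1/3) * (ln K)\<^sup>2 / B"
  assumes M: "M > 0" and K: "3 \<le> K" and large: "8 * ln K + - ln \<alpha> \<le> K"
    and B: "B > 0" and \<delta>1: "\<delta> \<le> 1"
  shows "\<bar>(1 / real M) * real (card {N \<in> {1..M}. (birkhoff_sum \<alpha> f N - birkhoff_mean \<alpha> f M) / B \<le> t})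
            - (LBINT x:{..t}. std_normal_density x)\<bar>
    \<le> (1 + 16 * c1 * c2 + 176 * c1 * c2\<^sup>2 + 768 * c1 * c2\<^sup>2 + 160 * sqrt c1 * c3\<^sup>2 
       + 64 * c1 * c3 ^ 3 * (8 + 384 * c1 * c2\<^sup>2)) * \<delta>"
proof -
  obtain l J where lJ: "l \<ge> 1" "J \<ge> 1" "\<alpha> ^ l \<le> 1 / K ^ 8" "real l \<le> (8 / - ln \<alpha> + 1) * ln K"
    "real (J * l) \<le> c1 * K" "q (Suc (J * l)) \<le> M" "M < q (Suc (Suc J * l))"
    using exists_block_lengths[OF M, folded K_def, OF K large] unfolding c1_def by metis
  have "2 \<le> K ^ 8" using K power_mono[of 2 K 8] by simp
  then have "1 / K ^ 8 \<le> 1 / 2" using K by (intro divide_left_mono) auto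
  then have small: "\<alpha> ^ l \<le> 1 / 2" using lJ(3) by linarith
  interpret block_decomposition a \<alpha> f v V l J M
    by unfold_locales (use lJ small in auto)
  have B2Y: "B \<le> 2 * Y"
    unfolding B_def using M by (intro birkhoff_sd_le) (auto simp: birkhoff_sum_eq orbit_sum_bound)
  have V: "V > 0"
  proof (rule ccontr)
    assume "\<not> V > 0"
    then have "V = 0" using V_nonneg by simp
    have "Y = 48 * real a * (real (J * l))\<^sup>2 * V" by (rule Y_def)
    also have "\<dots> = 0" using \<open>V = 0\<close> by simp
    finally show False using B2Y B by linarith
  qed
  have "exp 1 \<le> K" using exp_le K by linarith
  then have L: "1 \<le> ln K" using K by (simp add: ln_ge_iff)
  define k where "k = K powr (1/3)"
  have k: "k \<ge> 1" unfolding k_def using K by (intro ge_one_powr_ge_zero) auto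
  have k3: "k ^ 3 = K" unfolding k_def using K by (simp add: powr_power)
  define y where "y = V / B"
  define u where "u = Y / V"
  have y: "y > 0" using V B by (simp add: y_def)
  have \<delta>: "\<delta> = y * k * (ln K)\<^sup>2" by (simp add: \<delta>_def y_def k_def)
  have \<delta>0: "\<delta> > 0" unfolding \<delta> using y k L by simp
  have u: "u = 48 * real a * (real (J * l))\<^sup>2" using V by (simp add: u_def Y_def)
  have u_le: "u \<le> c2 * K\<^sup>2"
  proof -
    have "u \<le> 48 * real a * (c1 * K)\<^sup>2"
      unfolding u using lJ(5) by (intro mult_left_mono power_mono) auto
    then show ?thesis by (simp add: c2_def power_mult_distrib)
  qed
  have uy: "u * y = Y / B" using V by (simp add: u_def y_def)
  have JK: "real J \<le> c1 * K"
  proof -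
    have "J * 1 \<le> J * l" using lJ(1) by (rule mult_le_mono2)
    then have "real J \<le> real (J * l)" by (simp only: of_nat_le_iff mult_1_right)
    then show ?thesis using lJ(5) by linarith
  qed
  define \<beta> where "\<beta> = 96 * real a * (real l)\<^sup>2 * V / B"
  have "\<bar>(1 / real M) * real (card {N \<in> {1..M}. (birkhoff_sum \<alpha> f N - birkhoff_mean \<alpha> f M) / B \<le> t})
            - (LBINT x:{..t}. std_normal_density x)\<bar>
    \<le> \<delta> + (8 * (real J * \<epsilon>) + 88 * (real J * \<epsilon>) * Y / (\<delta> * B) + 768 * (real J * \<epsilon>) * Y\<^sup>2 / B\<^sup>2 + 2 * sqrt (6144 * real J) * \<beta>\<^sup>2
       + 64 * real J * \<beta> ^ 3 * (7 + 384 * (real J * \<epsilon>) * Y\<^sup>2 / B\<^sup>2 + 1 / \<delta>))"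
    using normal_approximation[OF B[unfolded B_def] \<delta>0, of t] unfolding B_def \<beta>_def .
  also have "\<dots> = \<delta> + (8 * (real J * \<epsilon>) + 88 * (real J * \<epsilon>) * (u * y) / \<delta> + 768 * (real J * \<epsilon>) * (u * y)\<^sup>2 + 2 * sqrt (6144 * real J) * \<beta>\<^sup>2
       + 64 * real J * \<beta> ^ 3 * (7 + 384 * (real J * \<epsilon>) * (u * y)\<^sup>2 + 1 / \<delta>))"
    unfolding uy power_divide by (simp add: mult.commute)
  also have "\<dots> \<le> (1 + 16 * c1 * c2 + 176 * c1 * c2\<^sup>2 + 768 * c1 * c2\<^sup>2 + 160 * sqrt c1 * c3\<^sup>2 
       + 64 * c1 * c3 ^ 3 * (8 + 384 * c1 * c2\<^sup>2)) * \<delta>"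
  proof (rule error_terms[OF k L y \<delta> \<delta>1])
    show "0 \<le> real J * \<epsilon>" using \<epsilon>_pos by simp
    have "real J * \<epsilon> \<le> (c1 * K) * (1 / K ^ 8)"
      using JK lJ(3) \<epsilon>_pos by (intro mult_mono) (auto simp: \<epsilon>_def)
    also have "\<dots> = c1 / K ^ 7" using K by (simp add: field_simps eval_nat_numeral)
    finally show "real J * \<epsilon> \<le> c1 / (k ^ 3) ^ 7" by (simp only: k3)
    show "0 \<le> u" by (simp add: u)
    show "u \<le> c2 * (k ^ 3)\<^sup>2" unfolding k3 by (rule u_le)
    have "1 \<le> 2 * (u * y)" using B2Y B unfolding uy by simp
    also have "\<dots> \<le> 2 * (c2 * K\<^sup>2 * y)" using u_le y by (intro mult_left_mono mult_right_mono) auto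
    finally show "1 \<le> 2 * c2 * (k ^ 3)\<^sup>2 * y" unfolding k3 by (simp add: mult_ac)
    show "real J \<le> c1 * k ^ 3" unfolding k3 by (rule JK)
    show "0 \<le> \<beta>" using V B by (simp add: \<beta>_def)
    have "\<beta> = 96 * real a * (real l)\<^sup>2 * y" by (simp add: \<beta>_def y_def)
    also have "\<dots> \<le> 96 * real a * ((8 / - ln \<alpha> + 1) * ln K)\<^sup>2 * y"
      using lJ(4) y by (intro mult_right_mono mult_left_mono power_mono) auto
    also have "\<dots> = c3 * (ln K)\<^sup>2 * y" by (simp add: c3_def power_mult_distrib mult_ac)
    finally show "\<beta> \<le> c3 * (ln K)\<^sup>2 * y" .
  qed simp
  finally show ?thesis .
qed

text \<open>
  For bounded \<open>M\<close> the standard deviation is at most a multiple of \<open>V\<close>, so the error term is bounded below. The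
  hypothesis \<open>3 \<le> M\<close> keeps \<open>ln (ln M)\<close> away from 0.
\<close>

lemma (in rotation_bv) one_le_error_of_short_orbit:
  assumes M: "3 \<le> M" "M \<le> M0" and B: "birkhoff_sd \<alpha> f M > 0"
  shows "1 \<le> (6 * real M0 / (ln (ln 3))\<^sup>2) * (V * ln (real M) powr (1/3) * (ln (ln (real M)))\<^sup>2 / birkhoff_sd \<alpha> f M)"
proof -
  define B where "B = birkhoff_sd \<alpha> f M"
  have "B \<le> 2 * (3 * real M * V)"
    unfolding B_def
  proof (rule birkhoff_sd_le)
    fix N assume "N \<in> {1..M}"
    then have "3 * real N * V \<le> 3 * real M * V" using V_nonneg by (intro mult_right_mono) auto
    then show "\<bar>birkhoff_sum \<alpha> f N\<bar> \<le> 3 * real M * V" using birkhoff_sum_trivial_bound[of N] by linarith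
  qed (use M in simp)
  also have "\<dots> \<le> 6 * real M0 * V"
    using M V_nonneg mult_right_mono[of "real M" "real M0" V] by simp
  finally have B_le: "B \<le> 6 * real M0 * V" .
  have B0: "B > 0" using B by (simp add: B_def)
  have ln3: "1 < ln (3::real)" 
  proof -
    have "exp 1 < (3::real)" using e_less_272 by simp
    then have "ln (exp 1) < ln (3::real)" by (subst ln_less_cancel_iff) auto
    then show ?thesis by simp
  qed
  define L0 where "L0 = ln (ln (3::real))"
  have L0: "L0 > 0" using ln3 by (simp add: L0_def)
  have lnM: "ln 3 \<le> ln (real M)" using M by simp
  have "L0 \<le> ln (ln (real M))" unfolding L0_def using lnM ln3 by simp
  then have "1 * L0\<^sup>2 \<le> ln (real M) powr (1/3) * (ln (ln (real M)))\<^sup>2"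
    using L0 ln3 lnM by (intro mult_mono power_mono ge_one_powr_ge_zero) auto
  moreover have "0 \<le> 6 * real M0 * V" using B_le B0 by linarith
  ultimately have "B * L0\<^sup>2 \<le> (6 * real M0 * V) * (ln (real M) powr (1/3) * (ln (ln (real M)))\<^sup>2)"
    using B_le by (intro mult_mono) simp_all
  then have "1 \<le> (6 * real M0 * V) * (ln (real M) powr (1/3) * (ln (ln (real M)))\<^sup>2) / (B * L0\<^sup>2)"
    using B0 L0 by simp
  then show ?thesis unfolding B_def[symmetric] L0_def[symmetric] by (simp add: mult_ac)
qed

lemma (in quadratic_rotation) uniform_normal_approximation:
  "\<exists>C::real. \<forall>f v V M t. rotation_bv a \<alpha> f v V \<longrightarrow> M \<ge> 3 \<longrightarrow> birkhoff_sd \<alpha> f M > 0 \<longrightarrow>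
     \<bar>(1 / real M) * real (card {N \<in> {1..M}. (birkhoff_sum \<alpha> f N - birkhoff_mean \<alpha> f M) / birkhoff_sd \<alpha> f M \<le> t})
        - (LBINT x:{..t}. std_normal_density x)\<bar>
     \<le> C * (V * ln (real M) powr (1/3) * (ln (ln (real M)))\<^sup>2 / birkhoff_sd \<alpha> f M)"
proof -
  have "eventually (\<lambda>K. 3 \<le> K \<and> 8 * ln K + - ln \<alpha> \<le> K) at_top"
    by (intro eventually_conj) real_asymp+
  then obtain K0 where K0: "\<And>K. K0 \<le> K \<Longrightarrow> 3 \<le> K \<and> 8 * ln K + - ln \<alpha> \<le> K"
    by (auto simp: eventually_at_top_linorder)
  define M0 where "M0 = nat \<lceil>exp K0\<rceil>"
  define c1 where "c1 = 2 / - ln \<alpha>"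
  define c2 where "c2 = 48 * real a * c1\<^sup>2"
  define c3 where "c3 = 96 * real a * (8 / - ln \<alpha> + 1)\<^sup>2"
  define C1 where "C1 = 1 + 16 * c1 * c2 + 176 * c1 * c2\<^sup>2 + 768 * c1 * c2\<^sup>2 + 160 * sqrt c1 * c3\<^sup>2 
       + 64 * c1 * c3 ^ 3 * (8 + 384 * c1 * c2\<^sup>2)"
  define C2 where "C2 = 6 * real M0 / (ln (ln 3))\<^sup>2"
  have "0 < - ln \<alpha>" using \<alpha>_pos \<alpha>_lt_1 by simp
  then have c: "0 \<le> c1" "0 \<le> c2" "0 \<le> c3" by (simp_all add: c1_def c2_def c3_def)
  have C1: "1 \<le> C1" unfolding C1_def using c by (simp add: add_nonneg_nonneg add.assoc)
  have C2: "0 \<le> C2" by (simp add: C2_def)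
  show ?thesis
  proof (intro exI[of _ "C1 + C2"] allI impI)
    fix f v :: "real \<Rightarrow> real" and V t :: real and M :: nat
    assume "rotation_bv a \<alpha> f v V" and M: "M \<ge> 3" and B: "birkhoff_sd \<alpha> f M > 0"
    then interpret rotation_bv a \<alpha> f v V by simp
    define \<delta> where "\<delta> = V * ln (real M) powr (1/3) * (ln (ln (real M)))\<^sup>2 / birkhoff_sd \<alpha> f M"
    have \<delta>0: "0 \<le> \<delta>" using V_nonneg B by (simp add: \<delta>_def)
    let ?D = "\<bar>(1 / real M) * real (card {N \<in> {1..M}. (birkhoff_sum \<alpha> f N - birkhoff_mean \<alpha> f M) / birkhoff_sd \<alpha> f M \<le> t})
        - (LBINT x:{..t}. std_normal_density x)\<bar>"
    have D1: "?D \<le> 1" by (rule distribution_function_diff_le_1)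
    consider "M \<le> M0" | "\<delta> > 1" | "M0 < M" "\<delta> \<le> 1" by linarith
    then have "?D \<le> C1 * \<delta> + C2 * \<delta>"
    proof cases
      case 1
      have "1 \<le> C2 * \<delta>" unfolding C2_def \<delta>_def by (rule one_le_error_of_short_orbit[OF M 1 B])
      then show ?thesis using D1 C1 \<delta>0 by (simp add: add_increasing)
    next
      case 2
      have "1 * 1 \<le> C1 * \<delta>" using C1 2 by (intro mult_mono) auto
      moreover have "0 \<le> C2 * \<delta>" using C2 \<delta>0 by simp
      ultimately show ?thesis using D1 by linarith
    next
      case 3
      have "exp K0 \<le> real M0" unfolding M0_def by linarith
      then have "exp K0 \<le> real M" using 3 by linarith
      then have "K0 \<le> ln (real M)" using M by (simp add: ln_ge_iff)
      then have K: "3 \<le> ln (real M)" "8 * ln (ln (real M)) + - ln \<alpha> \<le> ln (real M)" using K0 by auto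
      have "?D \<le> C1 * \<delta>"
        using normal_approximation_long_orbit[OF _ K B 3(2)[unfolded \<delta>_def], of t] M
        unfolding C1_def c1_def c2_def c3_def \<delta>_def by linarith
      moreover have "0 \<le> C2 * \<delta>" using C2 \<delta>0 by simp
      ultimately show ?thesis by linarith
    qed
    then show "?D \<le> (C1 + C2) * (V * ln (real M) powr (1/3) * (ln (ln (real M)))\<^sup>2 / birkhoff_sd \<alpha> f M)"
      by (simp add: \<delta>_def[symmetric] distrib_right)
  qed
qed

section \<open>The continued fraction and the theorem\<close>

text \<open>
  The convergents of \<open>[a; a, a, \<dots>]\<close> are the iterates of \<open>x \<mapsto> a + 1 / x\<close>, which contracts the distance to its
  fixed point \<open>\<phi>\<close> by the factor \<open>1 / \<phi>\<close> on \<open>{1..}\<close>.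
\<close>

lemma cfrac_value_constant:
  fixes a :: int
  assumes a: "a \<ge> 1"
  shows "cfrac_value (\<lambda>k. if k = 0 then 0 else a) = (sqrt ((real_of_int a)\<^sup>2 + 4) - real_of_int a) / 2"
proof -
  define s where "s = sqrt ((real_of_int a)\<^sup>2 + 4)"
  define \<phi> where "\<phi> = (s + real_of_int a) / 2"
  have s2: "s * s = (real_of_int a)\<^sup>2 + 4" unfolding s_def by (simp add: real_sqrt_mult_self)
  have s_gt: "s > 1" unfolding s_def using a by (intro real_less_rsqrt) (simp add: add_pos_nonneg power2_eq_square)
  have \<phi>_gt: "\<phi> > 1" using s_gt a by (simp add: \<phi>_def)
  have \<phi>_eq: "\<phi> = real_of_int a + 1 / \<phi>"
  proof -
    have "\<phi> * \<phi> = real_of_int a * \<phi> + 1"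
      unfolding \<phi>_def using s2 by (simp add: field_simps power2_eq_square)
    then show ?thesis using \<phi>_gt by (simp add: field_simps)
  qed
  define c where "c = (\<lambda>n. cfrac_convergent n (\<lambda>_. a))"
  have c_ge: "c n \<ge> 1" for n
  proof (induction n)
    case (Suc n)
    then show ?case using a by (simp add: c_def add_increasing2)
  qed (use a in \<open>simp add: c_def\<close>)
  have contract: "\<bar>c n - \<phi>\<bar> \<le> (1 / \<phi>) ^ n * \<bar>c 0 - \<phi>\<bar>" for n
  proof (induction n)
    case (Suc n)
    have "c (Suc n) - \<phi> = 1 / c n - 1 / \<phi>" using \<phi>_eq by (simp add: c_def)
    also have "\<dots> = (\<phi> - c n) / (c n * \<phi>)" using c_ge[of n] \<phi>_gt by (simp add: field_simps)
    finally have "\<bar>c (Suc n) - \<phi>\<bar> = \<bar>c n - \<phi>\<bar> / (c n * \<phi>)"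
      using c_ge[of n] \<phi>_gt by (simp add: abs_minus_commute abs_mult)
    also have "\<dots> \<le> \<bar>c n - \<phi>\<bar> / (1 * \<phi>)"
      using c_ge[of n] \<phi>_gt by (intro divide_left_mono mult_right_mono) auto
    also have "\<dots> \<le> ((1 / \<phi>) ^ n * \<bar>c 0 - \<phi>\<bar>) / (1 * \<phi>)"
      using Suc \<phi>_gt by (intro divide_right_mono) auto
    finally show ?case by simp
  qed simp
  have "(\<lambda>n. (1 / \<phi>) ^ n * \<bar>c 0 - \<phi>\<bar>) \<longlonglongrightarrow> 0 * \<bar>c 0 - \<phi>\<bar>"
    by (rule tendsto_mult_right, rule LIMSEQ_power_zero) (use \<phi>_gt in simp)
  then have "(\<lambda>n. (1 / \<phi>) ^ n * \<bar>c 0 - \<phi>\<bar>) \<longlonglongrightarrow> 0" by (simp only: mult_zero_left)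
  then have "(\<lambda>n. c n - \<phi>) \<longlonglongrightarrow> 0"
    by (rule Lim_null_comparison[rotated])
       (rule always_eventually, rule allI, simp only: real_norm_def contract)
  then have "c \<longlonglongrightarrow> \<phi>" by (rule LIM_zero_cancel)
  then have "(\<lambda>n. 1 / c n) \<longlonglongrightarrow> 1 / \<phi>"
    by (rule tendsto_divide[OF tendsto_const]) (use \<phi>_gt in simp)
  then have "(\<lambda>n. cfrac_convergent (Suc n) (\<lambda>k. if k = 0 then 0 else a)) \<longlonglongrightarrow> 1 / \<phi>"
    by (simp add: c_def)
  then have "(\<lambda>n. cfrac_convergent n (\<lambda>k. if k = 0 then 0 else a)) \<longlonglongrightarrow> 1 / \<phi>"
    by (rule LIMSEQ_imp_Suc)
  then have "cfrac_value (\<lambda>k. if k = 0 then 0 else a) = 1 / \<phi>"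
    unfolding cfrac_value_def by (rule limI)
  also have "\<dots> = (s - real_of_int a) / 2"
    using \<phi>_eq by (simp add: \<phi>_def field_simps)
  finally show ?thesis by (simp add: s_def)
qed

theorem theorem6:
  fixes a :: int and \<alpha> :: real
  assumes "a \<ge> 1"
    and "\<alpha> = cfrac_value (\<lambda>k. if k = 0 then 0 else a)"
  shows "\<alpha> = (sqrt ((real_of_int a)\<^sup>2 + 4) - real_of_int a) / 2
    \<and> (\<exists>C::real. \<forall>(f :: real \<Rightarrow> real) (M :: nat) (t :: real).
         (\<forall>x. f (x + 1) = f x) \<longrightarrow>
         bounded_variation_on f 0 1 \<longrightarrow>
         (f has_integral 0) {0..1} \<longrightarrow>
         M \<ge> 3 \<longrightarrow>
         birkhoff_sd \<alpha> f M > 0 \<longrightarrow>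
         \<bar>(1 / real M) * real (card {N \<in> {1..M}.
              (birkhoff_sum \<alpha> f N - birkhoff_mean \<alpha> f M) / birkhoff_sd \<alpha> f M \<le> t})
            - (LBINT x:{..t}. exp (- x\<^sup>2 / 2) / sqrt (2 * pi))\<bar>
           \<le> C * (total_variation f 0 1 * (ln (real M)) powr (1/3) * (ln (ln (real M)))\<^sup>2
                    / birkhoff_sd \<alpha> f M))"
proof (intro conjI)
  show \<alpha>: "\<alpha> = (sqrt ((real_of_int a)\<^sup>2 + 4) - real_of_int a) / 2"
    using cfrac_value_constant[OF assms(1)] assms(2) by simp
  have density: "(\<lambda>x. exp (- x\<^sup>2 / 2) / sqrt (2 * pi)) = std_normal_density"
    by (simp add: std_normal_density_def fun_eq_iff)
  have "real_of_int a < sqrt ((real_of_int a)\<^sup>2 + 4)"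
    using assms(1) by (intro real_less_rsqrt) auto
  then interpret quadratic_rotation "nat a" \<alpha>
  proof unfold_locales
    have sq: "(sqrt ((real_of_int a)\<^sup>2 + 4))\<^sup>2 = (real_of_int a)\<^sup>2 + 4" by simp
    have "real (nat a) = real_of_int a" using assms(1) by simp
    then show "\<alpha>\<^sup>2 + real (nat a) * \<alpha> = 1"
      unfolding \<alpha> using sq by (simp add: power2_eq_square field_simps)
  qed (use assms(1) \<alpha> in auto)
  obtain C where C: "\<And>f v V M t. rotation_bv (nat a) \<alpha> f v V \<Longrightarrow> M \<ge> 3 \<Longrightarrow> birkhoff_sd \<alpha> f M > 0 \<Longrightarrow>
     \<bar>(1 / real M) * real (card {N \<in> {1..M}. (birkhoff_sum \<alpha> f N - birkhoff_mean \<alpha> f M) / birkhoff_sd \<alpha> f M \<le> t})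
        - (LBINT x:{..t}. std_normal_density x)\<bar>
     \<le> C * (V * ln (real M) powr (1/3) * (ln (ln (real M)))\<^sup>2 / birkhoff_sd \<alpha> f M)"
    using uniform_normal_approximation by blast
  show "\<exists>C::real. \<forall>(f :: real \<Rightarrow> real) (M :: nat) (t :: real).
         (\<forall>x. f (x + 1) = f x) \<longrightarrow>
         bounded_variation_on f 0 1 \<longrightarrow>
         (f has_integral 0) {0..1} \<longrightarrow>
         M \<ge> 3 \<longrightarrow>
         birkhoff_sd \<alpha> f M > 0 \<longrightarrow>
         \<bar>(1 / real M) * real (card {N \<in> {1..M}.
              (birkhoff_sum \<alpha> f N - birkhoff_mean \<alpha> f M) / birkhoff_sd \<alpha> f M \<le> t})
            - (LBINT x:{..t}. exp (- x\<^sup>2 / 2) / sqrt (2 * pi))\<bar>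
           \<le> C * (total_variation f 0 1 * (ln (real M)) powr (1/3) * (ln (ln (real M)))\<^sup>2
                    / birkhoff_sd \<alpha> f M)"
    unfolding density
  proof (intro exI[of _ C] allI impI)
    fix f :: "real \<Rightarrow> real" and M :: nat and t :: real
    assume per: "\<forall>x. f (x + 1) = f x" and bv: "bounded_variation_on f 0 1"
      and mean: "(f has_integral 0) {0..1}" and M: "M \<ge> 3" "birkhoff_sd \<alpha> f M > 0"
    obtain v where "\<And>x. v (x + 1) = v x + total_variation f 0 1"
      "\<And>x y. x \<le> y \<Longrightarrow> \<bar>f y - f x\<bar> \<le> v y - v x"
      using bounded_variation_majorant[of f] per bv by blast
    then have "rotation_bv (nat a) \<alpha> f v (total_variation f 0 1)"
      using per mean by unfold_locales auto
    then show "\<bar>(1 / real M) * real (card {N \<in> {1..M}.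
              (birkhoff_sum \<alpha> f N - birkhoff_mean \<alpha> f M) / birkhoff_sd \<alpha> f M \<le> t})
            - (LBINT x:{..t}. std_normal_density x)\<bar>
           \<le> C * (total_variation f 0 1 * (ln (real M)) powr (1/3) * (ln (ln (real M)))\<^sup>2
                    / birkhoff_sd \<alpha> f M)"
      using M by (rule C)
  qed
qed

end
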